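(* Let $V=\mathbb R\times M$ be a standard stationary spacetime with metric $g=-dt^2+\pi^*\omega\otimes dt+dt\otimes\pi^*\omega+\pi^*g_0$. If $M_B^+$ is Hausdorff then the map $$\pi^+_{x_0}:B^+(M)\to\mathbb R\times M_B^+,\qquad b_c^+\mapsto(b_c^+(x_0),[b_c^+]),$$ is a homeomorphism for all $x_0\in M$. So, in this case, the future causal completion $\hat V\equiv B^+(M)\cup\{\infty\}$ is a (topological) cone with base $M_B^+$ and apex $i^+$, and the future causal boundary $\hat\partial V$ is also a (topological) cone with base $\partial_B^+M$ and apex $i^+$.
   Context: $M$ is a connected smooth manifold, $g_0$ a Riemannian metric and $\omega$ a 1-form on $M$, $t$ and $\pi$ the projections of $\mathbb R\times M$, $\partial_t$ future-directed. $F^+(v)=\sqrt{g_0(v,v)+\omega(v)^2}+\omega(v)$ is a (Finsler) Fermat metric and $d^+(x,y)$ is the infimum of the $F^+$-lengths of piecewise smooth curves from $x$ to $y$. Causal objects. $p\ll q$ if there is a future-directed timelike curve from $p$ to $q$; $I^-(p)=\{q:q\ll p\}$. A non-empty $P\subset V$ is a past set if $P=\bigcup_{p\in P}I^-(p)$; an IP is a past set which is not the union of two proper subsets which are past sets; a PIP is an IP of the form $I^-(p)$, $p\in V$; other IPs are TIPs. $\hat V$ is the set of IPs and $\hat\partial V$ the set of TIPs. For a sequence of IPs, $\hat L(\{P_n\})=\{P'\in\hat V:P'\subset\liminf P_n$ and $P'$ is a maximal IP in $\limsup P_n\}$ (set-theoretic limits); $C\subset\hat V$ is closed (chronological topology)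 iff $\hat L(\sigma)\subset C$ for each sequence $\sigma\subset C$. $\hat\partial V$ carries the induced topology. Busemann functions. $C^+(M)$ is the set of piecewise smooth curves $c:[\alpha,\Omega)\to M$, $\Omega\le\infty$, with $F^+(\dot c)<1$; $b_c^+(x)=\lim_{s\to\Omega}(s-d^+(x,c(s)))\in(-\infty,\infty]$; $B^+(M)$ is the set of the finite $b_c^+$. For $\sigma=\{f_n\}\subset B^+(M)$, $f\in\hat L(\sigma)$ iff $f\le\liminf f_n$ and every $g\in B^+(M)$ with $f\le g\le\limsup f_n$ equals $f$; $C\subset B^+(M)$ is closed (chronological topology) iff $\hat L(\sigma)\subset C$ for every sequence $\sigma\subset C$. $M_B^+=B^+(M)/\mathbb R$ (modulo additive constants) with the quotient topology; $M$ is included in it by $x\mapsto[-d^+(\cdot,x)]$ and $\partial_B^+M=M_B^+\setminus M$. The identification $\hat V\equiv B^+(M)\cup\{\infty\}$ sends $b$ to $P(b)=\{(t,x):t<b(x)\}$ and $\infty$ to the TIP $i^+:=V$. Cone. The (forward) cone with base a topological space $T$ is the quotient space $((-\infty,\infty]\times T)/\sim$ identifying all the points $(\infty,x)$, $x\in T$, to a single point, its apex. *)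

theory Defs
  imports "HOL-Analysis.Analysis"
begin

section \<open>Topologies\<close>

text \<open>The sequential topology on \<open>X\<close> determined by a limit operator \<open>L\<close>: a set
  \<open>C \<subseteq> X\<close> is closed iff \<open>L \<sigma> \<subseteq> C\<close> for every sequence \<open>\<sigma>\<close> in \<open>C\<close>.\<close>

definition limit_topology :: "'a set \<Rightarrow> ((nat \<Rightarrow> 'a) \<Rightarrow> 'a set) \<Rightarrow> 'a topology" where
  "limit_topology X L =
     topology (\<lambda>U. U \<subseteq> X \<and> (\<forall>\<sigma>. range \<sigma> \<subseteq> X - U \<longrightarrow> L \<sigma> \<subseteq> X - U))"

lemma istopology_limit:
  assumes L: "\<And>\<sigma>. L \<sigma> \<subseteq> X"
    and sub: "\<And>\<sigma> r. strict_mono (r :: nat \<Rightarrow> nat) \<Longrightarrow> L \<sigma> \<subseteq> L (\<sigma> \<circ> r)"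
  shows "istopology (\<lambda>U. U \<subseteq> X \<and> (\<forall>\<sigma>. range \<sigma> \<subseteq> X - U \<longrightarrow> L \<sigma> \<subseteq> X - U))"
  unfolding istopology_def
proof (intro conjI allI impI)
  fix S T
  assume S: "S \<subseteq> X \<and> (\<forall>\<sigma>. range \<sigma> \<subseteq> X - S \<longrightarrow> L \<sigma> \<subseteq> X - S)"
    and T: "T \<subseteq> X \<and> (\<forall>\<sigma>. range \<sigma> \<subseteq> X - T \<longrightarrow> L \<sigma> \<subseteq> X - T)"
  show "S \<inter> T \<subseteq> X" using S by blast
  fix \<sigma> :: "nat \<Rightarrow> 'a" assume \<sigma>: "range \<sigma> \<subseteq> X - S \<inter> T"
  have *: "L \<sigma> \<subseteq> X - W" if inf: "infinite {n. \<sigma> n \<notin> W}"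
    and W: "\<And>\<tau>. range \<tau> \<subseteq> X - W \<Longrightarrow> L \<tau> \<subseteq> X - W" for W
  proof -
    obtain r :: "nat \<Rightarrow> nat" where r: "strict_mono r" "\<And>n. r n \<in> {n. \<sigma> n \<notin> W}"
      using infinite_enumerate[OF inf] by blast
    have "range (\<sigma> \<circ> r) \<subseteq> X - W" using r(2) \<sigma> by auto
    then show ?thesis using W sub[OF r(1)] by blast
  qed
  have "{n. \<sigma> n \<notin> S} \<union> {n. \<sigma> n \<notin> T} = UNIV" using \<sigma> by auto
  then have "infinite {n. \<sigma> n \<notin> S} \<or> infinite {n. \<sigma> n \<notin> T}"
    by (metis finite_UnI infinite_UNIV_nat)
  then have "L \<sigma> \<subseteq> X - S \<or> L \<sigma> \<subseteq> X - T" using *[of S] *[of T] S T by blast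
  then show "L \<sigma> \<subseteq> X - S \<inter> T" by blast
next
  fix K assume K: "\<forall>S\<in>K. S \<subseteq> X \<and> (\<forall>\<sigma>. range \<sigma> \<subseteq> X - S \<longrightarrow> L \<sigma> \<subseteq> X - S)"
  show "\<Union>K \<subseteq> X" using K by blast
  fix \<sigma> :: "nat \<Rightarrow> 'a" assume \<sigma>: "range \<sigma> \<subseteq> X - \<Union>K"
  have "L \<sigma> \<subseteq> X - S" if "S \<in> K" for S
    using K that \<sigma> by (metis Diff_mono Union_upper order_refl subset_trans)
  then show "L \<sigma> \<subseteq> X - \<Union>K" using L[of \<sigma>] by blast
qed

text \<open>The final topology on the set \<open>S\<close> with respect to \<open>q\<close>; it is the usual quotient
  topology when \<open>S = q ` topspace X\<close>.\<close>

definition quotient_topology :: "'a topology \<Rightarrow> ('a \<Rightarrow> 'b) \<Rightarrow> 'b set \<Rightarrow> 'b topology" where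
  "quotient_topology X q S =
     topology (\<lambda>U. U \<subseteq> S \<and> openin X {x \<in> topspace X. q x \<in> U})"

lemma openin_quotient_topology:
  "openin (quotient_topology X q S) U \<longleftrightarrow> U \<subseteq> S \<and> openin X {x \<in> topspace X. q x \<in> U}"
proof -
  have "istopology (\<lambda>U. U \<subseteq> S \<and> openin X {x \<in> topspace X. q x \<in> U})"
    unfolding istopology_def
  proof (intro conjI allI impI)
    fix U W assume "U \<subseteq> S \<and> openin X {x \<in> topspace X. q x \<in> U}"
      and "W \<subseteq> S \<and> openin X {x \<in> topspace X. q x \<in> W}"
    moreover have "{x \<in> topspace X. q x \<in> U \<inter> W} =
      {x \<in> topspace X. q x \<in> U} \<inter> {x \<in> topspace X. q x \<in> W}" by blast
    ultimately show "U \<inter> W \<subseteq> S" "openin X {x \<in> topspace X. q x \<in> U \<inter> W}" by auto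
  next
    fix K assume K: "\<forall>U\<in>K. U \<subseteq> S \<and> openin X {x \<in> topspace X. q x \<in> U}"
    show "\<Union>K \<subseteq> S" using K by blast
    have "{x \<in> topspace X. q x \<in> \<Union>K} = (\<Union>U\<in>K. {x \<in> topspace X. q x \<in> U})" by blast
    then show "openin X {x \<in> topspace X. q x \<in> \<Union>K}" using K by auto
  qed
  then show ?thesis unfolding quotient_topology_def by simp
qed

text \<open>The forward cone, as a set of equivalence classes.  For a non-empty base the carrier is
  just the quotient set.  Only for the empty base (e.g. the boundary of a compact manifold) does
  the explicit insertion of the apex matter: the cone over the empty space is its apex.\<close>

definition cone_apex :: "'a topology \<Rightarrow> (ereal \<times> 'a) set" where
  "cone_apex T = {\<infinity>} \<times> topspace T"

definition cone_class :: "'a topology \<Rightarrow> ereal \<times> 'a \<Rightarrow> (ereal \<times> 'a) set" where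
  "cone_class T z = (if fst z = \<infinity> then cone_apex T else {z})"

definition cone_space :: "'a topology \<Rightarrow> (ereal \<times> 'a) set topology" where
  "cone_space T = quotient_topology (prod_topology (top_of_set {- \<infinity> <..}) T) (cone_class T)
     (insert (cone_apex T) (cone_class T ` ({- \<infinity> <..} \<times> topspace T)))"


section \<open>Smooth manifolds\<close>

text \<open>\<open>C\<^sup>k\<close> and smooth maps between Euclidean spaces, on open sets.\<close>

fun Ck_on :: "nat \<Rightarrow> 'a::euclidean_space set \<Rightarrow> ('a \<Rightarrow> 'b::euclidean_space) \<Rightarrow> bool" where
  "Ck_on 0 S f = continuous_on S f"
| "Ck_on (Suc k) S f = ((\<forall>x\<in>S. f differentiable at x) \<and>
     (\<forall>v. Ck_on k S (\<lambda>x. frechet_derivative f (at x) v)))"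

definition smooth_on :: "'a::euclidean_space set \<Rightarrow> ('a \<Rightarrow> 'b::euclidean_space) \<Rightarrow> bool" where
  "smooth_on S f \<longleftrightarrow> (\<forall>k. Ck_on k S f)"

text \<open>A manifold modelled on \<open>'e\<close> is a (Hausdorff, second countable) type \<open>'m\<close> together with an
  atlas.  A chart \<open>(U, \<phi>)\<close> consists of its domain and of a map that is relevant on \<open>U\<close> only.\<close>

type_synonym ('m, 'e) chart = "'m set \<times> ('m \<Rightarrow> 'e)"

definition is_chart :: "('m::topological_space, 'e::euclidean_space) chart \<Rightarrow> bool" where
  "is_chart = (\<lambda>(U, \<phi>). open U \<and> open (\<phi> ` U) \<and> homeomorphism U (\<phi> ` U) \<phi> (inv_into U \<phi>))"

definition smooth_atlas :: "('m::topological_space, 'e::euclidean_space) chart set \<Rightarrow> bool" where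
  "smooth_atlas A \<longleftrightarrow> (\<forall>\<kappa>\<in>A. is_chart \<kappa>) \<and> \<Union>(fst ` A) = UNIV \<and>
     (\<forall>(U, \<phi>)\<in>A. \<forall>(W, \<psi>)\<in>A. smooth_on (\<phi> ` (U \<inter> W)) (\<psi> \<circ> inv_into U \<phi>))"

text \<open>A tangent vector at \<open>p\<close> is the family of its coordinate vectors in all charts of the atlas
  around \<open>p\<close>; these are related by the derivatives of the coordinate changes.  The
  values at other pairs are irrelevant and normalised to \<open>0\<close>.\<close>

type_synonym ('m, 'e) tvec = "('m, 'e) chart \<Rightarrow> 'e"

definition charts_at :: "('m, 'e) chart set \<Rightarrow> 'm \<Rightarrow> ('m, 'e) chart set" where
  "charts_at A p = {\<kappa> \<in> A. p \<in> fst \<kappa>}"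

definition chart_change ::
  "('m, 'e::euclidean_space) chart \<Rightarrow> ('m, 'e) chart \<Rightarrow> 'm \<Rightarrow> 'e \<Rightarrow> 'e" where
  "chart_change \<kappa> \<mu> p = frechet_derivative (snd \<mu> \<circ> inv_into (fst \<kappa>) (snd \<kappa>)) (at (snd \<kappa> p))"

definition tangent_space ::
  "('m, 'e::euclidean_space) chart set \<Rightarrow> 'm \<Rightarrow> ('m, 'e) tvec set" where
  "tangent_space A p = {v. (\<forall>\<kappa>. \<kappa> \<notin> charts_at A p \<longrightarrow> v \<kappa> = 0) \<and>
     (\<forall>\<kappa>\<in>charts_at A p. \<forall>\<mu>\<in>charts_at A p. v \<mu> = chart_change \<kappa> \<mu> p (v \<kappa>))}"

text \<open>The tangent vector at \<open>p\<close> whose coordinates in the chart \<open>\<kappa>\<close> are \<open>a\<close>.\<close>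

definition coord_vec ::
  "('m, 'e::euclidean_space) chart set \<Rightarrow> ('m, 'e) chart \<Rightarrow> 'm \<Rightarrow> 'e \<Rightarrow> ('m, 'e) tvec" where
  "coord_vec A \<kappa> p a = (\<lambda>\<mu>. if \<mu> \<in> charts_at A p then chart_change \<kappa> \<mu> p a else 0)"

definition one_form ::
  "('m, 'e::euclidean_space) chart set \<Rightarrow> ('m \<Rightarrow> ('m, 'e) tvec \<Rightarrow> real) \<Rightarrow> bool" where
  "one_form A \<omega> \<longleftrightarrow>
     (\<forall>p. \<forall>u\<in>tangent_space A p. \<forall>v\<in>tangent_space A p. \<forall>r s.
        \<omega> p (\<lambda>\<kappa>. r *\<^sub>R u \<kappa> + s *\<^sub>R v \<kappa>) = r * \<omega> p u + s * \<omega> p v) \<and>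
     (\<forall>\<kappa>\<in>A. \<forall>a. smooth_on (snd \<kappa> ` fst \<kappa>)
        (\<lambda>y. let p = inv_into (fst \<kappa>) (snd \<kappa>) y in \<omega> p (coord_vec A \<kappa> p a)))"

definition riemannian_metric ::
  "('m, 'e::euclidean_space) chart set \<Rightarrow>
   ('m \<Rightarrow> ('m, 'e) tvec \<Rightarrow> ('m, 'e) tvec \<Rightarrow> real) \<Rightarrow> bool" where
  "riemannian_metric A g \<longleftrightarrow>
     (\<forall>p. \<forall>u\<in>tangent_space A p. \<forall>v\<in>tangent_space A p. \<forall>w\<in>tangent_space A p. \<forall>r s.
        g p (\<lambda>\<kappa>. r *\<^sub>R u \<kappa> + s *\<^sub>R v \<kappa>) w = r * g p u w + s * g p v w) \<and>
     (\<forall>p. \<forall>u\<in>tangent_space A p. \<forall>v\<in>tangent_space A p. g p u v = g p v u) \<and>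
     (\<forall>p. \<forall>v\<in>tangent_space A p. v \<noteq> (\<lambda>_. 0) \<longrightarrow> 0 < g p v v) \<and>
     (\<forall>\<kappa>\<in>A. \<forall>a b. smooth_on (snd \<kappa> ` fst \<kappa>)
        (\<lambda>y. let p = inv_into (fst \<kappa>) (snd \<kappa>) y in g p (coord_vec A \<kappa> p a) (coord_vec A \<kappa> p b)))"

text \<open>The differential at \<open>p\<close> of a map \<open>f\<close> between manifolds; it does not depend on the chosen
  chart around \<open>p\<close>.\<close>

definition differential ::
  "('m, 'e::euclidean_space) chart set \<Rightarrow> ('n, 'f::euclidean_space) chart set \<Rightarrow> ('m \<Rightarrow> 'n) \<Rightarrow>
   'm \<Rightarrow> ('m, 'e) tvec \<Rightarrow> ('n, 'f) tvec" where
  "differential A B f p v = (\<lambda>\<mu>. if \<mu> \<in> charts_at B (f p)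
     then let \<kappa> = (SOME \<kappa>. \<kappa> \<in> charts_at A p)
          in frechet_derivative (snd \<mu> \<circ> f \<circ> inv_into (fst \<kappa>) (snd \<kappa>)) (at (snd \<kappa> p)) (v \<kappa>)
     else 0)"

definition real_atlas :: "(real, real) chart set" where
  "real_atlas = {(UNIV, id)}"

definition prod_atlas ::
  "('m, 'e) chart set \<Rightarrow> ('n, 'f) chart set \<Rightarrow> ('m \<times> 'n, 'e \<times> 'f) chart set" where
  "prod_atlas A B = (\<lambda>((U, \<phi>), (W, \<psi>)). (U \<times> W, map_prod \<phi> \<psi>)) ` (A \<times> B)"

subsection \<open>Curves\<close>

text \<open>Smoothness on an arbitrary set \<open>S\<close> of parameters (e.g. a compact interval) means local
  smooth extendability.  On a compact interval the velocity at the end points is one-sided.\<close>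

definition smooth_curve_on ::
  "('m, 'e::euclidean_space) chart set \<Rightarrow> real set \<Rightarrow> (real \<Rightarrow> 'm) \<Rightarrow> bool" where
  "smooth_curve_on A S c \<longleftrightarrow> (\<forall>s\<in>S. \<forall>(U, \<phi>)\<in>charts_at A (c s). \<exists>\<epsilon>>0. \<exists>h.
     smooth_on (ball s \<epsilon>) h \<and> (\<forall>r\<in>S \<inter> ball s \<epsilon>. c r \<in> U \<and> \<phi> (c r) = h r))"

definition velocity ::
  "('m, 'e::euclidean_space) chart set \<Rightarrow> (real \<Rightarrow> 'm) \<Rightarrow> real set \<Rightarrow> real \<Rightarrow> ('m, 'e) tvec" where
  "velocity A c S s = (\<lambda>\<kappa>. if \<kappa> \<in> charts_at A (c s)
     then vector_derivative (snd \<kappa> \<circ> c) (at s within S) else 0)"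

text \<open>Break points may accumulate only at an end of the interval \<open>I\<close> which does not
  belong to \<open>I\<close>.\<close>

definition piecewise_smooth_on ::
  "('m, 'e::euclidean_space) chart set \<Rightarrow> real set \<Rightarrow> (real \<Rightarrow> 'm) \<Rightarrow> bool" where
  "piecewise_smooth_on A I c \<longleftrightarrow> (\<exists>S. (\<forall>a b. {a..b} \<subseteq> I \<longrightarrow> finite (S \<inter> {a..b})) \<and>
     (\<forall>a b. a < b \<and> {a..b} \<subseteq> I \<and> S \<inter> {a<..<b} = {} \<longrightarrow> smooth_curve_on A {a..b} c))"

text \<open>All velocities, including both one-sided ones at break points, satisfy \<open>Q\<close>.\<close>

definition velocities_satisfy ::
  "('m, 'e::euclidean_space) chart set \<Rightarrow> real set \<Rightarrow> (real \<Rightarrow> 'm) \<Rightarrow>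
   ('m \<Rightarrow> ('m, 'e) tvec \<Rightarrow> bool) \<Rightarrow> bool" where
  "velocities_satisfy A I c Q \<longleftrightarrow>
     (\<forall>a b. a < b \<and> {a..b} \<subseteq> I \<and> smooth_curve_on A {a..b} c \<longrightarrow>
        (\<forall>s\<in>{a..b}. Q (c s) (velocity A c {a..b} s)))"


section \<open>Fermat metric and Busemann functions\<close>

definition fermat_metric ::
  "('m \<Rightarrow> ('m, 'e) tvec \<Rightarrow> ('m, 'e) tvec \<Rightarrow> real) \<Rightarrow> ('m \<Rightarrow> ('m, 'e) tvec \<Rightarrow> real) \<Rightarrow>
   'm \<Rightarrow> ('m, 'e) tvec \<Rightarrow> real" where
  "fermat_metric g0 \<omega> p v = sqrt (g0 p v v + (\<omega> p v)\<^sup>2) + \<omega> p v"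

definition fermat_length ::
  "('m, 'e::euclidean_space) chart set \<Rightarrow> ('m \<Rightarrow> ('m, 'e) tvec \<Rightarrow> ('m, 'e) tvec \<Rightarrow> real) \<Rightarrow>
   ('m \<Rightarrow> ('m, 'e) tvec \<Rightarrow> real) \<Rightarrow> real \<Rightarrow> real \<Rightarrow> (real \<Rightarrow> 'm) \<Rightarrow> real" where
  "fermat_length A g0 \<omega> a b c =
     integral {a..b} (\<lambda>s. fermat_metric g0 \<omega> (c s) (velocity A c {a..b} s))"

definition fermat_dist ::
  "('m, 'e::euclidean_space) chart set \<Rightarrow> ('m \<Rightarrow> ('m, 'e) tvec \<Rightarrow> ('m, 'e) tvec \<Rightarrow> real) \<Rightarrow>
   ('m \<Rightarrow> ('m, 'e) tvec \<Rightarrow> real) \<Rightarrow> 'm \<Rightarrow> 'm \<Rightarrow> real" where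
  "fermat_dist A g0 \<omega> x y = Inf {fermat_length A g0 \<omega> a b c | a b c.
     a < b \<and> piecewise_smooth_on A {a..b} c \<and> c a = x \<and> c b = y}"

text \<open>Membership in \<open>C\<^sup>+(M)\<close> of a curve \<open>c\<close> with domain \<open>[\<alpha>, \<Omega>)\<close>.\<close>

definition C_plus ::
  "('m, 'e::euclidean_space) chart set \<Rightarrow> ('m \<Rightarrow> ('m, 'e) tvec \<Rightarrow> ('m, 'e) tvec \<Rightarrow> real) \<Rightarrow>
   ('m \<Rightarrow> ('m, 'e) tvec \<Rightarrow> real) \<Rightarrow> real \<Rightarrow> ereal \<Rightarrow> (real \<Rightarrow> 'm) \<Rightarrow> bool" where
  "C_plus A g0 \<omega> \<alpha> \<Omega> c \<longleftrightarrow> ereal \<alpha> < \<Omega> \<and>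
     piecewise_smooth_on A {s. \<alpha> \<le> s \<and> ereal s < \<Omega>} c \<and>
     velocities_satisfy A {s. \<alpha> \<le> s \<and> ereal s < \<Omega>} c (\<lambda>p v. fermat_metric g0 \<omega> p v < 1)"

definition busemann ::
  "('m, 'e::euclidean_space) chart set \<Rightarrow> ('m \<Rightarrow> ('m, 'e) tvec \<Rightarrow> ('m, 'e) tvec \<Rightarrow> real) \<Rightarrow>
   ('m \<Rightarrow> ('m, 'e) tvec \<Rightarrow> real) \<Rightarrow> ereal \<Rightarrow> (real \<Rightarrow> 'm) \<Rightarrow> 'm \<Rightarrow> ereal" where
  "busemann A g0 \<omega> \<Omega> c x =
     Lim (filtercomap ereal (at_left \<Omega>)) (\<lambda>s. ereal (s - fermat_dist A g0 \<omega> x (c s)))"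

definition B_plus ::
  "('m, 'e::euclidean_space) chart set \<Rightarrow> ('m \<Rightarrow> ('m, 'e) tvec \<Rightarrow> ('m, 'e) tvec \<Rightarrow> real) \<Rightarrow>
   ('m \<Rightarrow> ('m, 'e) tvec \<Rightarrow> real) \<Rightarrow> ('m \<Rightarrow> real) set" where
  "B_plus A g0 \<omega> =
     {f. \<exists>\<alpha> \<Omega> c. C_plus A g0 \<omega> \<alpha> \<Omega> c \<and> (\<forall>x. busemann A g0 \<omega> \<Omega> c x = ereal (f x))}"

definition B_limit ::
  "('m, 'e::euclidean_space) chart set \<Rightarrow> ('m \<Rightarrow> ('m, 'e) tvec \<Rightarrow> ('m, 'e) tvec \<Rightarrow> real) \<Rightarrow>
   ('m \<Rightarrow> ('m, 'e) tvec \<Rightarrow> real) \<Rightarrow> (nat \<Rightarrow> 'm \<Rightarrow> real) \<Rightarrow> ('m \<Rightarrow> real) set" where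
  "B_limit A g0 \<omega> \<sigma> = {f \<in> B_plus A g0 \<omega>.
     (\<forall>x. ereal (f x) \<le> liminf (\<lambda>n. ereal (\<sigma> n x))) \<and>
     (\<forall>g\<in>B_plus A g0 \<omega>. f \<le> g \<and> (\<forall>x. ereal (g x) \<le> limsup (\<lambda>n. ereal (\<sigma> n x))) \<longrightarrow> g = f)}"

definition B_topology ::
  "('m, 'e::euclidean_space) chart set \<Rightarrow> ('m \<Rightarrow> ('m, 'e) tvec \<Rightarrow> ('m, 'e) tvec \<Rightarrow> real) \<Rightarrow>
   ('m \<Rightarrow> ('m, 'e) tvec \<Rightarrow> real) \<Rightarrow> ('m \<Rightarrow> real) topology" where
  "B_topology A g0 \<omega> = limit_topology (B_plus A g0 \<omega>) (B_limit A g0 \<omega>)"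

definition B_class ::
  "('m, 'e::euclidean_space) chart set \<Rightarrow> ('m \<Rightarrow> ('m, 'e) tvec \<Rightarrow> ('m, 'e) tvec \<Rightarrow> real) \<Rightarrow>
   ('m \<Rightarrow> ('m, 'e) tvec \<Rightarrow> real) \<Rightarrow> ('m \<Rightarrow> real) \<Rightarrow> ('m \<Rightarrow> real) set" where
  "B_class A g0 \<omega> f = {g \<in> B_plus A g0 \<omega>. \<exists>k. \<forall>x. g x = f x + k}"

definition M_B ::
  "('m, 'e::euclidean_space) chart set \<Rightarrow> ('m \<Rightarrow> ('m, 'e) tvec \<Rightarrow> ('m, 'e) tvec \<Rightarrow> real) \<Rightarrow>
   ('m \<Rightarrow> ('m, 'e) tvec \<Rightarrow> real) \<Rightarrow> ('m \<Rightarrow> real) set topology" where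
  "M_B A g0 \<omega> =
     quotient_topology (B_topology A g0 \<omega>) (B_class A g0 \<omega>) (B_class A g0 \<omega> ` B_plus A g0 \<omega>)"

definition M_embedding ::
  "('m, 'e::euclidean_space) chart set \<Rightarrow> ('m \<Rightarrow> ('m, 'e) tvec \<Rightarrow> ('m, 'e) tvec \<Rightarrow> real) \<Rightarrow>
   ('m \<Rightarrow> ('m, 'e) tvec \<Rightarrow> real) \<Rightarrow> 'm \<Rightarrow> ('m \<Rightarrow> real) set" where
  "M_embedding A g0 \<omega> x = B_class A g0 \<omega> (\<lambda>y. - fermat_dist A g0 \<omega> y x)"

definition boundary_M_B ::
  "('m, 'e::euclidean_space) chart set \<Rightarrow> ('m \<Rightarrow> ('m, 'e) tvec \<Rightarrow> ('m, 'e) tvec \<Rightarrow> real) \<Rightarrow>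
   ('m \<Rightarrow> ('m, 'e) tvec \<Rightarrow> real) \<Rightarrow> ('m \<Rightarrow> real) set topology" where
  "boundary_M_B A g0 \<omega> =
     subtopology (M_B A g0 \<omega>) (topspace (M_B A g0 \<omega>) - range (M_embedding A g0 \<omega>))"


section \<open>The standard stationary spacetime and its future causal completion\<close>

definition V_atlas :: "('m, 'e) chart set \<Rightarrow> (real \<times> 'm, real \<times> 'e) chart set" where
  "V_atlas A = prod_atlas real_atlas A"

definition dt ::
  "('m, 'e::euclidean_space) chart set \<Rightarrow> real \<times> 'm \<Rightarrow> (real \<times> 'm, real \<times> 'e) tvec \<Rightarrow> real" where
  "dt A p v = differential (V_atlas A) real_atlas fst p v (UNIV, id)"

definition dpi ::
  "('m, 'e::euclidean_space) chart set \<Rightarrow> real \<times> 'm \<Rightarrow> (real \<times> 'm, real \<times> 'e) tvec \<Rightarrow>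
   ('m, 'e) tvec" where
  "dpi A p v = differential (V_atlas A) A snd p v"

definition stationary_metric ::
  "('m, 'e::euclidean_space) chart set \<Rightarrow> ('m \<Rightarrow> ('m, 'e) tvec \<Rightarrow> ('m, 'e) tvec \<Rightarrow> real) \<Rightarrow>
   ('m \<Rightarrow> ('m, 'e) tvec \<Rightarrow> real) \<Rightarrow> real \<times> 'm \<Rightarrow> (real \<times> 'm, real \<times> 'e) tvec \<Rightarrow>
   (real \<times> 'm, real \<times> 'e) tvec \<Rightarrow> real" where
  "stationary_metric A g0 \<omega> p v w =
     - dt A p v * dt A p w
     + \<omega> (snd p) (dpi A p v) * dt A p w + dt A p v * \<omega> (snd p) (dpi A p w)
     + g0 (snd p) (dpi A p v) (dpi A p w)"

definition del_t ::
  "('m, 'e::euclidean_space) chart set \<Rightarrow> real \<times> 'm \<Rightarrow> (real \<times> 'm, real \<times> 'e) tvec" where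
  "del_t A p = velocity (V_atlas A) (\<lambda>s. (s, snd p)) UNIV (fst p)"

text \<open>In signature \<open>(-,+,...,+)\<close>, a timelike vector lies in the time cone of \<open>\<partial>\<^sub>t\<close> iff its
  product with \<open>\<partial>\<^sub>t\<close> is negative.\<close>

definition future_timelike ::
  "('m, 'e::euclidean_space) chart set \<Rightarrow> ('m \<Rightarrow> ('m, 'e) tvec \<Rightarrow> ('m, 'e) tvec \<Rightarrow> real) \<Rightarrow>
   ('m \<Rightarrow> ('m, 'e) tvec \<Rightarrow> real) \<Rightarrow> real \<times> 'm \<Rightarrow> (real \<times> 'm, real \<times> 'e) tvec \<Rightarrow> bool" where
  "future_timelike A g0 \<omega> p v \<longleftrightarrow>
     stationary_metric A g0 \<omega> p v v < 0 \<and> stationary_metric A g0 \<omega> p v (del_t A p) < 0"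

definition chronological ::
  "('m, 'e::euclidean_space) chart set \<Rightarrow> ('m \<Rightarrow> ('m, 'e) tvec \<Rightarrow> ('m, 'e) tvec \<Rightarrow> real) \<Rightarrow>
   ('m \<Rightarrow> ('m, 'e) tvec \<Rightarrow> real) \<Rightarrow> real \<times> 'm \<Rightarrow> real \<times> 'm \<Rightarrow> bool" where
  "chronological A g0 \<omega> p q \<longleftrightarrow> (\<exists>a b \<gamma>. a < b \<and> \<gamma> a = p \<and> \<gamma> b = q \<and>
     piecewise_smooth_on (V_atlas A) {a..b} \<gamma> \<and>
     velocities_satisfy (V_atlas A) {a..b} \<gamma> (future_timelike A g0 \<omega>))"

definition I_minus ::
  "('m, 'e::euclidean_space) chart set \<Rightarrow> ('m \<Rightarrow> ('m, 'e) tvec \<Rightarrow> ('m, 'e) tvec \<Rightarrow> real) \<Rightarrow>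
   ('m \<Rightarrow> ('m, 'e) tvec \<Rightarrow> real) \<Rightarrow> real \<times> 'm \<Rightarrow> (real \<times> 'm) set" where
  "I_minus A g0 \<omega> p = {q. chronological A g0 \<omega> q p}"

definition past_set ::
  "('m, 'e::euclidean_space) chart set \<Rightarrow> ('m \<Rightarrow> ('m, 'e) tvec \<Rightarrow> ('m, 'e) tvec \<Rightarrow> real) \<Rightarrow>
   ('m \<Rightarrow> ('m, 'e) tvec \<Rightarrow> real) \<Rightarrow> (real \<times> 'm) set \<Rightarrow> bool" where
  "past_set A g0 \<omega> P \<longleftrightarrow> P \<noteq> {} \<and> P = (\<Union>p\<in>P. I_minus A g0 \<omega> p)"

definition IP ::
  "('m, 'e::euclidean_space) chart set \<Rightarrow> ('m \<Rightarrow> ('m, 'e) tvec \<Rightarrow> ('m, 'e) tvec \<Rightarrow> real) \<Rightarrow>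
   ('m \<Rightarrow> ('m, 'e) tvec \<Rightarrow> real) \<Rightarrow> (real \<times> 'm) set \<Rightarrow> bool" where
  "IP A g0 \<omega> P \<longleftrightarrow> past_set A g0 \<omega> P \<and>
     \<not> (\<exists>Q R. past_set A g0 \<omega> Q \<and> past_set A g0 \<omega> R \<and> Q \<subset> P \<and> R \<subset> P \<and> P = Q \<union> R)"

definition PIP ::
  "('m, 'e::euclidean_space) chart set \<Rightarrow> ('m \<Rightarrow> ('m, 'e) tvec \<Rightarrow> ('m, 'e) tvec \<Rightarrow> real) \<Rightarrow>
   ('m \<Rightarrow> ('m, 'e) tvec \<Rightarrow> real) \<Rightarrow> (real \<times> 'm) set \<Rightarrow> bool" where
  "PIP A g0 \<omega> P \<longleftrightarrow> IP A g0 \<omega> P \<and> (\<exists>p. P = I_minus A g0 \<omega> p)"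

definition TIP ::
  "('m, 'e::euclidean_space) chart set \<Rightarrow> ('m \<Rightarrow> ('m, 'e) tvec \<Rightarrow> ('m, 'e) tvec \<Rightarrow> real) \<Rightarrow>
   ('m \<Rightarrow> ('m, 'e) tvec \<Rightarrow> real) \<Rightarrow> (real \<times> 'm) set \<Rightarrow> bool" where
  "TIP A g0 \<omega> P \<longleftrightarrow> IP A g0 \<omega> P \<and> \<not> PIP A g0 \<omega> P"

text \<open>Here \<open>liminf\<close> and \<open>limsup\<close> are those of the complete lattice of sets, that is, the
  set-theoretic ones.\<close>

definition IP_limit ::
  "('m, 'e::euclidean_space) chart set \<Rightarrow> ('m \<Rightarrow> ('m, 'e) tvec \<Rightarrow> ('m, 'e) tvec \<Rightarrow> real) \<Rightarrow>
   ('m \<Rightarrow> ('m, 'e) tvec \<Rightarrow> real) \<Rightarrow> (nat \<Rightarrow> (real \<times> 'm) set) \<Rightarrow> (real \<times> 'm) set set" where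
  "IP_limit A g0 \<omega> \<sigma> = {P. IP A g0 \<omega> P \<and> P \<subseteq> liminf \<sigma> \<and> P \<subseteq> limsup \<sigma> \<and>
     (\<forall>Q. IP A g0 \<omega> Q \<and> P \<subseteq> Q \<and> Q \<subseteq> limsup \<sigma> \<longrightarrow> Q = P)}"

definition future_completion ::
  "('m, 'e::euclidean_space) chart set \<Rightarrow> ('m \<Rightarrow> ('m, 'e) tvec \<Rightarrow> ('m, 'e) tvec \<Rightarrow> real) \<Rightarrow>
   ('m \<Rightarrow> ('m, 'e) tvec \<Rightarrow> real) \<Rightarrow> (real \<times> 'm) set topology" where
  "future_completion A g0 \<omega> = limit_topology (Collect (IP A g0 \<omega>)) (IP_limit A g0 \<omega>)"

definition future_boundary ::
  "('m, 'e::euclidean_space) chart set \<Rightarrow> ('m \<Rightarrow> ('m, 'e) tvec \<Rightarrow> ('m, 'e) tvec \<Rightarrow> real) \<Rightarrow>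
   ('m \<Rightarrow> ('m, 'e) tvec \<Rightarrow> real) \<Rightarrow> (real \<times> 'm) set topology" where
  "future_boundary A g0 \<omega> = subtopology (future_completion A g0 \<omega>) (Collect (TIP A g0 \<omega>))"

definition busemann_past :: "('m \<Rightarrow> real) \<Rightarrow> (real \<times> 'm) set" where
  "busemann_past b = {(t, x). t < b x}"

definition i_plus :: "(real \<times> 'm) set" where
  "i_plus = UNIV"

subsection \<open>The chronological limits define topologies\<close>

lemma liminf_le_subseq:
  fixes X :: "nat \<Rightarrow> 'a::complete_lattice"
  assumes "strict_mono (r :: nat \<Rightarrow> nat)"
  shows "liminf X \<le> liminf (X \<circ> r)"
  unfolding liminf_SUP_INF
proof (rule SUP_mono)
  fix n
  have "(INF k\<in>{n..}. X k) \<le> (INF k\<in>{n..}. (X \<circ> r) k)"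
    by (rule INF_greatest) (use seq_suble[OF assms] in \<open>auto intro!: INF_lower intro: order_trans\<close>)
  then show "\<exists>m\<in>UNIV. (INF k\<in>{n..}. X k) \<le> (INF k\<in>{m..}. (X \<circ> r) k)" by blast
qed

lemma limsup_subseq_le:
  fixes X :: "nat \<Rightarrow> 'a::complete_lattice"
  assumes "strict_mono (r :: nat \<Rightarrow> nat)"
  shows "limsup (X \<circ> r) \<le> limsup X"
  unfolding limsup_INF_SUP
proof (rule INF_mono)
  fix n
  have "(SUP k\<in>{n..}. (X \<circ> r) k) \<le> (SUP k\<in>{n..}. X k)"
    by (rule SUP_least) (use seq_suble[OF assms] in \<open>auto intro!: SUP_upper intro: order_trans\<close>)
  then show "\<exists>m\<in>UNIV. (SUP k\<in>{m..}. (X \<circ> r) k) \<le> (SUP k\<in>{n..}. X k)" by blast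
qed

lemma openin_future_completion:
  "openin (future_completion A g0 \<omega>) U \<longleftrightarrow> U \<subseteq> Collect (IP A g0 \<omega>) \<and>
     (\<forall>\<sigma>. range \<sigma> \<subseteq> Collect (IP A g0 \<omega>) - U \<longrightarrow>
        IP_limit A g0 \<omega> \<sigma> \<subseteq> Collect (IP A g0 \<omega>) - U)"
proof -
  have "IP_limit A g0 \<omega> \<sigma> \<subseteq> IP_limit A g0 \<omega> (\<sigma> \<circ> r)" if "strict_mono r" for \<sigma> r
  proof
    fix P assume P: "P \<in> IP_limit A g0 \<omega> \<sigma>"
    have 1: "P \<subseteq> liminf (\<sigma> \<circ> r)"
      using P liminf_le_subseq[OF that, of \<sigma>] unfolding IP_limit_def by blast
    moreover have "liminf (\<sigma> \<circ> r) \<subseteq> limsup (\<sigma> \<circ> r)"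
      by (rule Liminf_le_Limsup) simp
    ultimately show "P \<in> IP_limit A g0 \<omega> (\<sigma> \<circ> r)"
      using P limsup_subseq_le[OF that, of \<sigma>] unfolding IP_limit_def by blast
  qed
  then have "istopology (\<lambda>U. U \<subseteq> Collect (IP A g0 \<omega>) \<and>
     (\<forall>\<sigma>. range \<sigma> \<subseteq> Collect (IP A g0 \<omega>) - U \<longrightarrow>
        IP_limit A g0 \<omega> \<sigma> \<subseteq> Collect (IP A g0 \<omega>) - U))"
    by (intro istopology_limit) (auto simp: IP_limit_def)
  then show ?thesis unfolding future_completion_def limit_topology_def by simp
qed

lemma openin_B_topology:
  "openin (B_topology A g0 \<omega>) U \<longleftrightarrow> U \<subseteq> B_plus A g0 \<omega> \<and>
     (\<forall>\<sigma>. range \<sigma> \<subseteq> B_plus A g0 \<omega> - U \<longrightarrow> B_limit A g0 \<omega> \<sigma> \<subseteq> B_plus A g0 \<omega> - U)"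
proof -
  have "B_limit A g0 \<omega> \<sigma> \<subseteq> B_limit A g0 \<omega> (\<sigma> \<circ> r)" if r: "strict_mono r" for \<sigma> r
  proof
    fix f assume f: "f \<in> B_limit A g0 \<omega> \<sigma>"
    have lo: "liminf (\<lambda>n. ereal (\<sigma> n x)) \<le> liminf (\<lambda>n. ereal ((\<sigma> \<circ> r) n x))" for x
      using liminf_le_subseq[OF r, of "\<lambda>n. ereal (\<sigma> n x)"] by (simp add: comp_def)
    have up: "limsup (\<lambda>n. ereal ((\<sigma> \<circ> r) n x)) \<le> limsup (\<lambda>n. ereal (\<sigma> n x))" for x
      using limsup_subseq_le[OF r, of "\<lambda>n. ereal (\<sigma> n x)"] by (simp add: comp_def)
    show "f \<in> B_limit A g0 \<omega> (\<sigma> \<circ> r)"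
      unfolding B_limit_def mem_Collect_eq
    proof (intro conjI ballI allI impI)
      show "f \<in> B_plus A g0 \<omega>" using f unfolding B_limit_def by blast
      show "ereal (f x) \<le> liminf (\<lambda>n. ereal ((\<sigma> \<circ> r) n x))" for x
        using f order_trans[OF _ lo] unfolding B_limit_def by blast
      show "g = f" if "g \<in> B_plus A g0 \<omega>"
        and "f \<le> g \<and> (\<forall>x. ereal (g x) \<le> limsup (\<lambda>n. ereal ((\<sigma> \<circ> r) n x)))" for g
        using f that order_trans[OF _ up] unfolding B_limit_def by blast
    qed
  qed
  then have "istopology (\<lambda>U. U \<subseteq> B_plus A g0 \<omega> \<and>
     (\<forall>\<sigma>. range \<sigma> \<subseteq> B_plus A g0 \<omega> - U \<longrightarrow> B_limit A g0 \<omega> \<sigma> \<subseteq> B_plus A g0 \<omega> - U))"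
    by (intro istopology_limit) (auto simp: B_limit_def)
  then show ?thesis unfolding B_topology_def limit_topology_def by simp
qed

end

theory Submission
  imports Defs
begin

text \<open>A curve of \<open>F\<^sup>+\<close>-length less than \<open>T\<close> can be reparametrized on \<open>[0, T]\<close> with
  \<open>F\<^sup>+\<close>-speed less than one by subdividing it finely and rescaling each piece linearly. Hence
  \<open>(t, x) \<lless> (t', x')\<close> iff \<open>t + d\<^sup>+(x, x') < t'\<close>, and an IP other than \<open>V\<close> is the region
  \<open>P(b)\<close> below the graph of a Busemann function, because an IP is the past of a chronological chain.

  By Zorn, below the limit \<open>h\<close> of a pointwise convergent sequence of Busemann functions there are maximal
  Busemann functions reaching any height less than \<open>h(x)\<close> over \<open>x\<close>, and all of them are limits of the
  sequence. If \<open>M\<^sub>B\<^sup>+\<close> is Hausdorff, two of them differ by a constant, hence agree by maximality, so that \<open>h\<close>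
  is itself a Busemann function and chronological convergence is pointwise convergence. The
  topology of \<open>B\<^sup>+(M)\<close> is therefore that of pointwise convergence, in which the product decomposition
  is evident and the functions vanishing at \<open>x\<^sub>0\<close> form a compact set.

  Compactness of the base makes the neighbourhoods of the apex of the cone contain some \<open>b(x\<^sub>0) > K\<close>,
  as do those of \<open>i\<^sup>+\<close>. The boundary is closed since a Busemann function \<open>b\<close> not coming from \<open>M\<close>
  satisfies \<open>b(x) \<le> b(y) - d\<^sup>+(x, y)\<close> for some \<open>y\<close> on any small sphere around \<open>x\<close>, whereas
  \<open>k - d\<^sup>+(\<cdot>, x)\<close> does not.\<close>

section \<open>Smooth maps\<close>

text \<open>Two obstacles shape the argument. The distance \<open>d\<close> is not symmetric and its
  infimum need not be attained, so everything is phrased through strict inequalities: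
  \<open>d x y < T\<close> holds exactly if some curve of speed less than one takes the time
  \<open>T\<close> from \<open>x\<close> to \<open>y\<close> (the relation \<open>link\<close>), and
  it is this relation, not a shortest curve, that is concatenated, shifted and lifted to
  \<open>V\<close>. Secondly, a pointwise limit of Busemann functions always inherits the one-sided
  Lipschitz bound \<open>is_lip\<close>, but may lose the directedness that makes
  \<open>P(b)\<close> indecomposable. The Hausdorff property restores it: all maximal Busemann
  functions below the limit are chronological limits of one and the same sequence, so their classes
  are limits of one sequence in \<open>M_B\<close>. Moreover, the chronological topologies are
  defined by sequences, whereas the pointwise topology on all functions on \<open>M\<close> is not
  first countable; the equicontinuity that \<open>is_lip\<close> provides and a countable dense
  subset of \<open>M\<close> bridge this gap.\<close>

lemma Ck_on_cong:
  assumes "open S" "\<And>x. x \<in> S \<Longrightarrow> f x = g x" "Ck_on k S f"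
  shows "Ck_on k S g"
  using assms(2,3)
proof (induction k arbitrary: f g)
  case 0
  then show ?case using continuous_on_cong[of S S f g] by simp
next
  case (Suc k)
  have d: "f differentiable at x" if "x \<in> S" for x using Suc.prems(2) that by simp
  have "g differentiable at x" if x: "x \<in> S" for x
  proof -
    obtain D where "(f has_derivative D) (at x)" using d[OF x] unfolding differentiable_def ..
    from has_derivative_transform_within_open[OF this assms(1) x Suc.prems(1)]
    show ?thesis unfolding differentiable_def by blast
  qed
  moreover have "Ck_on k S (\<lambda>x. frechet_derivative g (at x) v)" for v
  proof (rule Suc.IH)
    show "Ck_on k S (\<lambda>x. frechet_derivative f (at x) v)" using Suc.prems(2) by simp
    show "frechet_derivative f (at x) v = frechet_derivative g (at x) v" if "x \<in> S" for x
      using frechet_derivative_transform_within_open[OF d[OF that] assms(1) that Suc.prems(1)] by simp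
  qed
  ultimately show ?case by simp
qed

lemma Ck_on_subset: "Ck_on k S f \<Longrightarrow> T \<subseteq> S \<Longrightarrow> Ck_on k T f"
  by (induction k arbitrary: f) (auto intro: continuous_on_subset)

text \<open>The derivative of the composite in the direction \<open>v\<close> is the derivative of
  \<open>f\<close> in the direction \<open>B v\<close>, composed with the same affine map, so the
  induction on \<open>k\<close> closes. Needed for reparametrized curves and for straight segments
  in a chart.\<close>

lemma Ck_on_affine_compose:
  fixes f :: "'b::euclidean_space \<Rightarrow> 'c::euclidean_space" and B :: "'a::euclidean_space \<Rightarrow> 'b"
  assumes S: "open S" and B: "bounded_linear B" and f: "Ck_on k S f"
  shows "Ck_on k {x. p + B x \<in> S} (\<lambda>x. f (p + B x))"
  using f
proof (induction k arbitrary: f)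
  case 0
  have "continuous_on {x. p + B x \<in> S} (\<lambda>x. p + B x)"
    by (intro continuous_intros bounded_linear.continuous_on[OF B])
  moreover have f: "continuous_on S f" using 0 by simp
  ultimately have "continuous_on {x. p + B x \<in> S} (\<lambda>x. f (p + B x))"
    by (intro continuous_on_compose2[OF f, of _ "\<lambda>x. p + B x"]) auto
  then show ?case by simp
next
  case (Suc k)
  have cont: "continuous_on UNIV (\<lambda>x. p + B x)"
    by (intro continuous_intros bounded_linear.continuous_on[OF B])
  have op: "open {x. p + B x \<in> S}"
    using open_vimage[OF S cont] by (simp add: vimage_def)
  have hd: "((\<lambda>x. f (p + B x)) has_derivative (\<lambda>v. frechet_derivative f (at (p + B x)) (B v))) (at x)"
    if "p + B x \<in> S" for x
  proof -
    have "(f has_derivative frechet_derivative f (at (p + B x))) (at (p + B x))"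
      using Suc.prems that by (simp add: frechet_derivative_works)
    moreover have "((\<lambda>x. p + B x) has_derivative B) (at x)"
      using has_derivative_add[OF has_derivative_const bounded_linear_imp_has_derivative[OF B]] by simp
    ultimately show ?thesis using has_derivative_compose by blast
  qed
  have "Ck_on k {x. p + B x \<in> S} (\<lambda>x. frechet_derivative (\<lambda>x. f (p + B x)) (at x) v)" for v
  proof (rule Ck_on_cong[OF op])
    show "Ck_on k {x. p + B x \<in> S} (\<lambda>x. (\<lambda>y. frechet_derivative f (at y) (B v)) (p + B x))"
      by (rule Suc.IH) (use Suc.prems in simp)
    show "frechet_derivative f (at (p + B x)) (B v) = frechet_derivative (\<lambda>x. f (p + B x)) (at x) v"
      if "x \<in> {x. p + B x \<in> S}" for x
      using frechet_derivative_at[OF hd] that by (metis mem_Collect_eq)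
  qed
  moreover have "(\<lambda>x. f (p + B x)) differentiable at x" if "p + B x \<in> S" for x
    using hd[OF that] unfolding differentiable_def by blast
  ultimately show ?case by simp
qed

lemma Ck_on_linear_compose:
  fixes f :: "'a::euclidean_space \<Rightarrow> 'b::euclidean_space" and L :: "'b \<Rightarrow> 'c::euclidean_space"
  assumes S: "open S" and L: "bounded_linear L" and f: "Ck_on k S f"
  shows "Ck_on k S (\<lambda>x. L (f x))"
  using f
proof (induction k arbitrary: f)
  case 0
  then show ?case using bounded_linear.continuous_on[OF L] by simp
next
  case (Suc k)
  have hd: "((\<lambda>x. L (f x)) has_derivative (\<lambda>v. L (frechet_derivative f (at x) v))) (at x)" if "x \<in> S" for x
  proof (rule bounded_linear.has_derivative[OF L])
    show "(f has_derivative frechet_derivative f (at x)) (at x)"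
      using Suc.prems that by (simp add: frechet_derivative_works)
  qed
  have "Ck_on k S (\<lambda>x. frechet_derivative (\<lambda>x. L (f x)) (at x) v)" for v
  proof (rule Ck_on_cong[OF S])
    show "Ck_on k S (\<lambda>x. L (frechet_derivative f (at x) v))"
      by (rule Suc.IH) (use Suc.prems in simp)
    show "L (frechet_derivative f (at x) v) = frechet_derivative (\<lambda>x. L (f x)) (at x) v" if "x \<in> S" for x
      using frechet_derivative_at[OF hd[OF that]] by metis
  qed
  moreover have "(\<lambda>x. L (f x)) differentiable at x" if "x \<in> S" for x
    using hd[OF that] unfolding differentiable_def by blast
  ultimately show ?case by simp
qed

text \<open>Serves to lift a curve to its graph over time. The coefficients \<open>p\<close> and
  \<open>q\<close> are generalized in the induction because the derivative of the first component is
  again affine, with slope zero.\<close>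

lemma Ck_on_Pair_affine:
  fixes f :: "real \<Rightarrow> 'b::euclidean_space"
  assumes S: "open S" and f: "Ck_on k S f"
  shows "Ck_on k S (\<lambda>s. (p + q * s :: real, f s))"
  using f
proof (induction k arbitrary: f p q)
  case 0
  then have "continuous_on S (\<lambda>s. (p + q * s, f s))" by (intro continuous_intros) simp
  then show ?case by simp
next
  case (Suc k)
  have hd: "((\<lambda>s. (p + q * s, f s)) has_derivative (\<lambda>v. (q * v, frechet_derivative f (at x) v))) (at x)"
    if "x \<in> S" for x
  proof (rule has_derivative_Pair)
    show "((\<lambda>s. p + q * s) has_derivative (\<lambda>v. q * v)) (at x)"
      by (auto intro!: derivative_eq_intros)
    show "(f has_derivative frechet_derivative f (at x)) (at x)"
      using Suc.prems that by (simp add: frechet_derivative_works)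
  qed
  have "Ck_on k S (\<lambda>s. frechet_derivative (\<lambda>s. (p + q * s, f s)) (at s) v)" for v
  proof (rule Ck_on_cong[OF S])
    show "Ck_on k S (\<lambda>s. (q * v + 0 * s, frechet_derivative f (at s) v))"
      by (rule Suc.IH) (use Suc.prems in simp)
    show "(q * v + 0 * s, frechet_derivative f (at s) v) =
        frechet_derivative (\<lambda>s. (p + q * s, f s)) (at s) v" if "s \<in> S" for s
      using fun_cong[OF frechet_derivative_at[OF hd[OF that]], of v] by simp
  qed
  moreover have "(\<lambda>s. (p + q * s, f s)) differentiable at x" if "x \<in> S" for x
    using hd[OF that] unfolding differentiable_def by blast
  ultimately show ?case by simp
qed

lemma smooth_on_differentiable: "smooth_on S f \<Longrightarrow> x \<in> S \<Longrightarrow> f differentiable at x"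
  unfolding smooth_on_def using Ck_on.simps(2)[of 0 S f] by blast

lemma smooth_on_continuous: "smooth_on S f \<Longrightarrow> continuous_on S f"
  unfolding smooth_on_def using Ck_on.simps(1)[of S f] by blast

lemma smooth_on_has_vector_derivative:
  fixes h :: "real \<Rightarrow> 'b::euclidean_space"
  assumes "smooth_on S h"
  shows "\<And>r. r \<in> S \<Longrightarrow> (h has_vector_derivative frechet_derivative h (at r) 1) (at r)"
    and "continuous_on S (\<lambda>r. frechet_derivative h (at r) 1)"
proof -
  fix r assume "r \<in> S"
  then have hd: "(h has_derivative frechet_derivative h (at r)) (at r)"
    using smooth_on_differentiable[OF assms] by (simp add: frechet_derivative_works)
  then have "linear (frechet_derivative h (at r))" by (rule has_derivative_linear)
  note lin = this
  have eq: "(\<lambda>x. x *\<^sub>R frechet_derivative h (at r) 1) = frechet_derivative h (at r)"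
  proof
    fix x
    from linear_scale[OF lin, of x 1, symmetric]
    show "x *\<^sub>R frechet_derivative h (at r) 1 = frechet_derivative h (at r) x"
      by (simp only: real_scaleR_def mult_1_right)
  qed
  show "(h has_vector_derivative frechet_derivative h (at r) 1) (at r)"
    unfolding has_vector_derivative_def eq by (rule hd)
next
  have "Ck_on (Suc 0) S h" using assms unfolding smooth_on_def by blast
  then show "continuous_on S (\<lambda>r. frechet_derivative h (at r) 1)" by simp
qed

section \<open>Smooth curves\<close>

lemma smooth_curve_on_iff:
  "smooth_curve_on B S c \<longleftrightarrow> (\<forall>s\<in>S. \<forall>\<kappa>\<in>charts_at B (c s). \<exists>\<epsilon>>0. \<exists>h.
     smooth_on (ball s \<epsilon>) h \<and> (\<forall>r\<in>S \<inter> ball s \<epsilon>. c r \<in> fst \<kappa> \<and> snd \<kappa> (c r) = h r))"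
  unfolding smooth_curve_on_def case_prod_unfold ..

lemma smooth_curve_onE:
  assumes "smooth_curve_on B S c" "s \<in> S" "\<kappa> \<in> charts_at B (c s)"
  obtains \<epsilon> h where "\<epsilon> > 0" "smooth_on (ball s \<epsilon>) h"
    "\<forall>r\<in>S \<inter> ball s \<epsilon>. c r \<in> fst \<kappa> \<and> snd \<kappa> (c r) = h r"
proof -
  have "\<exists>\<epsilon>>0. \<exists>h. smooth_on (ball s \<epsilon>) h \<and> (\<forall>r\<in>S \<inter> ball s \<epsilon>. c r \<in> fst \<kappa> \<and> snd \<kappa> (c r) = h r)"
    using assms(1)[unfolded smooth_curve_on_iff, rule_format, OF assms(2,3)] .
  then show ?thesis using that by blast
qed

lemma smooth_curve_on_subset:
  assumes "smooth_curve_on B S c" "T \<subseteq> S"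
  shows "smooth_curve_on B T c"
  unfolding smooth_curve_on_iff
proof (intro ballI)
  fix s \<kappa> assume s: "s \<in> T" and \<kappa>: "\<kappa> \<in> charts_at B (c s)"
  then have "s \<in> S" using assms(2) by blast
  from assms(1) this \<kappa> obtain \<epsilon> h where "\<epsilon> > 0" "smooth_on (ball s \<epsilon>) h"
    "\<forall>r\<in>S \<inter> ball s \<epsilon>. c r \<in> fst \<kappa> \<and> snd \<kappa> (c r) = h r" by (rule smooth_curve_onE)
  then show "\<exists>\<epsilon>>0. \<exists>h. smooth_on (ball s \<epsilon>) h \<and>
      (\<forall>r\<in>T \<inter> ball s \<epsilon>. c r \<in> fst \<kappa> \<and> snd \<kappa> (c r) = h r)"
    using assms(2) by (intro exI[of _ \<epsilon>] conjI exI[of _ h]) auto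
qed

lemma smooth_curve_on_cong:
  assumes "\<And>s. s \<in> S \<Longrightarrow> c s = c' s" "smooth_curve_on B S c"
  shows "smooth_curve_on B S c'"
  using assms unfolding smooth_curve_on_def by auto

text \<open>The local extension \<open>h\<close> is differentiable on both sides of
  \<open>s\<close>, which yields a derivative relative to \<open>{a..b}\<close> that is continuous
  up to the end points.\<close>

lemma smooth_curve_chart:
  fixes B :: "('m, 'e::euclidean_space) chart set"
  assumes c: "smooth_curve_on B {a..b} c" and s: "s \<in> {a..b}" and \<kappa>: "\<kappa> \<in> charts_at B (c s)"
  shows "\<exists>\<epsilon>>0. \<exists>w. continuous_on ({a..b} \<inter> ball s \<epsilon>) w \<and> (\<forall>r\<in>{a..b} \<inter> ball s \<epsilon>. c r \<in> fst \<kappa> \<and>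
    ((snd \<kappa> \<circ> c) has_vector_derivative w r) (at r within {a..b}))"
proof -
  obtain \<epsilon> h where \<epsilon>: "\<epsilon> > 0" and h: "smooth_on (ball s \<epsilon>) h"
    and eq: "\<forall>r\<in>{a..b} \<inter> ball s \<epsilon>. c r \<in> fst \<kappa> \<and> snd \<kappa> (c r) = h r"
    using c s \<kappa> by (rule smooth_curve_onE)
  let ?w = "\<lambda>r. frechet_derivative h (at r) 1"
  have "((snd \<kappa> \<circ> c) has_vector_derivative ?w r) (at r within {a..b})" if r: "r \<in> {a..b} \<inter> ball s \<epsilon>" for r
  proof (rule has_vector_derivative_transform_within)
    show "(h has_vector_derivative ?w r) (at r within {a..b})"
      using smooth_on_has_vector_derivative(1)[OF h] r by (simp add: has_vector_derivative_at_within)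
    show "0 < \<epsilon> - dist s r" using r by simp
    show "h r' = (snd \<kappa> \<circ> c) r'" if "r' \<in> {a..b}" "dist r' r < \<epsilon> - dist s r" for r'
    proof -
      have "dist s r' < \<epsilon>" using that dist_triangle[of s r' r] by (simp add: dist_commute)
      then show ?thesis using eq that by simp
    qed
  qed (use r in simp)
  moreover have "continuous_on ({a..b} \<inter> ball s \<epsilon>) ?w"
    using smooth_on_has_vector_derivative(2)[OF h] by (rule continuous_on_subset) simp
  ultimately show ?thesis using \<epsilon> eq by (intro exI[of _ \<epsilon>] conjI exI[of _ ?w]) auto
qed

text \<open>Nondegeneracy of the interval makes the possibly one-sided vector derivative unique; the
  clause for charts away from the point matches the normalization to \<open>0\<close>.\<close>

lemma velocity_eqI:
  fixes B :: "('m, 'e::euclidean_space) chart set"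
  assumes "a < b" "s \<in> {a..b}"
    and "\<And>\<kappa>. \<kappa> \<in> charts_at B (c s) \<Longrightarrow> ((snd \<kappa> \<circ> c) has_vector_derivative v \<kappa>) (at s within {a..b})"
    and "\<And>\<kappa>. \<kappa> \<notin> charts_at B (c s) \<Longrightarrow> v \<kappa> = 0"
  shows "velocity B c {a..b} s = v"
proof
  fix \<kappa>
  show "velocity B c {a..b} s \<kappa> = v \<kappa>"
    using vector_derivative_within_closed_interval[OF assms(1,2) assms(3)] assms(4)
    by (cases "\<kappa> \<in> charts_at B (c s)") (simp_all add: velocity_def)
qed

lemma has_vector_derivative_velocity:
  fixes B :: "('m, 'e::euclidean_space) chart set"
  assumes ab: "a < b" and c: "smooth_curve_on B {a..b} c" and s: "s \<in> {a..b}" and \<kappa>: "\<kappa> \<in> charts_at B (c s)"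
  shows "((snd \<kappa> \<circ> c) has_vector_derivative velocity B c {a..b} s \<kappa>) (at s within {a..b})"
proof -
  obtain \<epsilon> w where \<epsilon>: "\<epsilon> > 0"
    and w: "\<forall>r\<in>{a..b} \<inter> ball s \<epsilon>. ((snd \<kappa> \<circ> c) has_vector_derivative w r) (at r within {a..b})"
    using smooth_curve_chart[OF c s \<kappa>] by blast
  have "((snd \<kappa> \<circ> c) has_vector_derivative w s) (at s within {a..b})" using w s \<epsilon> by simp
  moreover from this have "velocity B c {a..b} s \<kappa> = w s"
    using vector_derivative_within_closed_interval[OF ab s] \<kappa> by (simp add: velocity_def)
  ultimately show ?thesis by simp
qed

lemma velocity_not_chart: "\<kappa> \<notin> charts_at B (c s) \<Longrightarrow> velocity B c S s \<kappa> = 0"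
  by (simp add: velocity_def)

text \<open>Smoothness on the larger interval is essential: at a break point the one-sided
  velocities of the two adjacent pieces differ in general.\<close>

lemma velocity_subinterval:
  fixes B :: "('m, 'e::euclidean_space) chart set"
  assumes c: "smooth_curve_on B {a..b} c" and uv: "u < v" "{u..v} \<subseteq> {a..b}" and s: "s \<in> {u..v}"
  shows "velocity B c {u..v} s = velocity B c {a..b} s"
proof (rule velocity_eqI[OF uv(1) s])
  have ab: "a < b" using uv by auto
  fix \<kappa> assume "\<kappa> \<in> charts_at B (c s)"
  then have "((snd \<kappa> \<circ> c) has_vector_derivative velocity B c {a..b} s \<kappa>) (at s within {a..b})"
    using has_vector_derivative_velocity[OF ab c] s uv by blast
  then show "((snd \<kappa> \<circ> c) has_vector_derivative velocity B c {a..b} s \<kappa>) (at s within {u..v})"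
    using uv(2) by (rule has_vector_derivative_within_subset)
qed (simp add: velocity_not_chart)

lemma velocity_cong:
  fixes B :: "('m, 'e::euclidean_space) chart set"
  assumes ab: "a < b" and c: "smooth_curve_on B {a..b} c" and s: "s \<in> {a..b}"
    and eq: "\<And>s. s \<in> {a..b} \<Longrightarrow> c s = c' s"
  shows "velocity B c' {a..b} s = velocity B c {a..b} s"
proof (rule velocity_eqI[OF ab s])
  fix \<kappa> assume "\<kappa> \<in> charts_at B (c' s)"
  then have "((snd \<kappa> \<circ> c) has_vector_derivative velocity B c {a..b} s \<kappa>) (at s within {a..b})"
    using has_vector_derivative_velocity[OF ab c s] eq s by simp
  then show "((snd \<kappa> \<circ> c') has_vector_derivative velocity B c {a..b} s \<kappa>) (at s within {a..b})"
    using eq s by (intro has_vector_derivative_transform[of s _ "snd \<kappa> \<circ> c'"]) simp_all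
qed (use eq s in \<open>simp add: velocity_not_chart\<close>)

lemma smooth_curve_on_affine:
  fixes c :: "real \<Rightarrow> 'm"
  assumes c: "smooth_curve_on B S c" and T: "\<And>s. s \<in> T \<Longrightarrow> p + m * s \<in> S"
  shows "smooth_curve_on B T (\<lambda>s. c (p + m * s))"
  unfolding smooth_curve_on_iff
proof (intro ballI)
  fix s \<kappa> assume s: "s \<in> T" and \<kappa>: "\<kappa> \<in> charts_at B (c (p + m * s))"
  obtain \<epsilon> h where \<epsilon>: "\<epsilon> > 0" and h: "smooth_on (ball (p + m * s) \<epsilon>) h"
    and eq: "\<forall>r\<in>S \<inter> ball (p + m * s) \<epsilon>. c r \<in> fst \<kappa> \<and> snd \<kappa> (c r) = h r"
    using c T[OF s] \<kappa> by (rule smooth_curve_onE)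
  have "bounded_linear (\<lambda>s::real. m * s)" by (rule bounded_linear_mult_right)
  then have sm: "smooth_on {r. p + m * r \<in> ball (p + m * s) \<epsilon>} (\<lambda>r. h (p + m * r))"
    using h unfolding smooth_on_def by (intro allI Ck_on_affine_compose) simp_all
  \<comment> \<open>The summand \<open>1\<close> keeps the radius positive for
    \<open>m = 0\<close>.\<close>
  let ?\<delta> = "\<epsilon> / (\<bar>m\<bar> + 1)"
  have ball: "p + m * r \<in> ball (p + m * s) \<epsilon>" if "r \<in> ball s ?\<delta>" for r
  proof -
    have "\<bar>m\<bar> * \<bar>s - r\<bar> \<le> (\<bar>m\<bar> + 1) * \<bar>s - r\<bar>" by (intro mult_right_mono) auto
    also have "\<dots> < \<epsilon>" using that by (simp add: dist_real_def pos_less_divide_eq mult.commute)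
    finally show ?thesis by (simp add: dist_real_def flip: right_diff_distrib abs_mult)
  qed
  have "?\<delta> > 0" using \<epsilon> by simp
  moreover have "smooth_on (ball s ?\<delta>) (\<lambda>r. h (p + m * r))"
    using sm ball unfolding smooth_on_def by (blast intro: Ck_on_subset)
  moreover have "c (p + m * r) \<in> fst \<kappa> \<and> snd \<kappa> (c (p + m * r)) = h (p + m * r)" if "r \<in> T \<inter> ball s ?\<delta>" for r
    using that T ball eq by blast
  ultimately show "\<exists>\<epsilon>>0. \<exists>h. smooth_on (ball s \<epsilon>) h \<and>
      (\<forall>r\<in>T \<inter> ball s \<epsilon>. c (p + m * r) \<in> fst \<kappa> \<and> snd \<kappa> (c (p + m * r)) = h r)"
    by blast
qed

lemma velocity_affine:
  fixes B :: "('m, 'e::euclidean_space) chart set"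
  assumes ab: "a < b" and c: "smooth_curve_on B {a..b} c" and uv: "u < v" and s: "s \<in> {u..v}"
    and im: "\<And>s. s \<in> {u..v} \<Longrightarrow> p + m * s \<in> {a..b}"
  shows "velocity B (\<lambda>s. c (p + m * s)) {u..v} s = (\<lambda>\<kappa>. m *\<^sub>R velocity B c {a..b} (p + m * s) \<kappa>)"
proof (rule velocity_eqI[OF uv s])
  fix \<kappa> assume "\<kappa> \<in> charts_at B (c (p + m * s))"
  then have "((snd \<kappa> \<circ> c) has_vector_derivative velocity B c {a..b} (p + m * s) \<kappa>) (at (p + m * s) within {a..b})"
    by (intro has_vector_derivative_velocity ab c im s)
  then have "((snd \<kappa> \<circ> c) has_vector_derivative velocity B c {a..b} (p + m * s) \<kappa>)
      (at (p + m * s) within (\<lambda>s. p + m * s) ` {u..v})"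
    by (rule has_vector_derivative_within_subset) (use im in blast)
  moreover have "((\<lambda>s. p + m * s) has_vector_derivative m) (at s within {u..v})"
    by (auto intro!: derivative_eq_intros simp: has_vector_derivative_def)
  ultimately have "((snd \<kappa> \<circ> c) \<circ> (\<lambda>s. p + m * s) has_vector_derivative
      m *\<^sub>R velocity B c {a..b} (p + m * s) \<kappa>) (at s within {u..v})"
    by (intro vector_diff_chain_within)
  then show "((snd \<kappa> \<circ> (\<lambda>s. c (p + m * s))) has_vector_derivative
      m *\<^sub>R velocity B c {a..b} (p + m * s) \<kappa>) (at s within {u..v})"
    by (simp add: comp_def)
qed (simp add: velocity_not_chart)

subsection \<open>Arcs and chains of arcs\<close>

definition arc_on :: "('m, 'e::euclidean_space) chart set \<Rightarrow> ('m \<Rightarrow> ('m, 'e) tvec \<Rightarrow> bool) \<Rightarrow>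
    (real \<Rightarrow> 'm) \<Rightarrow> real \<Rightarrow> real \<Rightarrow> bool" where
  "arc_on B Q c a b \<longleftrightarrow> a < b \<and> smooth_curve_on B {a..b} c \<and>
     (\<forall>s\<in>{a..b}. Q (c s) (velocity B c {a..b} s))"

text \<open>This is \<open>piecewise_smooth_on\<close> together with
  \<open>velocities_satisfy\<close>, with the break set made explicit. Unlike the two separate
  predicates it can be checked piece by piece, as concatenation and lifting require.\<close>

definition arcs_on :: "('m, 'e::euclidean_space) chart set \<Rightarrow> ('m \<Rightarrow> ('m, 'e) tvec \<Rightarrow> bool) \<Rightarrow>
    (real \<Rightarrow> 'm) \<Rightarrow> real set \<Rightarrow> real set \<Rightarrow> bool" where
  "arcs_on B Q c I S \<longleftrightarrow> (\<forall>a b. {a..b} \<subseteq> I \<longrightarrow> finite (S \<inter> {a..b})) \<and>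
     (\<forall>a b. a < b \<and> {a..b} \<subseteq> I \<and> S \<inter> {a<..<b} = {} \<longrightarrow> arc_on B Q c a b)"

lemma arc_on_subinterval:
  assumes "arc_on B Q c a b" "u < v" "{u..v} \<subseteq> {a..b}"
  shows "arc_on B Q c u v"
  unfolding arc_on_def
proof (intro conjI ballI)
  have c: "smooth_curve_on B {a..b} c" using assms(1) unfolding arc_on_def by blast
  then show "smooth_curve_on B {u..v} c" using assms(3) by (rule smooth_curve_on_subset)
  show "Q (c s) (velocity B c {u..v} s)" if "s \<in> {u..v}" for s
    using velocity_subinterval[OF c assms(2,3) that] assms(1,3) that unfolding arc_on_def by auto
qed (rule assms(2))

lemma arc_on_cong:
  assumes "arc_on B Q c a b" "\<And>s. s \<in> {a..b} \<Longrightarrow> c s = c' s"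
  shows "arc_on B Q c' a b"
  unfolding arc_on_def
proof (intro conjI ballI)
  have c: "smooth_curve_on B {a..b} c" and ab: "a < b"
    and Q: "\<And>s. s \<in> {a..b} \<Longrightarrow> Q (c s) (velocity B c {a..b} s)"
    using assms(1) unfolding arc_on_def by blast+
  show "a < b" by (rule ab)
  show "smooth_curve_on B {a..b} c'" using assms(2) c by (rule smooth_curve_on_cong)
  show "Q (c' s) (velocity B c' {a..b} s)" if "s \<in> {a..b}" for s
    using Q[OF that] velocity_cong[OF ab c that assms(2)] assms(2)[OF that] by simp
qed

lemma arc_on_shift:
  assumes "arc_on B Q c a b"
  shows "arc_on B Q (\<lambda>s. c (p + s)) (a - p) (b - p)"
  unfolding arc_on_def
proof (intro conjI ballI)
  have c: "smooth_curve_on B {a..b} c" and ab: "a < b"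
    and Q: "\<And>s. s \<in> {a..b} \<Longrightarrow> Q (c s) (velocity B c {a..b} s)"
    using assms unfolding arc_on_def by blast+
  show ab': "a - p < b - p" using ab by simp
  have im: "p + 1 * s \<in> {a..b}" if "s \<in> {a - p..b - p}" for s using that by auto
  show "smooth_curve_on B {a - p..b - p} (\<lambda>s. c (p + s))"
    using smooth_curve_on_affine[of B "{a..b}" c "{a - p..b - p}" p 1] c im by simp
  show "Q (c (p + s)) (velocity B (\<lambda>s. c (p + s)) {a - p..b - p} s)" if s: "s \<in> {a - p..b - p}" for s
    using velocity_affine[OF ab c ab' s, of p 1] im Q[OF im[OF s]] by simp
qed

lemma arcs_on_subset: "arcs_on B Q c I S \<Longrightarrow> J \<subseteq> I \<Longrightarrow> arcs_on B Q c J S"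
  unfolding arcs_on_def by (meson order_trans)

text \<open>\<open>velocities_satisfy\<close> speaks of every closed interval on which
  \<open>c\<close> is smooth, and such an interval may contain points of \<open>S\<close>. Next to a
  given \<open>s\<close>, a one-sided interval without interior points of \<open>S\<close> carries
  the same velocity.\<close>

lemma arcs_on_imp_piecewise:
  assumes arcs: "arcs_on B Q c I S"
  shows "piecewise_smooth_on B I c" "velocities_satisfy B I c Q"
proof -
  show "piecewise_smooth_on B I c"
    unfolding piecewise_smooth_on_def using arcs unfolding arcs_on_def arc_on_def by (intro exI[of _ S]) blast
  show "velocities_satisfy B I c Q"
    unfolding velocities_satisfy_def
  proof (intro allI impI ballI)
    fix a b s assume ab: "a < b \<and> {a..b} \<subseteq> I \<and> smooth_curve_on B {a..b} c" and s: "s \<in> {a..b}"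
    have fin: "finite (S \<inter> {a..b} - {s})" using arcs ab unfolding arcs_on_def by blast
    obtain \<delta> where \<delta>: "\<delta> > 0" "\<And>r. r \<in> S \<inter> {a..b} - {s} \<Longrightarrow> \<delta> \<le> dist s r"
      using finite_set_avoid[OF fin, of s] by auto
    obtain u v where uv: "u < v" "{u..v} \<subseteq> {a..b}" "s \<in> {u..v}" "S \<inter> {u<..<v} = {}"
    proof (cases "s < b")
      case True
      show ?thesis
      proof (rule that[of s "min b (s + \<delta> / 2)"])
        show "S \<inter> {s<..<min b (s + \<delta> / 2)} = {}"
        proof (rule equals0I)
          fix r assume r: "r \<in> S \<inter> {s<..<min b (s + \<delta> / 2)}"
          then have "\<delta> \<le> dist s r" using s by (intro \<delta>(2)) auto
          then show False using r \<delta>(1) by (auto simp: dist_real_def)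
        qed
      qed (use True s \<delta>(1) in auto)
    next
      case False
      show ?thesis
      proof (rule that[of "max a (s - \<delta> / 2)" s])
        show "S \<inter> {max a (s - \<delta> / 2)<..<s} = {}"
        proof (rule equals0I)
          fix r assume r: "r \<in> S \<inter> {max a (s - \<delta> / 2)<..<s}"
          then have "\<delta> \<le> dist s r" using s by (intro \<delta>(2)) auto
          then show False using r \<delta>(1) by (auto simp: dist_real_def)
        qed
      qed (use False s ab \<delta>(1) in auto)
    qed
    have "arc_on B Q c u v" using arcs uv ab unfolding arcs_on_def by (meson order_trans)
    then have "Q (c s) (velocity B c {u..v} s)" using uv(3) unfolding arc_on_def by blast
    then show "Q (c s) (velocity B c {a..b} s)"
      using velocity_subinterval[of B a b c u v s] ab uv by simp
  qed
qed

lemma piecewise_imp_arcs_on: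
  assumes "piecewise_smooth_on B I c" "velocities_satisfy B I c Q"
  shows "\<exists>S. arcs_on B Q c I S"
proof -
  obtain S where "\<forall>a b. {a..b} \<subseteq> I \<longrightarrow> finite (S \<inter> {a..b})"
    "\<forall>a b. a < b \<and> {a..b} \<subseteq> I \<and> S \<inter> {a<..<b} = {} \<longrightarrow> smooth_curve_on B {a..b} c"
    using assms(1) unfolding piecewise_smooth_on_def by blast
  then have "arcs_on B Q c I S"
    using assms(2) unfolding velocities_satisfy_def arcs_on_def arc_on_def by blast
  then show ?thesis ..
qed

text \<open>Induction on the number of break points in the open interval, splitting at one of
  them.\<close>

lemma piecewise_induct:
  fixes S :: "real set"
  assumes "a < b" "finite (S \<inter> {a..b})"
    and piece: "\<And>u v. u < v \<Longrightarrow> {u..v} \<subseteq> {a..b} \<Longrightarrow> S \<inter> {u<..<v} = {} \<Longrightarrow> P u v"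
    and trans: "\<And>u v w. a \<le> u \<Longrightarrow> u < v \<Longrightarrow> v < w \<Longrightarrow> w \<le> b \<Longrightarrow> P u v \<Longrightarrow> P v w \<Longrightarrow> P u w"
  shows "P a b"
proof -
  have "P u v" if "a \<le> u" "u < v" "v \<le> b" for u v
    using that
  proof (induction "card (S \<inter> {u<..<v})" arbitrary: u v rule: less_induct)
    case less
    have fin: "finite (S \<inter> {u<..<v})"
      using assms(2) by (rule rev_finite_subset) (use less.prems in auto)
    show ?case
    proof (cases "S \<inter> {u<..<v} = {}")
      case False
      then obtain s where s: "s \<in> S" "u < s" "s < v" by auto
      have "card (S \<inter> {u<..<s}) < card (S \<inter> {u<..<v})"
        by (rule psubset_card_mono[OF fin]) (use s in auto)
      then have 1: "P u s" using less s by auto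
      have "card (S \<inter> {s<..<v}) < card (S \<inter> {u<..<v})"
        by (rule psubset_card_mono[OF fin]) (use s in auto)
      then have "P s v" using less s by auto
      then show ?thesis using 1 trans less.prems s by blast
    qed (use piece less.prems in auto)
  qed
  then show ?thesis using assms(1) by simp
qed

section \<open>Charts and the Fermat metric\<close>

abbreviation cinv :: "('m, 'e) chart \<Rightarrow> 'e \<Rightarrow> 'm" where
  "cinv \<kappa> \<equiv> inv_into (fst \<kappa>) (snd \<kappa>)"

locale stationary_data =
  fixes A :: "('m::{t2_space, second_countable_topology}, 'e::euclidean_space) chart set"
    and g0 :: "'m \<Rightarrow> ('m, 'e) tvec \<Rightarrow> ('m, 'e) tvec \<Rightarrow> real"
    and \<omega> :: "'m \<Rightarrow> ('m, 'e) tvec \<Rightarrow> real"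
  assumes conn: "connected (UNIV :: 'm set)"
    and atlas: "smooth_atlas A"
    and riem: "riemannian_metric A g0"
    and form: "one_form A \<omega>"
begin

section \<open>Charts, coordinate changes and tangent vectors\<close>

lemma chart_homeomorphism:
  assumes "\<kappa> \<in> A"
  shows "open (fst \<kappa>)" "open (snd \<kappa> ` fst \<kappa>)"
    "homeomorphism (fst \<kappa>) (snd \<kappa> ` fst \<kappa>) (snd \<kappa>) (cinv \<kappa>)"
proof -
  have "is_chart \<kappa>" using atlas assms unfolding smooth_atlas_def by blast
  then show "open (fst \<kappa>)" "open (snd \<kappa> ` fst \<kappa>)"
    "homeomorphism (fst \<kappa>) (snd \<kappa> ` fst \<kappa>) (snd \<kappa>) (cinv \<kappa>)"
    unfolding is_chart_def case_prod_unfold by simp_all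
qed

lemma cinv_chart: "\<kappa> \<in> A \<Longrightarrow> p \<in> fst \<kappa> \<Longrightarrow> cinv \<kappa> (snd \<kappa> p) = p"
  using homeomorphism_apply1[OF chart_homeomorphism(3)] by blast

lemma chart_cinv: "y \<in> snd \<kappa> ` fst \<kappa> \<Longrightarrow> snd \<kappa> (cinv \<kappa> y) = y"
  by (rule f_inv_into_f)

lemma cinv_in: "y \<in> snd \<kappa> ` fst \<kappa> \<Longrightarrow> cinv \<kappa> y \<in> fst \<kappa>"
  by (rule inv_into_into)

lemma continuous_on_chart: "\<kappa> \<in> A \<Longrightarrow> continuous_on (fst \<kappa>) (snd \<kappa>)"
  using chart_homeomorphism(3) homeomorphism_cont1 by blast

lemma continuous_on_cinv: "\<kappa> \<in> A \<Longrightarrow> continuous_on (snd \<kappa> ` fst \<kappa>) (cinv \<kappa>)"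
  using chart_homeomorphism(3) homeomorphism_cont2 by blast

lemma open_chart_image:
  assumes "\<kappa> \<in> A" "open V"
  shows "open (snd \<kappa> ` (fst \<kappa> \<inter> V))"
proof -
  have "snd \<kappa> ` (fst \<kappa> \<inter> V) = cinv \<kappa> -` V \<inter> snd \<kappa> ` fst \<kappa>"
    using cinv_chart[OF assms(1)] by (auto simp: image_iff)
  then show ?thesis
    using continuous_on_cinv[OF assms(1)] chart_homeomorphism(2)[OF assms(1)] assms(2)
    by (simp add: continuous_on_open_vimage)
qed

lemma open_chart_preimage:
  assumes "\<kappa> \<in> A" "open W"
  shows "open (snd \<kappa> -` W \<inter> fst \<kappa>)"
  using continuous_on_chart[OF assms(1)] chart_homeomorphism(1)[OF assms(1)] assms(2)
  by (simp add: continuous_on_open_vimage)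

lemma charts_atD: "\<kappa> \<in> charts_at A p \<Longrightarrow> \<kappa> \<in> A \<and> p \<in> fst \<kappa>"
  unfolding charts_at_def by blast

lemma charts_at_nonempty: "\<exists>\<kappa>. \<kappa> \<in> charts_at A p"
proof -
  have "p \<in> \<Union>(fst ` A)" using atlas unfolding smooth_atlas_def by blast
  then show ?thesis unfolding charts_at_def by blast
qed

lemma transition_smooth:
  assumes "\<kappa> \<in> A" "\<mu> \<in> A"
  shows "smooth_on (snd \<kappa> ` (fst \<kappa> \<inter> fst \<mu>)) (snd \<mu> \<circ> cinv \<kappa>)"
  using atlas assms unfolding smooth_atlas_def case_prod_unfold by blast

lemma chart_change_has_derivative:
  assumes "\<kappa> \<in> charts_at A p" "\<mu> \<in> charts_at A p"
  shows "((snd \<mu> \<circ> cinv \<kappa>) has_derivative chart_change \<kappa> \<mu> p) (at (snd \<kappa> p))"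
proof -
  have "(snd \<mu> \<circ> cinv \<kappa>) differentiable at (snd \<kappa> p)"
    by (rule smooth_on_differentiable[OF transition_smooth]) (use assms charts_atD in blast)+
  then show ?thesis unfolding chart_change_def by (simp add: frechet_derivative_works)
qed

lemma chart_change_linear:
  "\<kappa> \<in> charts_at A p \<Longrightarrow> \<mu> \<in> charts_at A p \<Longrightarrow> linear (chart_change \<kappa> \<mu> p)"
  using chart_change_has_derivative has_derivative_linear by blast

lemma chart_change_comp:
  assumes \<kappa>: "\<kappa> \<in> charts_at A p" and \<mu>: "\<mu> \<in> charts_at A p" and \<nu>: "\<nu> \<in> charts_at A p"
  shows "chart_change \<mu> \<nu> p (chart_change \<kappa> \<mu> p a) = chart_change \<kappa> \<nu> p a"
proof -
  have A: "\<kappa> \<in> A" "\<mu> \<in> A" "\<nu> \<in> A" "p \<in> fst \<kappa>" "p \<in> fst \<mu>"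
    using assms charts_atD by blast+
  have eq: "(snd \<mu> \<circ> cinv \<kappa>) (snd \<kappa> p) = snd \<mu> p" using A by (simp add: cinv_chart)
  have "((snd \<nu> \<circ> cinv \<mu>) has_derivative chart_change \<mu> \<nu> p) (at ((snd \<mu> \<circ> cinv \<kappa>) (snd \<kappa> p)))"
    unfolding eq using chart_change_has_derivative[OF \<mu> \<nu>] .
  from diff_chain_at[OF chart_change_has_derivative[OF \<kappa> \<mu>] this]
  have "(((snd \<nu> \<circ> cinv \<mu>) \<circ> (snd \<mu> \<circ> cinv \<kappa>)) has_derivative
      (chart_change \<mu> \<nu> p \<circ> chart_change \<kappa> \<mu> p)) (at (snd \<kappa> p))" .
  then have "((snd \<nu> \<circ> cinv \<kappa>) has_derivative (chart_change \<mu> \<nu> p \<circ> chart_change \<kappa> \<mu> p)) (at (snd \<kappa> p))"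
  proof (rule has_derivative_transform_within_open)
    show "open (snd \<kappa> ` (fst \<kappa> \<inter> fst \<mu>))" using open_chart_image chart_homeomorphism(1) A by blast
    show "snd \<kappa> p \<in> snd \<kappa> ` (fst \<kappa> \<inter> fst \<mu>)" using A by blast
    fix y assume "y \<in> snd \<kappa> ` (fst \<kappa> \<inter> fst \<mu>)"
    then obtain q where "q \<in> fst \<kappa>" "q \<in> fst \<mu>" "y = snd \<kappa> q" by blast
    then show "((snd \<nu> \<circ> cinv \<mu>) \<circ> (snd \<mu> \<circ> cinv \<kappa>)) y = (snd \<nu> \<circ> cinv \<kappa>) y"
      using A by (simp add: cinv_chart)
  qed
  then have "chart_change \<mu> \<nu> p \<circ> chart_change \<kappa> \<mu> p = chart_change \<kappa> \<nu> p"
    by (rule has_derivative_unique[OF _ chart_change_has_derivative[OF \<kappa> \<nu>]])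
  then show ?thesis by (metis comp_apply)
qed

lemma chart_change_self:
  assumes \<kappa>: "\<kappa> \<in> charts_at A p"
  shows "chart_change \<kappa> \<kappa> p a = a"
proof -
  have A: "\<kappa> \<in> A" "p \<in> fst \<kappa>" using \<kappa> charts_atD by blast+
  have "((\<lambda>y. y) has_derivative (\<lambda>a. a)) (at (snd \<kappa> p))" by (rule has_derivative_ident)
  then have "((snd \<kappa> \<circ> cinv \<kappa>) has_derivative (\<lambda>a. a)) (at (snd \<kappa> p))"
    by (rule has_derivative_transform_within_open[OF _ chart_homeomorphism(2)[OF A(1)]])
      (use A in \<open>auto simp: cinv_chart\<close>)
  from has_derivative_unique[OF this chart_change_has_derivative[OF \<kappa> \<kappa>]] show ?thesis by metis
qed

lemma coord_vec_at: "\<mu> \<in> charts_at A p \<Longrightarrow> coord_vec A \<kappa> p a \<mu> = chart_change \<kappa> \<mu> p a"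
  by (simp add: coord_vec_def)

lemma coord_vec_self: "\<kappa> \<in> charts_at A p \<Longrightarrow> coord_vec A \<kappa> p a \<kappa> = a"
  by (simp add: coord_vec_at chart_change_self)

lemma coord_vec_tangent: "\<kappa> \<in> charts_at A p \<Longrightarrow> coord_vec A \<kappa> p a \<in> tangent_space A p"
  unfolding tangent_space_def by (simp add: coord_vec_at chart_change_comp) (simp add: coord_vec_def)

lemma coord_vec_linear:
  assumes "\<kappa> \<in> charts_at A p"
  shows "coord_vec A \<kappa> p (r *\<^sub>R a + s *\<^sub>R b) = (\<lambda>\<mu>. r *\<^sub>R coord_vec A \<kappa> p a \<mu> + s *\<^sub>R coord_vec A \<kappa> p b \<mu>)"
proof
  fix \<mu>
  show "coord_vec A \<kappa> p (r *\<^sub>R a + s *\<^sub>R b) \<mu> = r *\<^sub>R coord_vec A \<kappa> p a \<mu> + s *\<^sub>R coord_vec A \<kappa> p b \<mu>"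
  proof (cases "\<mu> \<in> charts_at A p")
    case True
    note l = chart_change_linear[OF assms True]
    show ?thesis using True by (simp add: coord_vec_def linear_add[OF l] linear_scale[OF l])
  qed (simp add: coord_vec_def)
qed

lemma tangent_space_change:
  "v \<in> tangent_space A p \<Longrightarrow> \<kappa> \<in> charts_at A p \<Longrightarrow> \<mu> \<in> charts_at A p \<Longrightarrow>
    v \<mu> = chart_change \<kappa> \<mu> p (v \<kappa>)"
  unfolding tangent_space_def by blast

lemma tangent_space_not_chart: "v \<in> tangent_space A p \<Longrightarrow> \<kappa> \<notin> charts_at A p \<Longrightarrow> v \<kappa> = 0"
  unfolding tangent_space_def by blast

section \<open>Pointwise properties of the one-form, the Riemannian metric and the Fermat
  metric\<close>

lemma \<omega>_linear:
  "u \<in> tangent_space A p \<Longrightarrow> v \<in> tangent_space A p \<Longrightarrow>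
    \<omega> p (\<lambda>\<kappa>. r *\<^sub>R u \<kappa> + s *\<^sub>R v \<kappa>) = r * \<omega> p u + s * \<omega> p v"
  using form unfolding one_form_def by blast

lemma g0_linear:
  "u \<in> tangent_space A p \<Longrightarrow> v \<in> tangent_space A p \<Longrightarrow> w \<in> tangent_space A p \<Longrightarrow>
    g0 p (\<lambda>\<kappa>. r *\<^sub>R u \<kappa> + s *\<^sub>R v \<kappa>) w = r * g0 p u w + s * g0 p v w"
  using riem unfolding riemannian_metric_def by blast

lemma g0_sym: "u \<in> tangent_space A p \<Longrightarrow> v \<in> tangent_space A p \<Longrightarrow> g0 p u v = g0 p v u"
  using riem unfolding riemannian_metric_def by blast

lemma g0_pos: "v \<in> tangent_space A p \<Longrightarrow> v \<noteq> (\<lambda>_. 0) \<Longrightarrow> 0 < g0 p v v"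
  using riem unfolding riemannian_metric_def by blast

lemma zero_tangent: "(\<lambda>_. 0) \<in> tangent_space A p"
  unfolding tangent_space_def using chart_change_linear linear_0 by fastforce

lemma \<omega>_zero: "\<omega> p (\<lambda>_. 0) = 0"
  using \<omega>_linear[OF zero_tangent zero_tangent, of p 0 0] by simp

lemma g0_zero: "v \<in> tangent_space A p \<Longrightarrow> g0 p (\<lambda>_. 0) v = 0" "v \<in> tangent_space A p \<Longrightarrow> g0 p v (\<lambda>_. 0) = 0"
  using g0_linear[OF zero_tangent zero_tangent, of v p 0 0] g0_sym[OF zero_tangent, of v p] by simp_all

lemma g0_nonneg: "v \<in> tangent_space A p \<Longrightarrow> 0 \<le> g0 p v v"
  using g0_pos[of v p] g0_zero(1)[of v p] by (cases "v = (\<lambda>_. 0)") (auto intro: less_imp_le)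

abbreviation "F \<equiv> fermat_metric g0 \<omega>"

text \<open>Homogeneity holds for nonnegative factors only: the one-form is odd, so \<open>F\<close>
  is not reversible.\<close>

lemma F_scale:
  assumes v: "v \<in> tangent_space A p" and m: "0 \<le> m"
  shows "F p (\<lambda>\<kappa>. m *\<^sub>R v \<kappa>) = m * F p v"
proof -
  have mv: "(\<lambda>\<kappa>. m *\<^sub>R v \<kappa>) = (\<lambda>\<kappa>. m *\<^sub>R v \<kappa> + 0 *\<^sub>R v \<kappa>)" by simp
  have mvt: "(\<lambda>\<kappa>. m *\<^sub>R v \<kappa>) \<in> tangent_space A p"
  proof -
    have "m *\<^sub>R v \<mu> = chart_change \<kappa> \<mu> p (m *\<^sub>R v \<kappa>)" if "\<kappa> \<in> charts_at A p" "\<mu> \<in> charts_at A p" for \<kappa> \<mu>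
      unfolding linear_scale[OF chart_change_linear[OF that]] tangent_space_change[OF v that, symmetric] ..
    moreover have "m *\<^sub>R v \<kappa> = 0" if "\<kappa> \<notin> charts_at A p" for \<kappa>
      using tangent_space_not_chart[OF v that] by simp
    ultimately show ?thesis unfolding tangent_space_def by blast
  qed
  have w: "\<omega> p (\<lambda>\<kappa>. m *\<^sub>R v \<kappa>) = m * \<omega> p v"
    using \<omega>_linear[OF v v, of m 0] by simp
  have g1: "g0 p (\<lambda>\<kappa>. m *\<^sub>R v \<kappa>) u = m * g0 p v u" if "u \<in> tangent_space A p" for u
    using g0_linear[OF v v that, of m 0] by simp
  have "g0 p (\<lambda>\<kappa>. m *\<^sub>R v \<kappa>) (\<lambda>\<kappa>. m *\<^sub>R v \<kappa>) = m * g0 p v (\<lambda>\<kappa>. m *\<^sub>R v \<kappa>)" by (rule g1[OF mvt])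
  also have "g0 p v (\<lambda>\<kappa>. m *\<^sub>R v \<kappa>) = m * g0 p v v" using g0_sym[OF v mvt] g1[OF v] by simp
  finally have E: "g0 p (\<lambda>\<kappa>. m *\<^sub>R v \<kappa>) (\<lambda>\<kappa>. m *\<^sub>R v \<kappa>) + (\<omega> p (\<lambda>\<kappa>. m *\<^sub>R v \<kappa>))\<^sup>2 =
      m\<^sup>2 * (g0 p v v + (\<omega> p v)\<^sup>2)"
    unfolding w by (simp add: power2_eq_square algebra_simps)
  have "F p (\<lambda>\<kappa>. m *\<^sub>R v \<kappa>) = sqrt (m\<^sup>2 * (g0 p v v + (\<omega> p v)\<^sup>2)) + m * \<omega> p v"
    unfolding fermat_metric_def w E[unfolded w] ..
  also have "\<dots> = m * sqrt (g0 p v v + (\<omega> p v)\<^sup>2) + m * \<omega> p v"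
    unfolding real_sqrt_mult using m by simp
  finally show ?thesis unfolding fermat_metric_def by (simp add: distrib_left)
qed

lemma F_nonneg:
  assumes v: "v \<in> tangent_space A p"
  shows "0 \<le> F p v"
proof -
  have "\<bar>\<omega> p v\<bar> = sqrt ((\<omega> p v)\<^sup>2)" by simp
  also have "\<dots> \<le> sqrt (g0 p v v + (\<omega> p v)\<^sup>2)"
    by (rule real_sqrt_le_mono) (use g0_nonneg[OF v] in simp)
  finally show ?thesis unfolding fermat_metric_def by linarith
qed

lemma F_pos:
  assumes v: "v \<in> tangent_space A p" "v \<noteq> (\<lambda>_. 0)"
  shows "0 < F p v"
proof -
  have "\<bar>\<omega> p v\<bar> = sqrt ((\<omega> p v)\<^sup>2)" by simp
  also have "\<dots> < sqrt (g0 p v v + (\<omega> p v)\<^sup>2)"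
    by (rule real_sqrt_less_mono) (use g0_pos[OF v] in simp)
  finally show ?thesis unfolding fermat_metric_def by linarith
qed

text \<open>The Fermat metric in coordinates. The smoothness of \<open>g0\<close> and
  \<open>\<omega>\<close> is available only in charts, for fixed coordinate vectors.\<close>

definition fc :: "('m, 'e) chart \<Rightarrow> 'e \<Rightarrow> 'e \<Rightarrow> real" where
  "fc \<kappa> y a = F (cinv \<kappa> y) (coord_vec A \<kappa> (cinv \<kappa> y) a)"

lemma linear_euclidean_sum:
  fixes f :: "'e \<Rightarrow> real"
  assumes "linear f"
  shows "f a = (\<Sum>i\<in>Basis. (a \<bullet> i) * f i)"
proof -
  have "f a = f (\<Sum>i\<in>Basis. (a \<bullet> i) *\<^sub>R i)" by (simp add: euclidean_representation)
  also have "\<dots> = (\<Sum>i\<in>Basis. (a \<bullet> i) * f i)" using assms by (simp add: linear_sum linear_scale)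
  finally show ?thesis .
qed

lemma cinv_charts_at: "\<kappa> \<in> A \<Longrightarrow> y \<in> snd \<kappa> ` fst \<kappa> \<Longrightarrow> \<kappa> \<in> charts_at A (cinv \<kappa> y)"
  unfolding charts_at_def using cinv_in by simp

lemma \<omega>_coord_linear:
  assumes "\<kappa> \<in> charts_at A p"
  shows "linear (\<lambda>a. \<omega> p (coord_vec A \<kappa> p a))"
proof (rule linearI)
  note l = coord_vec_linear[OF assms] and t = coord_vec_tangent[OF assms]
  show "\<omega> p (coord_vec A \<kappa> p (a + b)) = \<omega> p (coord_vec A \<kappa> p a) + \<omega> p (coord_vec A \<kappa> p b)" for a b
    using l[of 1 a 1 b] \<omega>_linear[OF t[of a] t[of b], of 1 1] by simp
  show "\<omega> p (coord_vec A \<kappa> p (r *\<^sub>R a)) = r *\<^sub>R \<omega> p (coord_vec A \<kappa> p a)" for r a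
    using l[of r a 0 a] \<omega>_linear[OF t[of a] t[of a], of r 0] by simp
qed

lemma g0_coord_linear:
  assumes "\<kappa> \<in> charts_at A p" "w \<in> tangent_space A p"
  shows "linear (\<lambda>a. g0 p (coord_vec A \<kappa> p a) w)"
proof (rule linearI)
  note l = coord_vec_linear[OF assms(1)] and t = coord_vec_tangent[OF assms(1)]
  show "g0 p (coord_vec A \<kappa> p (a + b)) w = g0 p (coord_vec A \<kappa> p a) w + g0 p (coord_vec A \<kappa> p b) w" for a b
    using l[of 1 a 1 b] g0_linear[OF t[of a] t[of b] assms(2), of 1 1] by simp
  show "g0 p (coord_vec A \<kappa> p (r *\<^sub>R a)) w = r *\<^sub>R g0 p (coord_vec A \<kappa> p a) w" for r a
    using l[of r a 0 a] g0_linear[OF t[of a] t[of a] assms(2), of r 0] by simp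
qed

text \<open>The hypotheses give continuity in the base point for each fixed coordinate vector;
  expanding \<open>a\<close> in \<open>Basis\<close> by linearity makes it joint in both
  arguments.\<close>

lemma continuous_on_fc:
  assumes \<kappa>: "\<kappa> \<in> A"
  shows "continuous_on (snd \<kappa> ` fst \<kappa> \<times> UNIV) (\<lambda>z. fc \<kappa> (fst z) (snd z))"
proof -
  let ?S = "snd \<kappa> ` fst \<kappa>"
  define G where "G a b y = g0 (cinv \<kappa> y) (coord_vec A \<kappa> (cinv \<kappa> y) a) (coord_vec A \<kappa> (cinv \<kappa> y) b)" for a b y
  define W where "W a y = \<omega> (cinv \<kappa> y) (coord_vec A \<kappa> (cinv \<kappa> y) a)" for a y
  have "smooth_on ?S (G a b)" for a b
    using riem \<kappa> unfolding riemannian_metric_def G_def Let_def by blast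
  then have "continuous_on ?S (G a b)" for a b by (rule smooth_on_continuous)
  then have G: "continuous_on (?S \<times> UNIV) (\<lambda>z. G a b (fst z))" for a b
    by (rule continuous_on_compose2[OF _ continuous_on_fst[OF continuous_on_id]]) auto
  have "smooth_on ?S (W a)" for a
    using form \<kappa> unfolding one_form_def W_def Let_def by blast
  then have "continuous_on ?S (W a)" for a by (rule smooth_on_continuous)
  then have W: "continuous_on (?S \<times> UNIV) (\<lambda>z. W a (fst z))" for a
    by (rule continuous_on_compose2[OF _ continuous_on_fst[OF continuous_on_id]]) auto
  let ?w = "\<lambda>z. \<Sum>i\<in>Basis. (snd z \<bullet> i) * W i (fst z)"
  let ?g = "\<lambda>z. \<Sum>i\<in>Basis. (snd z \<bullet> i) * (\<Sum>j\<in>Basis. (snd z \<bullet> j) * G j i (fst z))"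
  have eq: "fc \<kappa> y a = sqrt (?g (y, a) + (?w (y, a))\<^sup>2) + ?w (y, a)" if y: "y \<in> ?S" for y a
  proof -
    note c = cinv_charts_at[OF \<kappa> y]
    note t = coord_vec_tangent[OF c]
    have "W a y = ?w (y, a)"
      using linear_euclidean_sum[OF \<omega>_coord_linear[OF c], of a] by (simp add: W_def)
    moreover have "G a b y = (\<Sum>i\<in>Basis. (a \<bullet> i) * G i b y)" for a b
      using linear_euclidean_sum[OF g0_coord_linear[OF c t[of b]], of a] by (simp add: G_def)
    moreover have "G a b y = G b a y" for a b unfolding G_def by (rule g0_sym[OF t t])
    ultimately show ?thesis unfolding fc_def fermat_metric_def W_def[symmetric] G_def[symmetric]
      by (metis (no_types, lifting) fst_conv snd_conv sum.cong)
  qed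
  have "continuous_on (?S \<times> UNIV) (\<lambda>z. sqrt (?g z + (?w z)\<^sup>2) + ?w z)"
    by (intro continuous_intros G W)
  then show ?thesis
    by (rule continuous_on_eq) (use eq in auto)
qed

lemma fc_scale: "\<kappa> \<in> A \<Longrightarrow> y \<in> snd \<kappa> ` fst \<kappa> \<Longrightarrow> 0 \<le> m \<Longrightarrow> fc \<kappa> y (m *\<^sub>R a) = m * fc \<kappa> y a"
  using F_scale[OF coord_vec_tangent[OF cinv_charts_at], of \<kappa> y m a]
    coord_vec_linear[OF cinv_charts_at, of \<kappa> y m a 0 a] by (simp add: fc_def)

lemma fc_pos:
  assumes "\<kappa> \<in> A" "y \<in> snd \<kappa> ` fst \<kappa>" "a \<noteq> 0"
  shows "0 < fc \<kappa> y a"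
proof -
  note c = cinv_charts_at[OF assms(1,2)]
  have "coord_vec A \<kappa> (cinv \<kappa> y) a \<kappa> \<noteq> 0" using coord_vec_self[OF c] assms(3) by simp
  then have "coord_vec A \<kappa> (cinv \<kappa> y) a \<noteq> (\<lambda>_. 0)" by metis
  then show ?thesis unfolding fc_def by (intro F_pos coord_vec_tangent[OF c])
qed

text \<open>By homogeneity it suffices to bound \<open>fc\<close> on the compact product of
  \<open>K\<close> and the unit sphere, where it is positive.\<close>

lemma fc_bounds:
  assumes \<kappa>: "\<kappa> \<in> A" and K: "compact K" "K \<subseteq> snd \<kappa> ` fst \<kappa>"
  obtains m M where "0 < m" "0 < M" "\<forall>y\<in>K. \<forall>a. m * norm a \<le> fc \<kappa> y a \<and> fc \<kappa> y a \<le> M * norm a"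
proof (cases "K = {}")
  case True
  then show ?thesis using that[of 1 1] by simp
next
  case False
  let ?C = "K \<times> sphere 0 1 :: ('e \<times> 'e) set" and ?f = "\<lambda>z. fc \<kappa> (fst z) (snd z)"
  have C: "compact ?C" using K(1) by (intro compact_Times) auto
  obtain b :: 'e where b: "b \<in> Basis" using nonempty_Basis by blast
  have ne: "?C \<noteq> {}" using False b norm_Basis by force
  have cont: "continuous_on ?C ?f" using continuous_on_fc[OF \<kappa>] by (rule continuous_on_subset) (use K(2) in auto)
  obtain z1 where z1: "z1 \<in> ?C" "\<And>z. z \<in> ?C \<Longrightarrow> ?f z1 \<le> ?f z"
    using continuous_attains_inf[OF C ne cont] by blast
  obtain z2 where z2: "z2 \<in> ?C" "\<And>z. z \<in> ?C \<Longrightarrow> ?f z \<le> ?f z2"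
    using continuous_attains_sup[OF C ne cont] by blast
  have pos: "0 < ?f z" if "z \<in> ?C" for z
  proof (rule fc_pos[OF \<kappa>])
    show "fst z \<in> snd \<kappa> ` fst \<kappa>" using that K(2) by auto
    show "snd z \<noteq> 0" using that by auto
  qed
  have "?f z1 * norm a \<le> fc \<kappa> y a \<and> fc \<kappa> y a \<le> ?f z2 * norm a" if y: "y \<in> K" for y a
  proof (cases "a = 0")
    case True
    then show ?thesis using fc_scale[OF \<kappa>, of y 0 0] y K(2) by auto
  next
    case False
    let ?u = "a /\<^sub>R norm a"
    have u: "(y, ?u) \<in> ?C" using y False by simp
    have "fc \<kappa> y a = norm a * fc \<kappa> y ?u"
      using fc_scale[OF \<kappa>, of y "norm a" ?u] y K(2) False by auto
    moreover have "?f z1 \<le> fc \<kappa> y ?u" "fc \<kappa> y ?u \<le> ?f z2" using z1(2)[OF u] z2(2)[OF u] by simp_all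
    ultimately show ?thesis by (simp add: mult.commute mult_left_mono)
  qed
  then show ?thesis using that[of "?f z1" "?f z2"] pos[OF z1(1)] pos[OF z2(1)] by blast
qed

section \<open>Velocities\<close>

text \<open>Chain rule: the coordinates of a velocity in two charts are related by the derivative of
  the transition map. Hence a velocity is a tangent vector in the sense of
  \<open>tangent_space\<close>, and its Fermat norm can be computed in a single chart.\<close>

lemma velocity_eq_coord_vec:
  assumes ab: "a < b" and c: "smooth_curve_on A {a..b} c" and s: "s \<in> {a..b}" and \<kappa>: "\<kappa> \<in> charts_at A (c s)"
    and w: "((snd \<kappa> \<circ> c) has_vector_derivative w) (at s within {a..b})"
  shows "velocity A c {a..b} s = coord_vec A \<kappa> (c s) w"
proof (rule velocity_eqI[OF ab s])
  fix \<mu> assume \<mu>: "\<mu> \<in> charts_at A (c s)"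
  have "((snd \<mu> \<circ> cinv \<kappa>) has_derivative chart_change \<kappa> \<mu> (c s)) (at ((snd \<kappa> \<circ> c) s))"
    using chart_change_has_derivative[OF \<kappa> \<mu>] by simp
  then have "((snd \<mu> \<circ> cinv \<kappa>) has_derivative chart_change \<kappa> \<mu> (c s))
      (at ((snd \<kappa> \<circ> c) s) within (snd \<kappa> \<circ> c) ` {a..b})"
    by (rule has_derivative_at_withinI)
  from diff_chain_within[OF w[unfolded has_vector_derivative_def] this]
  have "(((snd \<mu> \<circ> cinv \<kappa>) \<circ> (snd \<kappa> \<circ> c)) has_derivative
      (chart_change \<kappa> \<mu> (c s) \<circ> (\<lambda>x. x *\<^sub>R w))) (at s within {a..b})" .
  moreover have "chart_change \<kappa> \<mu> (c s) \<circ> (\<lambda>x. x *\<^sub>R w) = (\<lambda>x. x *\<^sub>R chart_change \<kappa> \<mu> (c s) w)"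
    using linear_scale[OF chart_change_linear[OF \<kappa> \<mu>]] by (auto simp: comp_def)
  ultimately have "(((snd \<mu> \<circ> cinv \<kappa>) \<circ> (snd \<kappa> \<circ> c)) has_vector_derivative chart_change \<kappa> \<mu> (c s) w)
      (at s within {a..b})"
    unfolding has_vector_derivative_def by simp
  moreover obtain \<epsilon> where "\<epsilon> > 0" "\<forall>r\<in>{a..b} \<inter> ball s \<epsilon>. c r \<in> fst \<kappa>"
    using smooth_curve_chart[OF c s \<kappa>] by blast
  ultimately have "((snd \<mu> \<circ> c) has_vector_derivative chart_change \<kappa> \<mu> (c s) w) (at s within {a..b})"
    using s charts_atD[OF \<kappa>]
    by (elim has_vector_derivative_transform_within) (auto simp: cinv_chart dist_commute)
  then show "((snd \<mu> \<circ> c) has_vector_derivative coord_vec A \<kappa> (c s) w \<mu>) (at s within {a..b})"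
    by (simp add: coord_vec_at[OF \<mu>])
qed (simp add: coord_vec_def)

lemma velocity_tangent:
  assumes ab: "a < b" and c: "smooth_curve_on A {a..b} c" and s: "s \<in> {a..b}"
  shows "velocity A c {a..b} s \<in> tangent_space A (c s)"
proof -
  obtain \<kappa> where \<kappa>: "\<kappa> \<in> charts_at A (c s)" using charts_at_nonempty by blast
  then show ?thesis
    using velocity_eq_coord_vec[OF ab c s \<kappa> has_vector_derivative_velocity[OF ab c s \<kappa>]]
      coord_vec_tangent by metis
qed

lemma F_velocity_chart:
  assumes ab: "a < b" and c: "smooth_curve_on A {a..b} c" and s: "s \<in> {a..b}" and \<kappa>: "\<kappa> \<in> charts_at A (c s)"
    and w: "((snd \<kappa> \<circ> c) has_vector_derivative w) (at s within {a..b})"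
  shows "F (c s) (velocity A c {a..b} s) = fc \<kappa> (snd \<kappa> (c s)) w"
  unfolding velocity_eq_coord_vec[OF assms] fc_def using charts_atD[OF \<kappa>] by (simp add: cinv_chart)

lemma continuous_on_F_velocity:
  assumes ab: "a < b" and c: "smooth_curve_on A {a..b} c"
  shows "continuous_on {a..b} (\<lambda>s. F (c s) (velocity A c {a..b} s))"
proof (rule continuous_on_eq_continuous_within[THEN iffD2, OF ballI])
  fix s assume s: "s \<in> {a..b}"
  obtain \<kappa> where \<kappa>: "\<kappa> \<in> charts_at A (c s)" using charts_at_nonempty by blast
  have \<kappa>A: "\<kappa> \<in> A" using charts_atD[OF \<kappa>] by blast
  obtain \<epsilon> w where \<epsilon>: "\<epsilon> > 0" and w: "continuous_on ({a..b} \<inter> ball s \<epsilon>) w"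
    and vd: "\<forall>r\<in>{a..b} \<inter> ball s \<epsilon>. c r \<in> fst \<kappa> \<and> ((snd \<kappa> \<circ> c) has_vector_derivative w r) (at r within {a..b})"
    using smooth_curve_chart[OF c s \<kappa>] by blast
  let ?N = "{a..b} \<inter> ball s \<epsilon>"
  have "continuous (at r within {a..b}) (snd \<kappa> \<circ> c)" if "r \<in> ?N" for r
    using vd that has_vector_derivative_continuous by blast
  then have "continuous_on ?N (snd \<kappa> \<circ> c)"
    unfolding continuous_on_eq_continuous_within by (meson continuous_within_subset inf_le1)
  then have "continuous_on ?N (\<lambda>r. (snd \<kappa> (c r), w r))"
    using w by (intro continuous_on_Pair) (simp_all add: comp_def)
  moreover have "(\<lambda>r. (snd \<kappa> (c r), w r)) ` ?N \<subseteq> snd \<kappa> ` fst \<kappa> \<times> UNIV" using vd by auto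
  ultimately have "continuous_on ?N (\<lambda>r. fc \<kappa> (snd \<kappa> (c r)) (w r))"
    using continuous_on_compose2[OF continuous_on_fc[OF \<kappa>A]] by fastforce
  moreover have "fc \<kappa> (snd \<kappa> (c r)) (w r) = F (c r) (velocity A c {a..b} r)" if r: "r \<in> ?N" for r
  proof -
    have "\<kappa> \<in> charts_at A (c r)" using vd r \<kappa>A unfolding charts_at_def by blast
    then show ?thesis using F_velocity_chart[OF ab c, of r \<kappa> "w r"] vd r by simp
  qed
  ultimately have "continuous_on ?N (\<lambda>s. F (c s) (velocity A c {a..b} s))" by (rule continuous_on_eq)
  then have "continuous (at s within ?N) (\<lambda>s. F (c s) (velocity A c {a..b} s))"
    using s \<epsilon> unfolding continuous_on_eq_continuous_within by simp
  moreover have "at s within ?N = at s within {a..b}"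
    using \<epsilon> by (intro at_within_nhd[of s "ball s \<epsilon>"]) auto
  ultimately show "continuous (at s within {a..b}) (\<lambda>s. F (c s) (velocity A c {a..b} s))" by simp
qed

section \<open>Curves of Fermat speed less than one\<close>

abbreviation "speed_lt_1 \<equiv> \<lambda>p v. F p v < 1"

text \<open>In the spacetime, the graph of such a curve is future-directed timelike from
  \<open>(t, x)\<close> to \<open>(t + T, y)\<close>. The exact duration is recorded, rather than a
  length, because durations add up under concatenation.\<close>

definition link :: "'m \<Rightarrow> 'm \<Rightarrow> real \<Rightarrow> bool" where
  "link x y T \<longleftrightarrow> 0 < T \<and> (\<exists>c S. c 0 = x \<and> c T = y \<and> arcs_on A speed_lt_1 c {0..T} S)"

lemma arcs_on_shift:
  assumes "arcs_on B Q c {a..b} S"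
  shows "arcs_on B Q (\<lambda>s. c (p + s)) {a - p..b - p} ((\<lambda>s. s - p) ` S)"
  unfolding arcs_on_def
proof (intro conjI allI impI)
  fix u v assume uv: "{u..v} \<subseteq> {a - p..b - p}"
  have sub: "{p + u..p + v} \<subseteq> {a..b}"
    using uv by (cases "u \<le> v") auto
  then have "finite ((\<lambda>s. s - p) ` (S \<inter> {p + u..p + v}))"
    using assms unfolding arcs_on_def by blast
  moreover have "(\<lambda>s. s - p) ` S \<inter> {u..v} \<subseteq> (\<lambda>s. s - p) ` (S \<inter> {p + u..p + v})" by auto
  ultimately show "finite ((\<lambda>s. s - p) ` S \<inter> {u..v})" by (rule rev_finite_subset)
next
  fix u v assume uv: "u < v \<and> {u..v} \<subseteq> {a - p..b - p} \<and> (\<lambda>s. s - p) ` S \<inter> {u<..<v} = {}"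
  have "S \<inter> {p + u<..<p + v} = {}"
  proof (rule equals0I)
    fix s assume "s \<in> S \<inter> {p + u<..<p + v}"
    then have "s - p \<in> (\<lambda>s. s - p) ` S \<inter> {u<..<v}" by auto
    then show False using uv by blast
  qed
  moreover have "{p + u..p + v} \<subseteq> {a..b}" using uv by auto
  ultimately have "arc_on B Q c (p + u) (p + v)" using assms uv unfolding arcs_on_def by simp
  from arc_on_shift[OF this, of p] show "arc_on B Q (\<lambda>s. c (p + s)) u v" by simp
qed

lemma link_of_arcs:
  assumes "arcs_on A speed_lt_1 c I S" "u < v" "{u..v} \<subseteq> I"
  shows "link (c u) (c v) (v - u)"
proof -
  have "arcs_on A speed_lt_1 c {u..v} S" using assms(1,3) by (rule arcs_on_subset)
  from arcs_on_shift[OF this, of u]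
  have "arcs_on A speed_lt_1 (\<lambda>s. c (u + s)) {0..v - u} ((\<lambda>s. s - u) ` S)" by simp
  then show ?thesis
    unfolding link_def using assms(2)
    by (intro conjI exI[of _ "\<lambda>s. c (u + s)"] exI[of _ "(\<lambda>s. s - u) ` S"]) simp_all
qed

lemma arcs_on_cong:
  assumes "arcs_on B Q c I S" "\<And>s. s \<in> I \<Longrightarrow> c s = c' s"
  shows "arcs_on B Q c' I S"
  unfolding arcs_on_def
proof (intro conjI allI impI)
  show "finite (S \<inter> {a..b})" if "{a..b} \<subseteq> I" for a b using assms(1) that unfolding arcs_on_def by blast
  fix a b assume ab: "a < b \<and> {a..b} \<subseteq> I \<and> S \<inter> {a<..<b} = {}"
  then have "arc_on B Q c a b" using assms(1) unfolding arcs_on_def by blast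
  then show "arc_on B Q c' a b" by (rule arc_on_cong) (use ab assms(2) in blast)
qed

lemma arc_on_imp_arcs_on: "arc_on B Q c a b \<Longrightarrow> arcs_on B Q c {a..b} {}"
  unfolding arcs_on_def using arc_on_subinterval[of B Q c a b] by simp

text \<open>Infinitely many links are glued at the times \<open>T n\<close>. The break points
  accumulate at most at the supremum of these times, which \<open>piecewise_smooth_on\<close>
  permits.\<close>

lemma link_chain:
  assumes link: "\<And>n. link (X n) (X (Suc n)) (T (Suc n) - T n)"
  obtains c S where "arcs_on A speed_lt_1 c {s. T 0 \<le> s \<and> (\<exists>n. s < T n)} S" "\<And>n. c (T n) = X n"
proof -
  obtain e E where e: "\<And>n. e n 0 = X n" "\<And>n. e n (T (Suc n) - T n) = X (Suc n)"
    "\<And>n. arcs_on A speed_lt_1 (e n) {0..T (Suc n) - T n} (E n)"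
    using link unfolding link_def by metis
  have Tlt: "T n < T (Suc n)" for n using link[of n] unfolding link_def by simp
  then have mono: "strict_mono T" by (rule strict_monoI_Suc)
  define N where "N s = (LEAST n. s < T (Suc n))" for s
  define c where "c s = e (N s) (s - T (N s))" for s
  have N_eq: "N s = n" if "T n \<le> s" "s < T (Suc n)" for s n
    unfolding N_def
  proof (rule Least_equality)
    show "n \<le> m" if "s < T (Suc m)" for m
    proof (rule ccontr)
      assume "\<not> n \<le> m"
      then have "T (Suc m) \<le> T n" using mono by (simp add: strict_mono_less_eq)
      then show False using that \<open>T n \<le> s\<close> by simp
    qed
  qed (rule that(2))
  have cT: "c (T n) = X n" for n using N_eq[of n "T n"] Tlt e(1) by (simp add: c_def)
  have c_eq: "c s = e n (s - T n)" if "s \<in> {T n..T (Suc n)}" for s n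
  proof (cases "s < T (Suc n)")
    case True
    then show ?thesis using N_eq[of n s] that by (simp add: c_def)
  next
    case False
    then have "s = T (Suc n)" using that by simp
    then show ?thesis using cT[of "Suc n"] e(2) by simp
  qed
  \<comment> \<open>The break points of each piece are clipped to its own interval, since the
    shifted sets \<open>E n\<close> are known to be finite only there.\<close>
  define S' where "S' = range T \<union> (\<Union>n. ((\<lambda>s. s + T n) ` E n) \<inter> {T n..T (Suc n)})"
  have piece: "arcs_on A speed_lt_1 c {T n..T (Suc n)} ((\<lambda>s. s + T n) ` E n)" for n
  proof -
    have "arcs_on A speed_lt_1 (\<lambda>s. e n (- T n + s)) {T n..T (Suc n)} ((\<lambda>s. s + T n) ` E n)"
      using arcs_on_shift[OF e(3)[of n], of "- T n"] by simp
    then show ?thesis by (rule arcs_on_cong) (simp add: c_eq)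
  qed
  have interval: "\<exists>n. T n \<le> s \<and> s < T (Suc n)" if "T 0 \<le> s" "s < T k" for s k
    using that
  proof (induction k)
    case (Suc k)
    show ?case
    proof (cases "s < T k")
      case False
      then have "T k \<le> s \<and> s < T (Suc k)" using Suc.prems by simp
      then show ?thesis by blast
    qed (use Suc in blast)
  qed simp
  have "arcs_on A speed_lt_1 c {s. T 0 \<le> s \<and> (\<exists>n. s < T n)} S'"
    unfolding arcs_on_def
  proof (intro conjI allI impI)
    fix a b assume ab: "{a..b} \<subseteq> {s. T 0 \<le> s \<and> (\<exists>n. s < T n)}"
    show "finite (S' \<inter> {a..b})"
    proof (cases "a \<le> b")
      case True
      then obtain k where k: "b < T k" using ab by auto
      have "S' \<inter> {a..b} \<subseteq> T ` {..k} \<union> (\<Union>n\<in>{..k}. ((\<lambda>s. s + T n) ` E n) \<inter> {T n..T (Suc n)})"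
      proof
        fix s assume s: "s \<in> S' \<inter> {a..b}"
        have le: "n \<le> k" if "T n \<le> s" for n
        proof (rule ccontr)
          assume "\<not> n \<le> k"
          then have "T k \<le> T n" using mono by (simp add: strict_mono_less_eq)
          then show False using that s k by simp
        qed
        from s consider n where "s = T n" | n where "s \<in> ((\<lambda>s. s + T n) ` E n) \<inter> {T n..T (Suc n)}"
          unfolding S'_def by blast
        then show "s \<in> T ` {..k} \<union> (\<Union>n\<in>{..k}. ((\<lambda>s. s + T n) ` E n) \<inter> {T n..T (Suc n)})"
        proof cases
          case (1 n) then show ?thesis using le[of n] by blast
        next
          case (2 n)
          then have "n \<in> {..k}" using le[of n] by simp
          then show ?thesis using 2 by blast
        qed
      qed
      moreover have "finite (((\<lambda>s. s + T n) ` E n) \<inter> {T n..T (Suc n)})" for n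
        using piece[of n] unfolding arcs_on_def by blast
      ultimately show ?thesis by (meson finite_UN_I finite_Un finite_atMost finite_imageI finite_subset)
    qed simp
  next
    fix a b assume ab: "a < b \<and> {a..b} \<subseteq> {s. T 0 \<le> s \<and> (\<exists>n. s < T n)} \<and> S' \<inter> {a<..<b} = {}"
    have "{a..b} \<subseteq> {s. T 0 \<le> s \<and> (\<exists>n. s < T n)}" "a \<in> {a..b}" using ab by simp_all
    then have "a \<in> {s. T 0 \<le> s \<and> (\<exists>n. s < T n)}" by (rule subsetD)
    then obtain n where n: "T n \<le> a" "a < T (Suc n)" using interval by blast
    have bn: "b \<le> T (Suc n)"
    proof (rule ccontr)
      assume "\<not> b \<le> T (Suc n)"
      then have "T (Suc n) \<in> S' \<inter> {a<..<b}" using n unfolding S'_def by simp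
      then show False using ab by blast
    qed
    have "((\<lambda>s. s + T n) ` E n) \<inter> {a<..<b} = {}"
    proof -
      have "((\<lambda>s. s + T n) ` E n) \<inter> {a<..<b} \<subseteq> ((\<lambda>s. s + T n) ` E n) \<inter> {T n..T (Suc n)} \<inter> {a<..<b}"
        using n bn by auto
      also have "\<dots> \<subseteq> S' \<inter> {a<..<b}" unfolding S'_def by blast
      finally show ?thesis using ab by blast
    qed
    moreover have "{a..b} \<subseteq> {T n..T (Suc n)}" using n bn by auto
    ultimately show "arc_on A speed_lt_1 c a b" using piece[of n] ab unfolding arcs_on_def by blast
  qed
  then show ?thesis using cT by (rule that)
qed

lemma link_trans:
  assumes xy: "link x y S" and yz: "link y z T"
  shows "link x z (S + T)"
proof -
  obtain c C where c: "c 0 = x" "c S = y" "arcs_on A speed_lt_1 c {0..S} C" and S: "0 < S"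
    using xy unfolding link_def by blast
  obtain e E where e: "e 0 = y" "e T = z" "arcs_on A speed_lt_1 e {0..T} E" and T: "0 < T"
    using yz unfolding link_def by blast
  define f where "f s = (if s \<le> S then c s else e (s - S))" for s
  let ?E = "(\<lambda>s. s + S) ` E"
  have 1: "arcs_on A speed_lt_1 f {0..S} C"
    using c(3) by (rule arcs_on_cong) (simp add: f_def)
  have "arcs_on A speed_lt_1 (\<lambda>s. e (- S + s)) {S..S + T} ?E"
    using arcs_on_shift[OF e(3), of "- S"] by (simp add: add.commute)
  then have 2: "arcs_on A speed_lt_1 f {S..S + T} ?E"
    by (rule arcs_on_cong) (auto simp: f_def c e)
  have "arcs_on A speed_lt_1 f {0..S + T} (insert S ((C \<inter> {0..S}) \<union> (?E \<inter> {S..S + T})))"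
    unfolding arcs_on_def
  proof (intro conjI allI impI)
    have "finite (C \<inter> {0..S})" "finite (?E \<inter> {S..S + T})" using 1 2 unfolding arcs_on_def by blast+
    then show "finite (insert S ((C \<inter> {0..S}) \<union> (?E \<inter> {S..S + T})) \<inter> {a..b})" for a b by blast
    fix a b assume ab: "a < b \<and> {a..b} \<subseteq> {0..S + T} \<and>
      insert S ((C \<inter> {0..S}) \<union> (?E \<inter> {S..S + T})) \<inter> {a<..<b} = {}"
    then have ab': "0 \<le> a" "b \<le> S + T" "S \<notin> {a<..<b}" by auto
    show "arc_on A speed_lt_1 f a b"
    proof (cases "b \<le> S")
      case True
      then have "{a..b} \<subseteq> {0..S}" using ab' by auto
      moreover have "C \<inter> {a<..<b} = {}"
      proof -
        have "C \<inter> {a<..<b} \<subseteq> (C \<inter> {0..S}) \<inter> {a<..<b}" using True ab' by auto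
        then show ?thesis using ab by blast
      qed
      ultimately show ?thesis using 1 ab unfolding arcs_on_def by blast
    next
      case False
      then have aS: "S \<le> a" using ab' by auto
      then have "{a..b} \<subseteq> {S..S + T}" using ab' by auto
      moreover have "?E \<inter> {a<..<b} = {}"
      proof -
        have "?E \<inter> {a<..<b} \<subseteq> (?E \<inter> {S..S + T}) \<inter> {a<..<b}" using aS ab' by auto
        then show ?thesis using ab by blast
      qed
      ultimately show ?thesis using 2 ab unfolding arcs_on_def by blast
    qed
  qed
  moreover have "f 0 = x" "f (S + T) = z" using S T c e by (simp_all add: f_def)
  ultimately show ?thesis unfolding link_def using S T
    by (intro conjI exI[of _ f] exI[of _ "insert S ((C \<inter> {0..S}) \<union> (?E \<inter> {S..S + T}))"]) simp_all
qed

text \<open>Rescaling the parameter linearly to the duration \<open>T\<close> multiplies the speed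
  by \<open>m = (v - u) / T\<close>, and \<open>m * K \<le> 1\<close>.\<close>

lemma link_of_speed_bound:
  assumes uv: "u < v" and c: "smooth_curve_on A {u..v} c"
    and K: "\<And>s. s \<in> {u..v} \<Longrightarrow> F (c s) (velocity A c {u..v} s) < K" and T: "K * (v - u) \<le> T"
  shows "link (c u) (c v) T"
proof -
  have F0: "0 \<le> F (c s) (velocity A c {u..v} s)" if "s \<in> {u..v}" for s
    using F_nonneg[OF velocity_tangent[OF uv c that]] .
  have K0: "0 < K" using K[of u] F0[of u] uv by simp
  then have T0: "0 < T" using T uv by (smt (verit) mult_pos_pos)
  define m where "m = (v - u) / T"
  have m: "0 < m" "m * K \<le> 1" "m * T = v - u"
    using uv T0 T by (simp_all add: m_def field_simps)
  have im: "u + m * s \<in> {u..v}" if "s \<in> {0..T}" for s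
    using that m mult_left_mono[of s T m] by auto
  have "arc_on A speed_lt_1 (\<lambda>s. c (u + m * s)) 0 T"
    unfolding arc_on_def
  proof (intro conjI ballI T0)
    show "smooth_curve_on A {0..T} (\<lambda>s. c (u + m * s))" using c im by (rule smooth_curve_on_affine)
    fix s assume s: "s \<in> {0..T}"
    have vel: "velocity A (\<lambda>s. c (u + m * s)) {0..T} s = (\<lambda>\<kappa>. m *\<^sub>R velocity A c {u..v} (u + m * s) \<kappa>)"
      using uv c T0 s im by (rule velocity_affine)
    have "F (c (u + m * s)) (velocity A (\<lambda>s. c (u + m * s)) {0..T} s) =
        m * F (c (u + m * s)) (velocity A c {u..v} (u + m * s))"
      unfolding vel using velocity_tangent[OF uv c im[OF s]] m(1) by (intro F_scale) auto
    also have "\<dots> < m * K" using K[OF im[OF s]] m(1) by simp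
    also have "\<dots> \<le> 1" by (rule m(2))
    finally show "F (c (u + m * s)) (velocity A (\<lambda>s. c (u + m * s)) {0..T} s) < 1" .
  qed
  from arc_on_imp_arcs_on[OF this] show ?thesis
    unfolding link_def using T0 m(3)
    by (intro conjI exI[of _ "\<lambda>s. c (u + m * s)"] exI[of _ "{}"]) simp_all
qed

text \<open>The fine subdivision is delegated to \<open>Bolzano\<close>, which reduces the claim to
  short intervals around a point \<open>x\<close>. There the speed stays within \<open>e / 2\<close>
  of its value at \<open>x\<close>, so linear rescaling costs at most \<open>e\<close> per unit of
  parameter more than the integral.\<close>

lemma link_smooth:
  assumes ab: "a < b" and c: "smooth_curve_on A {a..b} c" and e: "0 < e"
  shows "link (c a) (c b) (integral {a..b} (\<lambda>s. F (c s) (velocity A c {a..b} s)) + e * (b - a))"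
proof -
  let ?f = "\<lambda>s. F (c s) (velocity A c {a..b} s)"
  have cont: "continuous_on {a..b} ?f" by (rule continuous_on_F_velocity[OF ab c])
  have "a \<le> u \<and> u < v \<and> v \<le> b \<longrightarrow> link (c u) (c v) (integral {u..v} ?f + e * (v - u))"
    if "u = a" "v = b" for u v
  proof -
    have "a \<le> b" using ab by simp
    then have "a \<le> a \<and> a < b \<and> b \<le> b \<longrightarrow> link (c a) (c b) (integral {a..b} ?f + e * (b - a))"
    proof (induction rule: Bolzano[where P = "\<lambda>u v. a \<le> u \<and> u < v \<and> v \<le> b \<longrightarrow>
          link (c u) (c v) (integral {u..v} ?f + e * (v - u))"])
      case (trans u v w)
      show ?case
      proof (intro impI)
        assume *: "a \<le> u \<and> u < w \<and> w \<le> b"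
        show "link (c u) (c w) (integral {u..w} ?f + e * (w - u))"
        proof (cases "u < v \<and> v < w")
          case True
          then have "link (c u) (c v) (integral {u..v} ?f + e * (v - u))"
            "link (c v) (c w) (integral {v..w} ?f + e * (w - v))" using trans * by auto
          from link_trans[OF this]
          have "link (c u) (c w) ((integral {u..v} ?f + integral {v..w} ?f) + e * (w - u))"
            by (simp add: algebra_simps)
          moreover have "?f integrable_on {u..w}"
            by (rule integrable_continuous_real[OF continuous_on_subset[OF cont]]) (use * in auto)
          then have "integral {u..v} ?f + integral {v..w} ?f = integral {u..w} ?f"
            using trans(3,4) by (intro Henstock_Kurzweil_Integration.integral_combine)
          ultimately show ?thesis by simp
        next
          case False
          then have "u = v \<or> v = w" using trans(3,4) by linarith
          then show ?thesis using trans(1,2) * by auto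
        qed
      qed
    next
      case (local x)
      then have x: "x \<in> {a..b}" by simp
      obtain \<delta> where \<delta>: "\<delta> > 0" "\<And>y. y \<in> {a..b} \<Longrightarrow> dist y x < \<delta> \<Longrightarrow> dist (?f y) (?f x) < e / 2"
        using cont[unfolded continuous_on_iff, rule_format, OF x, of "e / 2"] e by auto
      have "link (c u) (c v) (integral {u..v} ?f + e * (v - u))"
        if *: "u \<le> x" "x \<le> v" "v - u < \<delta>" "a \<le> u" "u < v" "v \<le> b" for u v
      proof (rule link_of_speed_bound)
        show "u < v" by (rule *)
        show cuv: "smooth_curve_on A {u..v} c" using c by (rule smooth_curve_on_subset) (use * in auto)
        have near: "\<bar>?f s - ?f x\<bar> < e / 2" if "s \<in> {u..v}" for s
          using \<delta>(2)[of s] that * by (auto simp: dist_real_def)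
        show "F (c s) (velocity A c {u..v} s) < ?f x + e / 2" if s: "s \<in> {u..v}" for s
        proof -
          have eq: "velocity A c {u..v} s = velocity A c {a..b} s"
            by (rule velocity_subinterval[OF c]) (use * s in auto)
          show ?thesis using near[OF s] unfolding eq abs_less_iff by linarith
        qed
        have int: "?f integrable_on {u..v}"
          by (rule integrable_continuous_real[OF continuous_on_subset[OF cont]]) (use * in auto)
        have "integral {u..v} (\<lambda>_. ?f x - e / 2) \<le> integral {u..v} ?f"
        proof (rule integral_le[OF _ int])
          show "?f x - e / 2 \<le> ?f s" if "s \<in> {u..v}" for s
            using near[OF that] unfolding abs_less_iff by linarith
        qed (rule integrable_const_ivl)
        then have "(?f x - e / 2) * (v - u) \<le> integral {u..v} ?f" using *(5) by (simp add: mult.commute)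
        then show "(?f x + e / 2) * (v - u) \<le> integral {u..v} ?f + e * (v - u)"
        proof -
          have "(?f x + e / 2) * (v - u) = ((?f x - e / 2) + e) * (v - u)" by simp
          also have "\<dots> = (?f x - e / 2) * (v - u) + e * (v - u)" by (rule distrib_right)
          finally show ?thesis using \<open>(?f x - e / 2) * (v - u) \<le> integral {u..v} ?f\<close> by linarith
        qed
      qed
      then show ?case using \<delta>(1) by (intro exI[of _ \<delta>]) auto
    qed
    then show ?thesis using that by simp
  qed
  then show ?thesis using ab by simp
qed

text \<open>\<open>fermat_length\<close> takes velocities relative to the whole interval, which are
  meaningless at a corner of the curve. They agree with those of the piece except possibly at its
  two end points, and these do not affect the integral.\<close>

lemma fermat_length_piece:
  assumes uv: "u < v" "{u..v} \<subseteq> {a..b}" and c: "smooth_curve_on A {u..v} c"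
  shows "((\<lambda>s. F (c s) (velocity A c {a..b} s)) has_integral
    integral {u..v} (\<lambda>s. F (c s) (velocity A c {u..v} s))) {u..v}"
proof (rule has_integral_spike_finite)
  show "finite {u, v}" by simp
  show "((\<lambda>s. F (c s) (velocity A c {u..v} s)) has_integral
      integral {u..v} (\<lambda>s. F (c s) (velocity A c {u..v} s))) {u..v}"
    by (intro integrable_integral integrable_continuous_real continuous_on_F_velocity uv(1) c)
  fix s assume s: "s \<in> {u..v} - {u, v}"
  then have s': "u < s" "s < v" by auto
  moreover have "a < s" "s < b" using uv s' by auto
  ultimately have eq: "at s within {a..b} = at s within {u..v}" by (simp add: at_within_Icc_at)
  show "F (c s) (velocity A c {a..b} s) = F (c s) (velocity A c {u..v} s)" unfolding velocity_def eq ..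
qed

lemma link_of_length:
  assumes ab: "a < b" and c: "piecewise_smooth_on A {a..b} c" and e: "0 < e"
  shows "link (c a) (c b) (fermat_length A g0 \<omega> a b c + e * (b - a))"
proof -
  let ?f = "\<lambda>s. F (c s) (velocity A c {a..b} s)"
  obtain S where S0: "(\<forall>u v. {u..v} \<subseteq> {a..b} \<longrightarrow> finite (S \<inter> {u..v})) \<and>
      (\<forall>u v. u < v \<and> {u..v} \<subseteq> {a..b} \<and> S \<inter> {u<..<v} = {} \<longrightarrow> smooth_curve_on A {u..v} c)"
    using c unfolding piecewise_smooth_on_def ..
  have S: "finite (S \<inter> {a..b})"
    "\<And>u v. u < v \<Longrightarrow> {u..v} \<subseteq> {a..b} \<Longrightarrow> S \<inter> {u<..<v} = {} \<Longrightarrow> smooth_curve_on A {u..v} c"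
    using S0 by simp_all
  have "?f integrable_on {a..b} \<and> link (c a) (c b) (integral {a..b} ?f + e * (b - a))"
  proof (rule piecewise_induct[OF ab S(1), where
        P = "\<lambda>u v. ?f integrable_on {u..v} \<and> link (c u) (c v) (integral {u..v} ?f + e * (v - u))"])
    fix u v assume uv: "u < v" "{u..v} \<subseteq> {a..b}" "S \<inter> {u<..<v} = {}"
    note cuv = S(2)[OF uv]
    note i = fermat_length_piece[OF uv(1,2) cuv]
    show "?f integrable_on {u..v} \<and> link (c u) (c v) (integral {u..v} ?f + e * (v - u))"
      using i link_smooth[OF uv(1) cuv e] integral_unique[OF i] has_integral_integrable[OF i] by simp
  next
    fix u v w assume uvw: "u < v" "v < w"
      and 1: "?f integrable_on {u..v} \<and> link (c u) (c v) (integral {u..v} ?f + e * (v - u))"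
      and 2: "?f integrable_on {v..w} \<and> link (c v) (c w) (integral {v..w} ?f + e * (w - v))"
    have i: "?f integrable_on {u..w}"
      using 1 2 uvw by (intro Henstock_Kurzweil_Integration.integrable_combine[of u v w]) auto
    moreover have "integral {u..v} ?f + integral {v..w} ?f = integral {u..w} ?f"
      using uvw i by (intro Henstock_Kurzweil_Integration.integral_combine) auto
    moreover have "link (c u) (c w) ((integral {u..v} ?f + e * (v - u)) + (integral {v..w} ?f + e * (w - v)))"
      by (rule link_trans[OF conjunct2[OF 1] conjunct2[OF 2]])
    ultimately show "?f integrable_on {u..w} \<and> link (c u) (c w) (integral {u..w} ?f + e * (w - u))"
      by (simp add: algebra_simps)
  qed
  then show ?thesis unfolding fermat_length_def by blast
qed

text \<open>A negative length would, with the slack \<open>?e\<close> that cancels it, produce a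
  link of duration zero.\<close>

lemma fermat_length_nonneg: "a < b \<Longrightarrow> piecewise_smooth_on A {a..b} c \<Longrightarrow> 0 \<le> fermat_length A g0 \<omega> a b c"
proof (rule ccontr)
  assume ab: "a < b" and c: "piecewise_smooth_on A {a..b} c" and neg: "\<not> 0 \<le> fermat_length A g0 \<omega> a b c"
  let ?e = "- fermat_length A g0 \<omega> a b c / (b - a)"
  have "0 < ?e" using ab neg by (intro divide_pos_pos) auto
  from link_of_length[OF ab c this] show False using ab by (simp add: link_def)
qed

abbreviation "d \<equiv> fermat_dist A g0 \<omega>"

lemma fermat_dist_le:
  assumes "a < b" "piecewise_smooth_on A {a..b} c"
  shows "d (c a) (c b) \<le> fermat_length A g0 \<omega> a b c"
  unfolding fermat_dist_def
proof (rule cInf_lower)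
  show "bdd_below {fermat_length A g0 \<omega> a' b' c' |a' b' c'.
      a' < b' \<and> piecewise_smooth_on A {a'..b'} c' \<and> c' a' = c a \<and> c' b' = c b}"
    by (rule bdd_belowI[of _ 0]) (use fermat_length_nonneg in blast)
qed (use assms in blast)

text \<open>The assumed link guarantees that the set of lengths is nonempty, so that its
  \<open>Inf\<close> is a genuine infimum.\<close>

lemma link_of_fermat_dist_less:
  assumes ne: "link x y S" and T: "d x y < T"
  shows "link x y T"
proof -
  let ?L = "{fermat_length A g0 \<omega> a b c |a b c. a < b \<and> piecewise_smooth_on A {a..b} c \<and> c a = x \<and> c b = y}"
  obtain c C where "c 0 = x" "c S = y" "arcs_on A speed_lt_1 c {0..S} C" "0 < S"
    using ne unfolding link_def by blast
  then have "?L \<noteq> {}" using arcs_on_imp_piecewise(1) by blast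
  then obtain l where "l \<in> ?L" "l < T" using T unfolding fermat_dist_def by (meson cInf_lessD)
  then obtain a b e where e: "a < b" "piecewise_smooth_on A {a..b} e" "e a = x" "e b = y"
    "fermat_length A g0 \<omega> a b e < T" by blast
  \<comment> \<open>The remaining time is spread evenly over the parameter interval, so that the
    link has duration exactly \<open>T\<close>.\<close>
  let ?e = "(T - fermat_length A g0 \<omega> a b e) / (b - a)"
  have "0 < ?e" using e by (intro divide_pos_pos) auto
  from link_of_length[OF e(1,2) this] show ?thesis using e by simp
qed

section \<open>The stationary spacetime\<close>


abbreviation V_chart :: "('m, 'e) chart \<Rightarrow> (real \<times> 'm, real \<times> 'e) chart" where
  "V_chart \<kappa> \<equiv> (UNIV \<times> fst \<kappa>, map_prod id (snd \<kappa>))"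

lemma V_atlas_eq: "V_atlas A = V_chart ` A"
proof -
  have "{(UNIV, id)} \<times> A = (\<lambda>\<kappa>. ((UNIV :: real set, id :: real \<Rightarrow> real), \<kappa>)) ` A" by auto
  then show ?thesis
    unfolding V_atlas_def prod_atlas_def real_atlas_def by (simp add: image_image case_prod_unfold)
qed

lemma charts_at_V_atlas: "charts_at (V_atlas A) p = V_chart ` charts_at A (snd p)"
  unfolding charts_at_def V_atlas_eq by (cases p) auto

lemma cinv_V_chart:
  assumes "\<kappa> \<in> A" "y \<in> snd \<kappa> ` fst \<kappa>"
  shows "cinv (V_chart \<kappa>) (t, y) = (t, cinv \<kappa> y)"
proof (rule inv_into_f_eq)
  have "inj_on (snd \<kappa>) (fst \<kappa>)" by (rule inj_on_inverseI[of _ "cinv \<kappa>"]) (rule cinv_chart[OF assms(1)])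
  then show "inj_on (snd (V_chart \<kappa>)) (fst (V_chart \<kappa>))" by (auto simp: inj_on_def)
  show "(t, cinv \<kappa> y) \<in> fst (V_chart \<kappa>)" using cinv_in[OF assms(2)] by simp
  show "snd (V_chart \<kappa>) (t, cinv \<kappa> y) = (t, y)" using chart_cinv[OF assms(2)] by simp
qed

lemma open_V_chart_image: "\<kappa> \<in> A \<Longrightarrow> open V \<Longrightarrow> open ((UNIV :: real set) \<times> snd \<kappa> ` (fst \<kappa> \<inter> V))"
  by (intro open_Times open_chart_image) simp_all

text \<open>\<open>differential\<close> evaluates in a chart chosen by \<open>SOME\<close>. In every
  product chart the two projections are linear up to a change of chart on \<open>M\<close>, so the
  choice does not matter.\<close>

lemma dt_dpi:
  assumes w: "w \<in> tangent_space A x"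
    and v: "\<And>\<kappa>. \<kappa> \<in> charts_at A x \<Longrightarrow> v (V_chart \<kappa>) = (\<tau>, w \<kappa>)"
  shows "dt A (t, x) v = \<tau>" and "dpi A (t, x) v = w"
proof -
  let ?\<kappa> = "SOME \<kappa>. \<kappa> \<in> charts_at (V_atlas A) (t, x)"
  have "\<exists>\<kappa>. \<kappa> \<in> charts_at (V_atlas A) (t, x)"
    using charts_at_nonempty[of x] unfolding charts_at_V_atlas by auto
  then have "?\<kappa> \<in> charts_at (V_atlas A) (t, x)" by (rule someI_ex)
  then obtain \<kappa> where \<kappa>: "\<kappa> \<in> charts_at A x" and some: "?\<kappa> = V_chart \<kappa>"
    unfolding charts_at_V_atlas by auto
  have A: "\<kappa> \<in> A" "x \<in> fst \<kappa>" using charts_atD[OF \<kappa>] by simp_all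
  let ?z = "(t, snd \<kappa> x)"
  have "((id \<circ> fst \<circ> cinv (V_chart \<kappa>)) has_derivative fst) (at ?z)"
  proof (rule has_derivative_transform_within_open)
    show "(fst has_derivative fst) (at ?z)"
      by (rule bounded_linear_imp_has_derivative) (rule bounded_linear_fst)
    show "open ((UNIV :: real set) \<times> snd \<kappa> ` (fst \<kappa> \<inter> UNIV))" using A(1) open_UNIV by (rule open_V_chart_image)
    show "?z \<in> UNIV \<times> snd \<kappa> ` (fst \<kappa> \<inter> UNIV)" using A by simp
    show "fst z = (id \<circ> fst \<circ> cinv (V_chart \<kappa>)) z" if "z \<in> UNIV \<times> snd \<kappa> ` (fst \<kappa> \<inter> UNIV)" for z
      using that cinv_V_chart[OF A(1), of "snd z" "fst z"] by auto
  qed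
  from frechet_derivative_at[OF this]
  have "frechet_derivative (id \<circ> fst \<circ> cinv (V_chart \<kappa>)) (at ?z) = fst" by simp
  then show "dt A (t, x) v = \<tau>"
    unfolding dt_def differential_def some Let_def using v[OF \<kappa>]
    by (simp add: charts_at_def real_atlas_def)
  show "dpi A (t, x) v = w"
  proof
    fix \<mu>
    show "dpi A (t, x) v \<mu> = w \<mu>"
    proof (cases "\<mu> \<in> charts_at A x")
      case \<mu>: True
      have B: "\<mu> \<in> A" "x \<in> fst \<mu>" using charts_atD[OF \<mu>] by simp_all
      have "((snd \<mu> \<circ> snd \<circ> cinv (V_chart \<kappa>)) has_derivative (\<lambda>z. chart_change \<kappa> \<mu> x (snd z))) (at ?z)"
      proof (rule has_derivative_transform_within_open)
        have "(snd has_derivative snd) (at ?z)"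
          by (rule bounded_linear_imp_has_derivative) (rule bounded_linear_snd)
        moreover have "((snd \<mu> \<circ> cinv \<kappa>) has_derivative chart_change \<kappa> \<mu> x) (at (snd ?z))"
          using chart_change_has_derivative[OF \<kappa> \<mu>] by simp
        ultimately show "((\<lambda>z. (snd \<mu> \<circ> cinv \<kappa>) (snd z)) has_derivative
            (\<lambda>z. chart_change \<kappa> \<mu> x (snd z))) (at ?z)"
          by (rule has_derivative_compose)
        show "open ((UNIV :: real set) \<times> snd \<kappa> ` (fst \<kappa> \<inter> UNIV))" using A(1) open_UNIV by (rule open_V_chart_image)
        show "?z \<in> UNIV \<times> snd \<kappa> ` (fst \<kappa> \<inter> UNIV)" using A by simp
        show "(snd \<mu> \<circ> cinv \<kappa>) (snd z) = (snd \<mu> \<circ> snd \<circ> cinv (V_chart \<kappa>)) z"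
          if "z \<in> UNIV \<times> snd \<kappa> ` (fst \<kappa> \<inter> UNIV)" for z
          using that cinv_V_chart[OF A(1), of "snd z" "fst z"] by auto
      qed
      from frechet_derivative_at[OF this]
      have "frechet_derivative (snd \<mu> \<circ> snd \<circ> cinv (V_chart \<kappa>)) (at ?z) = (\<lambda>z. chart_change \<kappa> \<mu> x (snd z))"
        by simp
      then show ?thesis
        unfolding dpi_def differential_def some Let_def
        using v[OF \<kappa>] \<mu> tangent_space_change[OF w \<kappa> \<mu>, symmetric] by simp
    next
      case False
      then show ?thesis
        unfolding dpi_def differential_def using tangent_space_not_chart[OF w False] by simp
    qed
  qed
qed

text \<open>For time component \<open>\<tau>\<close> and spatial part \<open>w\<close>, the two
  conditions read \<open>- \<tau>\<^sup>2 + 2 * \<tau> * \<omega> x w + g0 x w w < 0\<close> and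
  \<open>\<omega> x w < \<tau>\<close>. Completing the square turns them into \<open>sqrt (g0 x w w
  + (\<omega> x w)\<^sup>2) < \<tau> - \<omega> x w\<close>. This is where the Fermat metric comes
  from.\<close>

lemma future_timelike_iff:
  assumes w: "w \<in> tangent_space A x"
    and v: "\<And>\<kappa>. \<kappa> \<in> charts_at A x \<Longrightarrow> v (V_chart \<kappa>) = (\<tau>, w \<kappa>)"
  shows "future_timelike A g0 \<omega> (t, x) v \<longleftrightarrow> F x w < \<tau>"
proof -
  have "del_t A (t, x) (V_chart \<kappa>) = (1, (\<lambda>_. 0) \<kappa>)" if "\<kappa> \<in> charts_at A x" for \<kappa>
  proof -
    have "((snd (V_chart \<kappa>) \<circ> (\<lambda>s. (s, x))) has_vector_derivative (1, 0)) (at t)"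
      unfolding comp_def by (auto intro!: derivative_eq_intros has_vector_derivative_Pair)
    then have "vector_derivative (snd (V_chart \<kappa>) \<circ> (\<lambda>s. (s, x))) (at t) = (1, 0)"
      by (rule vector_derivative_at)
    then show ?thesis using that
      unfolding del_t_def velocity_def charts_at_V_atlas by (simp add: image_iff) blast
  qed
  note e = dt_dpi[where v = "del_t A (t, x)" and t = t, OF zero_tangent this]
    and f = dt_dpi[where v = v and t = t, OF w v]
  let ?g = "g0 x w w" and ?o = "\<omega> x w"
  have "future_timelike A g0 \<omega> (t, x) v \<longleftrightarrow> - \<tau> * \<tau> + ?o * \<tau> + \<tau> * ?o + ?g < 0 \<and> - \<tau> + ?o < 0"
    unfolding future_timelike_def stationary_metric_def e f
    using \<omega>_zero g0_zero(2)[OF w] e f by simp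
  also have "\<dots> \<longleftrightarrow> ?g + ?o\<^sup>2 < (\<tau> - ?o)\<^sup>2 \<and> 0 < \<tau> - ?o"
    by (auto simp: power2_eq_square algebra_simps)
  also have "\<dots> \<longleftrightarrow> sqrt (?g + ?o\<^sup>2) < \<tau> - ?o"
  proof
    assume "?g + ?o\<^sup>2 < (\<tau> - ?o)\<^sup>2 \<and> 0 < \<tau> - ?o"
    then show "sqrt (?g + ?o\<^sup>2) < \<tau> - ?o" by (intro real_less_lsqrt) simp_all
  next
    assume l: "sqrt (?g + ?o\<^sup>2) < \<tau> - ?o"
    have nn: "0 \<le> ?g + ?o\<^sup>2" using g0_nonneg[OF w] by simp
    have pos: "0 < \<tau> - ?o" using l real_sqrt_ge_zero[OF nn] by linarith
    have "(sqrt (?g + ?o\<^sup>2))\<^sup>2 < (\<tau> - ?o)\<^sup>2"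
      using l real_sqrt_ge_zero[OF nn] by (intro power_strict_mono) simp_all
    then show "?g + ?o\<^sup>2 < (\<tau> - ?o)\<^sup>2 \<and> 0 < \<tau> - ?o" using pos nn by simp
  qed
  also have "\<dots> \<longleftrightarrow> F x w < \<tau>" unfolding fermat_metric_def by linarith
  finally show ?thesis .
qed

lemma arc_on_V_atlas:
  assumes c: "arc_on A speed_lt_1 c a b"
  shows "arc_on (V_atlas A) (future_timelike A g0 \<omega>) (\<lambda>s. (t + s, c s)) a b"
  unfolding arc_on_def
proof (intro conjI ballI)
  have ab: "a < b" and sm: "smooth_curve_on A {a..b} c"
    and sp: "\<And>s. s \<in> {a..b} \<Longrightarrow> F (c s) (velocity A c {a..b} s) < 1"
    using c unfolding arc_on_def by blast+
  show "a < b" by (rule ab)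
  let ?\<gamma> = "\<lambda>s. (t + s, c s)"
  show V: "smooth_curve_on (V_atlas A) {a..b} ?\<gamma>"
    unfolding smooth_curve_on_iff
  proof (intro ballI)
    fix s \<kappa>' assume s: "s \<in> {a..b}" and "\<kappa>' \<in> charts_at (V_atlas A) (t + s, c s)"
    then obtain \<kappa> where \<kappa>: "\<kappa> \<in> charts_at A (c s)" "\<kappa>' = V_chart \<kappa>" unfolding charts_at_V_atlas by auto
    obtain \<epsilon> h where e: "\<epsilon> > 0" "smooth_on (ball s \<epsilon>) h"
      "\<forall>r\<in>{a..b} \<inter> ball s \<epsilon>. c r \<in> fst \<kappa> \<and> snd \<kappa> (c r) = h r"
      using sm s \<kappa>(1) by (rule smooth_curve_onE)
    have "Ck_on k (ball s \<epsilon>) (\<lambda>r. (t + 1 * r, h r))" for k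
      by (rule Ck_on_Pair_affine) (use e(2) in \<open>simp_all add: smooth_on_def\<close>)
    then have "smooth_on (ball s \<epsilon>) (\<lambda>r. (t + r, h r))" unfolding smooth_on_def by simp
    then show "\<exists>\<epsilon>>0. \<exists>h. smooth_on (ball s \<epsilon>) h \<and>
        (\<forall>r\<in>{a..b} \<inter> ball s \<epsilon>. ?\<gamma> r \<in> fst \<kappa>' \<and> snd \<kappa>' (?\<gamma> r) = h r)"
      using e(1,3) unfolding \<kappa>(2) by (intro exI[of _ \<epsilon>] conjI exI[of _ "\<lambda>r. (t + r, h r)"]) auto
  qed
  fix s assume s: "s \<in> {a..b}"
  have "velocity (V_atlas A) ?\<gamma> {a..b} s (V_chart \<kappa>) = (1, velocity A c {a..b} s \<kappa>)"
    if \<kappa>: "\<kappa> \<in> charts_at A (c s)" for \<kappa>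
  proof -
    have "((\<lambda>s. t + s) has_vector_derivative 1) (at s within {a..b})"
      by (auto intro!: derivative_eq_intros simp: has_vector_derivative_def)
    from has_vector_derivative_Pair[OF this has_vector_derivative_velocity[OF ab sm s \<kappa>]]
    have "((snd (V_chart \<kappa>) \<circ> ?\<gamma>) has_vector_derivative (1, velocity A c {a..b} s \<kappa>)) (at s within {a..b})"
      by (simp add: comp_def)
    from vector_derivative_within_closed_interval[OF ab s this] show ?thesis
      using \<kappa> unfolding velocity_def[of "V_atlas A"] charts_at_V_atlas by auto
  qed
  with velocity_tangent[OF ab sm s]
  have "future_timelike A g0 \<omega> (t + s, c s) (velocity (V_atlas A) ?\<gamma> {a..b} s) \<longleftrightarrow>
      F (c s) (velocity A c {a..b} s) < 1"
    by (rule future_timelike_iff)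
  then show "future_timelike A g0 \<omega> (?\<gamma> s) (velocity (V_atlas A) ?\<gamma> {a..b} s)" using sp[OF s] by simp
qed

text \<open>A timelike curve need not be parametrized by time, so the spatial speed is compared with
  the derivative of the time component instead of with one.\<close>

lemma arc_on_V_atlas_D:
  assumes \<gamma>: "arc_on (V_atlas A) (future_timelike A g0 \<omega>) \<gamma> a b"
  shows "smooth_curve_on A {a..b} (\<lambda>s. snd (\<gamma> s))"
    and "\<And>s. s \<in> {a..b} \<Longrightarrow> \<exists>\<tau>. ((\<lambda>s. fst (\<gamma> s)) has_real_derivative \<tau>) (at s within {a..b}) \<and>
      F (snd (\<gamma> s)) (velocity A (\<lambda>s. snd (\<gamma> s)) {a..b} s) < \<tau>"
proof -
  have ab: "a < b" and V: "smooth_curve_on (V_atlas A) {a..b} \<gamma>"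
    and ft: "\<And>s. s \<in> {a..b} \<Longrightarrow> future_timelike A g0 \<omega> (\<gamma> s) (velocity (V_atlas A) \<gamma> {a..b} s)"
    using \<gamma> unfolding arc_on_def by blast+
  show sm: "smooth_curve_on A {a..b} (\<lambda>s. snd (\<gamma> s))"
    unfolding smooth_curve_on_iff
  proof (intro ballI)
    fix s \<kappa> assume s: "s \<in> {a..b}" and \<kappa>: "\<kappa> \<in> charts_at A (snd (\<gamma> s))"
    have "V_chart \<kappa> \<in> charts_at (V_atlas A) (\<gamma> s)" unfolding charts_at_V_atlas using \<kappa> by (rule imageI)
    with V s obtain \<epsilon> h where e: "\<epsilon> > 0" "smooth_on (ball s \<epsilon>) h"
      "\<forall>r\<in>{a..b} \<inter> ball s \<epsilon>. \<gamma> r \<in> fst (V_chart \<kappa>) \<and> snd (V_chart \<kappa>) (\<gamma> r) = h r"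
      by (rule smooth_curve_onE)
    have "Ck_on k (ball s \<epsilon>) (\<lambda>r. snd (h r))" for k
      by (rule Ck_on_linear_compose[OF open_ball bounded_linear_snd]) (use e(2) in \<open>simp add: smooth_on_def\<close>)
    then have "smooth_on (ball s \<epsilon>) (\<lambda>r. snd (h r))" unfolding smooth_on_def by blast
    moreover have "snd (\<gamma> r) \<in> fst \<kappa> \<and> snd \<kappa> (snd (\<gamma> r)) = snd (h r)" if "r \<in> {a..b} \<inter> ball s \<epsilon>" for r
      using e(3)[rule_format, OF that] by (cases "\<gamma> r"; cases "h r") auto
    ultimately show "\<exists>\<epsilon>>0. \<exists>h. smooth_on (ball s \<epsilon>) h \<and>
        (\<forall>r\<in>{a..b} \<inter> ball s \<epsilon>. snd (\<gamma> r) \<in> fst \<kappa> \<and> snd \<kappa> (snd (\<gamma> r)) = h r)"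
      using e(1) by blast
  qed
  fix s assume s: "s \<in> {a..b}"
  let ?v = "velocity (V_atlas A) \<gamma> {a..b} s" and ?w = "velocity A (\<lambda>s. snd (\<gamma> s)) {a..b} s"
  have pair: "((\<lambda>s. fst (\<gamma> s)) has_vector_derivative fst (?v (V_chart \<kappa>))) (at s within {a..b}) \<and>
      snd (?v (V_chart \<kappa>)) = ?w \<kappa>" if \<kappa>: "\<kappa> \<in> charts_at A (snd (\<gamma> s))" for \<kappa>
  proof -
    have "V_chart \<kappa> \<in> charts_at (V_atlas A) (\<gamma> s)" unfolding charts_at_V_atlas using \<kappa> by (rule imageI)
    from has_vector_derivative_velocity[OF ab V s this]
    have hv: "((\<lambda>s. (fst (\<gamma> s), snd \<kappa> (snd (\<gamma> s)))) has_vector_derivative ?v (V_chart \<kappa>)) (at s within {a..b})"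
      by (simp add: comp_def map_prod_def case_prod_unfold)
    have 1: "((\<lambda>s. fst (\<gamma> s)) has_vector_derivative fst (?v (V_chart \<kappa>))) (at s within {a..b})"
      using bounded_linear.has_vector_derivative[OF bounded_linear_fst hv] by simp
    have "((snd \<kappa> \<circ> (\<lambda>s. snd (\<gamma> s))) has_vector_derivative snd (?v (V_chart \<kappa>))) (at s within {a..b})"
      using bounded_linear.has_vector_derivative[OF bounded_linear_snd hv] by (simp add: comp_def)
    from vector_derivative_within_closed_interval[OF ab s this] 1 show ?thesis
      using \<kappa> by (simp add: velocity_def)
  qed
  obtain \<kappa>0 where \<kappa>0: "\<kappa>0 \<in> charts_at A (snd (\<gamma> s))" using charts_at_nonempty by blast
  define \<tau> where "\<tau> = fst (?v (V_chart \<kappa>0))"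
  have d: "((\<lambda>s. fst (\<gamma> s)) has_vector_derivative \<tau>) (at s within {a..b})"
    using pair[OF \<kappa>0] unfolding \<tau>_def by simp
  have "?v (V_chart \<kappa>) = (\<tau>, ?w \<kappa>)" if \<kappa>: "\<kappa> \<in> charts_at A (snd (\<gamma> s))" for \<kappa>
  proof (rule prod_eqI)
    have "fst (?v (V_chart \<kappa>)) = \<tau>"
      using vector_derivative_within_closed_interval[OF ab s conjunct1[OF pair[OF \<kappa>]]]
        vector_derivative_within_closed_interval[OF ab s d] by simp
    then show "fst (?v (V_chart \<kappa>)) = fst (\<tau>, ?w \<kappa>)" by simp
    show "snd (?v (V_chart \<kappa>)) = snd (\<tau>, ?w \<kappa>)" using pair[OF \<kappa>] by simp
  qed
  with velocity_tangent[OF ab sm s]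
  have "future_timelike A g0 \<omega> (fst (\<gamma> s), snd (\<gamma> s)) ?v \<longleftrightarrow> F (snd (\<gamma> s)) ?w < \<tau>"
    by (rule future_timelike_iff)
  then have "F (snd (\<gamma> s)) ?w < \<tau>" using ft[OF s] by simp
  then show "\<exists>\<tau>. ((\<lambda>s. fst (\<gamma> s)) has_real_derivative \<tau>) (at s within {a..b}) \<and> F (snd (\<gamma> s)) ?w < \<tau>"
    using d unfolding has_real_derivative_iff_has_vector_derivative by blast
qed

lemma link_imp_chronological:
  assumes "link x y T"
  shows "chronological A g0 \<omega> (t, x) (t + T, y)"
proof -
  obtain c S where c: "c 0 = x" "c T = y" "arcs_on A speed_lt_1 c {0..T} S" "0 < T"
    using assms unfolding link_def by blast
  have "arcs_on (V_atlas A) (future_timelike A g0 \<omega>) (\<lambda>s. (t + s, c s)) {0..T} S"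
    unfolding arcs_on_def
  proof (intro conjI allI impI)
    show "finite (S \<inter> {a..b})" if "{a..b} \<subseteq> {0..T}" for a b using c(3) that unfolding arcs_on_def by simp
    show "arc_on (V_atlas A) (future_timelike A g0 \<omega>) (\<lambda>s. (t + s, c s)) a b"
      if "a < b \<and> {a..b} \<subseteq> {0..T} \<and> S \<inter> {a<..<b} = {}" for a b
      by (rule arc_on_V_atlas) (use c(3) that in \<open>simp add: arcs_on_def\<close>)
  qed
  from arcs_on_imp_piecewise[OF this] show ?thesis
    unfolding chronological_def using c
    by (intro exI[of _ 0] exI[of _ T] exI[of _ "\<lambda>s. (t + s, c s)"]) simp
qed

lemma chronological_imp_less:
  assumes "chronological A g0 \<omega> (t, x) (t', x')"
  shows "t + d x x' < t'"
proof -
  obtain a b \<gamma> where \<gamma>: "a < b" "\<gamma> a = (t, x)" "\<gamma> b = (t', x')"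
    "piecewise_smooth_on (V_atlas A) {a..b} \<gamma>"
    "velocities_satisfy (V_atlas A) {a..b} \<gamma> (future_timelike A g0 \<omega>)"
    using assms unfolding chronological_def by blast
  obtain S where S: "arcs_on (V_atlas A) (future_timelike A g0 \<omega>) \<gamma> {a..b} S"
    using piecewise_imp_arcs_on[OF \<gamma>(4,5)] ..
  then have fin: "finite (S \<inter> {a..b})"
    and arc: "\<And>u v. u < v \<Longrightarrow> {u..v} \<subseteq> {a..b} \<Longrightarrow> S \<inter> {u<..<v} = {} \<Longrightarrow>
      arc_on (V_atlas A) (future_timelike A g0 \<omega>) \<gamma> u v"
    unfolding arcs_on_def by simp_all
  let ?c = "\<lambda>s. snd (\<gamma> s)" and ?\<tau> = "\<lambda>s. fst (\<gamma> s)"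
  let ?f = "\<lambda>s. F (?c s) (velocity A ?c {a..b} s)"
  have pw: "piecewise_smooth_on A {a..b} ?c"
    unfolding piecewise_smooth_on_def
  proof (intro exI[of _ S] conjI allI impI)
    show "finite (S \<inter> {u..v})" if "{u..v} \<subseteq> {a..b}" for u v using S that unfolding arcs_on_def by simp
    show "smooth_curve_on A {u..v} ?c" if "u < v \<and> {u..v} \<subseteq> {a..b} \<and> S \<inter> {u<..<v} = {}" for u v
      by (rule arc_on_V_atlas_D(1)[OF arc]) (use that in simp_all)
  qed
  have "?f integrable_on {a..b} \<and> integral {a..b} ?f < ?\<tau> b - ?\<tau> a"
  proof (rule piecewise_induct[OF \<gamma>(1) fin, where
        P = "\<lambda>u v. ?f integrable_on {u..v} \<and> integral {u..v} ?f < ?\<tau> v - ?\<tau> u"])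
    fix u v assume uv: "u < v" "{u..v} \<subseteq> {a..b}" "S \<inter> {u<..<v} = {}"
    note D = arc_on_V_atlas_D[OF arc[OF uv]]
    let ?h = "\<lambda>s. F (?c s) (velocity A ?c {u..v} s)"
    note i = fermat_length_piece[OF uv(1,2) D(1)]
    have cont: "continuous_on {u..v} ?h" by (rule continuous_on_F_velocity[OF uv(1) D(1)])
    obtain \<tau>' where \<tau>': "\<And>s. s \<in> {u..v} \<Longrightarrow> (?\<tau> has_real_derivative \<tau>' s) (at s within {u..v})"
      "\<And>s. s \<in> {u..v} \<Longrightarrow> ?h s < \<tau>' s" using D(2) by metis
    \<comment> \<open>The elapsed time minus the length covered so far; its derivative
      \<open>\<tau>' s - ?h s\<close> is positive.\<close>
    let ?k = "\<lambda>s. ?\<tau> s - integral {u..s} ?h"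
    have k: "(?k has_real_derivative (\<tau>' s - ?h s)) (at s within {u..v})" if "s \<in> {u..v}" for s
      by (intro DERIV_diff \<tau>'(1)[OF that] integral_has_real_derivative[OF cont that])
    have "?k u < ?k v"
    proof (rule DERIV_pos_imp_increasing_open[OF uv(1)])
      show "continuous_on {u..v} ?k"
        unfolding continuous_on_eq_continuous_within using k DERIV_continuous by blast
      fix s assume s: "u < s" "s < v"
      have "(?k has_real_derivative (\<tau>' s - ?h s)) (at s)"
        using k[of s] s by (simp add: at_within_Icc_at)
      then show "\<exists>y. (?k has_real_derivative y) (at s) \<and> 0 < y"
        using \<tau>'(2)[of s] s by (intro exI[of _ "\<tau>' s - ?h s"]) simp
    qed
    then have "integral {u..v} ?h < ?\<tau> v - ?\<tau> u" by simp
    then show "?f integrable_on {u..v} \<and> integral {u..v} ?f < ?\<tau> v - ?\<tau> u"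
      using integral_unique[OF i] has_integral_integrable[OF i] by simp
  next
    fix u v w assume uvw: "u < v" "v < w"
      and 1: "?f integrable_on {u..v} \<and> integral {u..v} ?f < ?\<tau> v - ?\<tau> u"
      and 2: "?f integrable_on {v..w} \<and> integral {v..w} ?f < ?\<tau> w - ?\<tau> v"
    have i: "?f integrable_on {u..w}"
      using 1 2 uvw by (intro Henstock_Kurzweil_Integration.integrable_combine[of u v w]) auto
    moreover have "integral {u..v} ?f + integral {v..w} ?f = integral {u..w} ?f"
      using uvw i by (intro Henstock_Kurzweil_Integration.integral_combine) auto
    ultimately show "?f integrable_on {u..w} \<and> integral {u..w} ?f < ?\<tau> w - ?\<tau> u" using 1 2 by linarith
  qed
  then have "fermat_length A g0 \<omega> a b ?c < t' - t" unfolding fermat_length_def using \<gamma> by simp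
  then show ?thesis using fermat_dist_le[OF \<gamma>(1) pw] \<gamma> by simp
qed

lemma link_imp_fermat_dist_less: "link x y T \<Longrightarrow> d x y < T"
  using chronological_imp_less[OF link_imp_chronological[of x y T 0]] by simp

section \<open>The Fermat distance\<close>


lemma smooth_segment:
  assumes \<kappa>: "\<kappa> \<in> A" and seg: "\<And>s. s \<in> {u..v} \<Longrightarrow> y + s *\<^sub>R a \<in> snd \<kappa> ` fst \<kappa>"
  shows "smooth_curve_on A {u..v} (\<lambda>s. cinv \<kappa> (y + s *\<^sub>R a))"
  unfolding smooth_curve_on_iff
proof (intro ballI)
  let ?c = "\<lambda>s. cinv \<kappa> (y + s *\<^sub>R a)"
  fix s \<mu> assume s: "s \<in> {u..v}" and \<mu>: "\<mu> \<in> charts_at A (?c s)"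
  have \<mu>A: "\<mu> \<in> A" "?c s \<in> fst \<mu>" using charts_atD[OF \<mu>] by simp_all
  let ?S = "snd \<kappa> ` (fst \<kappa> \<inter> fst \<mu>)"
  have S: "open ?S" using \<kappa> chart_homeomorphism(1)[OF \<mu>A(1)] by (rule open_chart_image)
  have "continuous_on UNIV (\<lambda>r. y + r *\<^sub>R a)" by (intro continuous_intros)
  from open_vimage[OF S this] have op: "open {r. y + r *\<^sub>R a \<in> ?S}" by (simp add: vimage_def)
  have "snd \<kappa> (?c s) = y + s *\<^sub>R a" "?c s \<in> fst \<kappa>"
    using chart_cinv[OF seg[OF s]] cinv_in[OF seg[OF s]] by simp_all
  then have "y + s *\<^sub>R a \<in> ?S" using \<mu>A(2) by (metis IntI imageI)
  then obtain \<epsilon> where \<epsilon>: "\<epsilon> > 0" "ball s \<epsilon> \<subseteq> {r. y + r *\<^sub>R a \<in> ?S}"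
    using op open_contains_ball by blast
  have "Ck_on k ?S (snd \<mu> \<circ> cinv \<kappa>)" for k
    using transition_smooth[OF \<kappa> \<mu>A(1)] unfolding smooth_on_def by blast
  from Ck_on_affine_compose[OF S bounded_linear_scaleR_left this]
  have "Ck_on k {r. y + r *\<^sub>R a \<in> ?S} (\<lambda>r. (snd \<mu> \<circ> cinv \<kappa>) (y + r *\<^sub>R a))" for k .
  from Ck_on_subset[OF this \<epsilon>(2)]
  have "smooth_on (ball s \<epsilon>) (\<lambda>r. (snd \<mu> \<circ> cinv \<kappa>) (y + r *\<^sub>R a))" unfolding smooth_on_def by blast
  moreover have "?c r \<in> fst \<mu> \<and> snd \<mu> (?c r) = (snd \<mu> \<circ> cinv \<kappa>) (y + r *\<^sub>R a)" if "r \<in> {u..v} \<inter> ball s \<epsilon>" for r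
  proof -
    have "y + r *\<^sub>R a \<in> ?S" using that \<epsilon>(2) by blast
    then obtain q where "q \<in> fst \<kappa>" "q \<in> fst \<mu>" "y + r *\<^sub>R a = snd \<kappa> q" by blast
    then show ?thesis using \<kappa> by (simp add: cinv_chart)
  qed
  ultimately show "\<exists>\<epsilon>>0. \<exists>h. smooth_on (ball s \<epsilon>) h \<and>
      (\<forall>r\<in>{u..v} \<inter> ball s \<epsilon>. ?c r \<in> fst \<mu> \<and> snd \<mu> (?c r) = h r)"
    using \<epsilon>(1) by blast
qed

text \<open>The straight segment in the chart has constant coordinate velocity
  \<open>y2 - y1\<close>, hence Fermat speed at most \<open>M * norm (y2 - y1)\<close>.\<close>

lemma link_segment:
  assumes \<kappa>: "\<kappa> \<in> A" and C: "convex C" "C \<subseteq> snd \<kappa> ` fst \<kappa>" and y: "y1 \<in> C" "y2 \<in> C"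
    and M: "\<And>y a. y \<in> C \<Longrightarrow> fc \<kappa> y a \<le> M * norm a" and T: "M * norm (y2 - y1) < T"
  shows "link (cinv \<kappa> y1) (cinv \<kappa> y2) T"
proof -
  let ?c = "\<lambda>s. cinv \<kappa> (y1 + s *\<^sub>R (y2 - y1))"
  have inC: "y1 + s *\<^sub>R (y2 - y1) \<in> C" if "s \<in> {0..1}" for s
  proof -
    have "(1 - s) *\<^sub>R y1 + s *\<^sub>R y2 \<in> C" using C(1) y that by (simp add: convexD_alt)
    then show ?thesis by (simp add: algebra_simps)
  qed
  then have seg: "y1 + s *\<^sub>R (y2 - y1) \<in> snd \<kappa> ` fst \<kappa>" if "s \<in> {0..1}" for s using C(2) that by blast
  have sm: "smooth_curve_on A {0..1} ?c" using \<kappa> seg by (rule smooth_segment)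
  have "link (?c 0) (?c 1) T"
  proof (rule link_of_speed_bound)
    show "smooth_curve_on A {0..1} ?c" by (rule sm)
    fix s :: real assume s: "s \<in> {0..1}"
    have ch: "snd \<kappa> (?c r) = y1 + r *\<^sub>R (y2 - y1)" if "r \<in> {0..1}" for r
      using chart_cinv[OF seg[OF that]] .
    have "((\<lambda>r. y1 + r *\<^sub>R (y2 - y1)) has_vector_derivative (y2 - y1)) (at s within {0..1})"
      unfolding has_vector_derivative_def by (auto intro!: derivative_eq_intros)
    then have "((snd \<kappa> \<circ> ?c) has_vector_derivative (y2 - y1)) (at s within {0..1})"
      by (rule has_vector_derivative_transform[OF s, rotated]) (use ch in simp)
    moreover have "\<kappa> \<in> charts_at A (?c s)" using \<kappa> seg[OF s] by (rule cinv_charts_at)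
    ultimately have "F (?c s) (velocity A ?c {0..1} s) = fc \<kappa> (snd \<kappa> (?c s)) (y2 - y1)"
      using sm s by (intro F_velocity_chart) simp_all
    also have "\<dots> \<le> M * norm (y2 - y1)" unfolding ch[OF s] by (rule M[OF inC[OF s]])
    also have "\<dots> < T" by (rule T)
    finally show "F (?c s) (velocity A ?c {0..1} s) < T" .
  qed simp_all
  then show ?thesis by simp
qed

lemma chart_cball:
  obtains \<kappa> r where "\<kappa> \<in> charts_at A x" "0 < r" "cball (snd \<kappa> x) r \<subseteq> snd \<kappa> ` fst \<kappa>"
proof -
  obtain \<kappa> where \<kappa>: "\<kappa> \<in> charts_at A x" using charts_at_nonempty by blast
  have "open (snd \<kappa> ` fst \<kappa>)" "snd \<kappa> x \<in> snd \<kappa> ` fst \<kappa>"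
    using charts_atD[OF \<kappa>] chart_homeomorphism(2) by blast+
  then show ?thesis using open_contains_cball that[OF \<kappa>] by blast
qed

lemma link_local:
  assumes T: "0 < T"
  shows "\<exists>N. open N \<and> x \<in> N \<and> (\<forall>y\<in>N. \<forall>z\<in>N. link y z T)"
proof -
  obtain \<kappa> r where \<kappa>: "\<kappa> \<in> charts_at A x" and r: "0 < r" "cball (snd \<kappa> x) r \<subseteq> snd \<kappa> ` fst \<kappa>"
    by (rule chart_cball)
  have A: "\<kappa> \<in> A" "x \<in> fst \<kappa>" using charts_atD[OF \<kappa>] by simp_all
  obtain m M where "0 < m" and M: "0 < M"
    "\<forall>y\<in>cball (snd \<kappa> x) r. \<forall>a. m * norm a \<le> fc \<kappa> y a \<and> fc \<kappa> y a \<le> M * norm a"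
    using A(1) compact_cball r(2) by (rule fc_bounds)
  \<comment> \<open>Two points of the ball of radius \<open>\<rho>\<close> are less than
    \<open>2 * \<rho>\<close> apart, and linking them takes any time above \<open>M\<close> times
    their distance.\<close>
  define \<rho> where "\<rho> = min r (T / (2 * M))"
  have \<rho>: "0 < \<rho>" "\<rho> \<le> r" "2 * \<rho> * M \<le> T"
    using r(1) T M(1) by (auto simp: \<rho>_def min_def field_simps)
  let ?N = "snd \<kappa> -` ball (snd \<kappa> x) \<rho> \<inter> fst \<kappa>"
  have "open ?N" using A(1) open_ball by (rule open_chart_preimage)
  moreover have "x \<in> ?N" using A(2) \<rho>(1) by simp
  moreover have "link y z T" if yz: "y \<in> ?N" "z \<in> ?N" for y z
  proof -
    have in_ball: "snd \<kappa> y \<in> ball (snd \<kappa> x) \<rho>" "snd \<kappa> z \<in> ball (snd \<kappa> x) \<rho>" using yz by simp_all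
    have "norm (snd \<kappa> z - snd \<kappa> y) < 2 * \<rho>"
      using in_ball dist_triangle[of "snd \<kappa> z" "snd \<kappa> y" "snd \<kappa> x"] by (simp add: dist_norm norm_minus_commute)
    then have "M * norm (snd \<kappa> z - snd \<kappa> y) < M * (2 * \<rho>)" using M(1) by simp
    then have lt: "M * norm (snd \<kappa> z - snd \<kappa> y) < T" using \<rho>(3) by (simp add: mult.commute)
    have sub: "ball (snd \<kappa> x) \<rho> \<subseteq> cball (snd \<kappa> x) r" using \<rho>(2) by auto
    have "link (cinv \<kappa> (snd \<kappa> y)) (cinv \<kappa> (snd \<kappa> z)) T"
      by (rule link_segment[OF A(1) convex_ball _ in_ball _ lt]) (use sub r(2) M(2) in blast)+
    then show ?thesis using yz A(1) by (simp add: cinv_chart)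
  qed
  ultimately show ?thesis by blast
qed

text \<open>Since \<open>F\<close> is not reversible, links in both directions are combined into an
  equivalence relation. Its classes are open by \<open>link_local\<close>, so the connected space
  \<open>M\<close> is a single class.\<close>

lemma link_exists: "\<exists>T. link x y T"
proof -
  have "(\<exists>S. link x y S) \<and> (\<exists>S. link y x S)"
  proof (rule connected_equivalence_relation[OF conn, of x y])
    fix x y z assume "(\<exists>S. link x y S) \<and> (\<exists>S. link y x S)" "(\<exists>S. link y z S) \<and> (\<exists>S. link z y S)"
    then show "(\<exists>S. link x z S) \<and> (\<exists>S. link z x S)" using link_trans by meson
  next
    fix x
    obtain N where N: "open N" "x \<in> N" "\<forall>y\<in>N. \<forall>z\<in>N. link y z 1" using link_local[of 1 x] by auto
    then have "\<forall>y\<in>N. (\<exists>S. link x y S) \<and> (\<exists>S. link y x S)" by blast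
    moreover have "openin (top_of_set UNIV) N" using N(1) by simp
    ultimately show "\<exists>N. openin (top_of_set UNIV) N \<and> x \<in> N \<and>
        (\<forall>y\<in>N. (\<exists>S. link x y S) \<and> (\<exists>S. link y x S))" using N(2) by blast
  qed auto
  then show ?thesis by blast
qed

text \<open>The bridge from curves to the distance: from here on, \<open>d\<close> alone carries the
  geometry. One direction passes through the spacetime, where the graph of a link is
  timelike.\<close>

lemma fermat_dist_less_iff: "d x y < T \<longleftrightarrow> link x y T"
  using link_exists link_of_fermat_dist_less link_imp_fermat_dist_less by blast

lemma fermat_dist_nonneg: "0 \<le> d x y"
proof (rule ccontr)
  assume "\<not> 0 \<le> d x y"
  then have "link x y 0" unfolding fermat_dist_less_iff[symmetric] by simp
  then show False unfolding link_def by simp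
qed

lemma fermat_dist_triangle: "d x z \<le> d x y + d y z"
proof (rule field_le_epsilon)
  fix e :: real assume "0 < e"
  then have "link x y (d x y + e / 2)" "link y z (d y z + e / 2)"
    unfolding fermat_dist_less_iff[symmetric] by simp_all
  from link_trans[OF this] have "d x z < d x y + e / 2 + (d y z + e / 2)"
    unfolding fermat_dist_less_iff .
  then show "d x z \<le> d x y + d y z + e" by simp
qed

lemma fermat_dist_local:
  assumes "0 < e"
  shows "\<exists>N. open N \<and> x \<in> N \<and> (\<forall>y\<in>N. d x y < e \<and> d y x < e)"
  using link_local[OF assms, of x] unfolding fermat_dist_less_iff by blast

lemma fermat_dist_self: "d x x = 0"
proof (rule antisym)
  show "d x x \<le> 0"
  proof (rule field_le_epsilon)
    fix e :: real assume "0 < e"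
    from fermat_dist_local[OF this, of x] obtain N where "x \<in> N" "\<forall>y\<in>N. d x y < e \<and> d y x < e" by blast
    then show "d x x \<le> 0 + e" by auto
  qed
qed (rule fermat_dist_nonneg)

lemma fermat_chronological_iff: "chronological A g0 \<omega> (t, x) (t', x') \<longleftrightarrow> t + d x x' < t'"
proof
  assume "t + d x x' < t'"
  then have "link x x' (t' - t)" unfolding fermat_dist_less_iff[symmetric] by simp
  from link_imp_chronological[OF this, of t] show "chronological A g0 \<omega> (t, x) (t', x')" by simp
qed (rule chronological_imp_less)

lemma fermat_C_plus_less:
  assumes c: "C_plus A g0 \<omega> \<alpha> \<Omega> c" and s: "\<alpha> \<le> s" "s < s'" "ereal s' < \<Omega>"
  shows "d (c s) (c s') < s' - s"
proof -
  let ?I = "{s. \<alpha> \<le> s \<and> ereal s < \<Omega>}"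
  obtain S where S: "arcs_on A speed_lt_1 c ?I S"
    using c piecewise_imp_arcs_on unfolding C_plus_def by blast
  have "{s..s'} \<subseteq> ?I"
  proof
    fix r assume "r \<in> {s..s'}"
    then have "\<alpha> \<le> r" and le: "ereal r \<le> ereal s'" using s by simp_all
    moreover from le s(3) have "ereal r < \<Omega>" by (rule le_less_trans)
    ultimately show "r \<in> ?I" by simp
  qed
  from link_of_arcs[OF S s(2) this] show ?thesis unfolding fermat_dist_less_iff .
qed

lemma fermat_C_plus_chain:
  assumes "\<And>n. T n + d (X n) (X (Suc n)) < T (Suc n)"
  shows "\<exists>c. C_plus A g0 \<omega> (T 0) (SUP n. ereal (T n)) c \<and> (\<forall>n. c (T n) = X n)"
proof -
  have l: "link (X n) (X (Suc n)) (T (Suc n) - T n)" for n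
    unfolding fermat_dist_less_iff[symmetric] using assms[of n] by simp
  obtain c S where c: "arcs_on A speed_lt_1 c {s. T 0 \<le> s \<and> (\<exists>n. s < T n)} S" "\<And>n. c (T n) = X n"
    using link_chain[of X T, OF l] by blast
  have I: "{s. T 0 \<le> s \<and> (\<exists>n. s < T n)} = {s. T 0 \<le> s \<and> ereal s < (SUP n. ereal (T n))}"
    by (simp add: less_SUP_iff)
  have "ereal (T 0) < ereal (T 1)" using l[of 0] unfolding link_def by simp
  also have "\<dots> \<le> (SUP n. ereal (T n))" by (rule SUP_upper) simp
  finally have "C_plus A g0 \<omega> (T 0) (SUP n. ereal (T n)) c"
    unfolding C_plus_def using arcs_on_imp_piecewise[OF c(1)] unfolding I by simp
  then show ?thesis using c(2) by blast
qed

text \<open>This bounds the Fermat distance from below and makes curves leaving a coordinate ball cross a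
  smaller coordinate sphere, by the intermediate value theorem.\<close>

lemma radial_Lipschitz:
  assumes \<kappa>: "\<kappa> \<in> charts_at A x" and r: "0 < r" "r < R" "cball (snd \<kappa> x) R \<subseteq> snd \<kappa> ` fst \<kappa>"
    and m: "0 < m" "\<And>y a. y \<in> cball (snd \<kappa> x) R \<Longrightarrow> m * norm a \<le> fc \<kappa> y a"
    and f: "f = (\<lambda>z. if z \<in> fst \<kappa> then min (dist (snd \<kappa> z) (snd \<kappa> x)) r else r)"
    and arcs: "arcs_on A speed_lt_1 c {a..b} S" and ab: "a < b"
  shows "\<bar>f (c b) - f (c a)\<bar> \<le> (b - a) / m"
proof -
  have \<kappa>A: "\<kappa> \<in> A" "x \<in> fst \<kappa>" using charts_atD[OF \<kappa>] by simp_all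
  have fin: "finite (S \<inter> {a..b})" using arcs unfolding arcs_on_def by blast
  have tri: "\<bar>f (c w) - f (c u)\<bar> \<le> (w - u) / m"
    if "\<bar>f (c v) - f (c u)\<bar> \<le> (v - u) / m" "\<bar>f (c w) - f (c v)\<bar> \<le> (w - v) / m" for u v w
  proof -
    have "(w - u) / m = (v - u) / m + (w - v) / m" by (simp add: diff_divide_distrib)
    then show ?thesis using that by linarith
  qed
  show ?thesis
  proof (rule piecewise_induct[OF ab fin, where P = "\<lambda>u v. \<bar>f (c v) - f (c u)\<bar> \<le> (v - u) / m"])
    show "\<bar>f (c w) - f (c u)\<bar> \<le> (w - u) / m"
      if "\<bar>f (c v) - f (c u)\<bar> \<le> (v - u) / m" "\<bar>f (c w) - f (c v)\<bar> \<le> (w - v) / m" for u v w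
      using that by (rule tri)
    fix u0 v0 assume uv0: "u0 < v0" "{u0..v0} \<subseteq> {a..b}" "S \<inter> {u0<..<v0} = {}"
    then have arc: "arc_on A speed_lt_1 c u0 v0" using arcs unfolding arcs_on_def by blast
    then have c: "smooth_curve_on A {u0..v0} c"
      and sp: "\<And>s. s \<in> {u0..v0} \<Longrightarrow> F (c s) (velocity A c {u0..v0} s) < 1"
      unfolding arc_on_def by blast+
    let ?P = "\<lambda>u v. u0 \<le> u \<and> v \<le> v0 \<longrightarrow> \<bar>f (c v) - f (c u)\<bar> \<le> (v - u) / m"
    have "u0 \<le> v0" using uv0(1) by simp
    then have "?P u0 v0"
    proof (induction rule: Bolzano[where P = ?P])
      case (trans u v w)
      show ?case
      proof
        assume "u0 \<le> u \<and> w \<le> v0"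
        then show "\<bar>f (c w) - f (c u)\<bar> \<le> (w - u) / m" using trans by (intro tri[of v u w]) auto
      qed
    next
      case (local s)
      then have s: "s \<in> {u0..v0}" by simp
      obtain \<mu> where \<mu>: "\<mu> \<in> charts_at A (c s)" using charts_at_nonempty by blast
      have cont: "\<exists>\<delta>>0. \<forall>q\<in>{u0..v0}. dist q s < \<delta> \<longrightarrow> c q \<in> W" if W: "open W" "c s \<in> W" for W
      proof -
        have \<mu>A: "\<mu> \<in> A" "c s \<in> fst \<mu>" using charts_atD[OF \<mu>] by simp_all
        obtain \<epsilon> w where \<epsilon>: "\<epsilon> > 0"
          and w: "\<forall>q\<in>{u0..v0} \<inter> ball s \<epsilon>. c q \<in> fst \<mu> \<and> ((snd \<mu> \<circ> c) has_vector_derivative w q) (at q within {u0..v0})"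
          using smooth_curve_chart[OF c s \<mu>] by blast
        have "continuous (at s within {u0..v0}) (snd \<mu> \<circ> c)"
          using w s \<epsilon> by (intro has_vector_derivative_continuous[of _ "w s"]) simp
        moreover have "open (snd \<mu> ` (fst \<mu> \<inter> W))" using \<mu>A(1) W(1) by (rule open_chart_image)
        moreover have "(snd \<mu> \<circ> c) s \<in> snd \<mu> ` (fst \<mu> \<inter> W)" using \<mu>A W by simp
        ultimately have "\<forall>\<^sub>F q in at s within {u0..v0}. (snd \<mu> \<circ> c) q \<in> snd \<mu> ` (fst \<mu> \<inter> W)"
          unfolding continuous_within by (metis topological_tendstoD)
        then obtain \<delta> where \<delta>: "\<delta> > 0"
          "\<forall>q\<in>{u0..v0}. q \<noteq> s \<and> dist q s < \<delta> \<longrightarrow> (snd \<mu> \<circ> c) q \<in> snd \<mu> ` (fst \<mu> \<inter> W)"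
          unfolding eventually_at by blast
        have "c q \<in> W" if q: "q \<in> {u0..v0}" "dist q s < min \<delta> \<epsilon>" for q
        proof (cases "q = s")
          case False
          then have "snd \<mu> (c q) \<in> snd \<mu> ` (fst \<mu> \<inter> W)" using \<delta>(2) q by simp
          then obtain p where p: "p \<in> fst \<mu>" "p \<in> W" "snd \<mu> (c q) = snd \<mu> p" by blast
          have "c q \<in> fst \<mu>" using w q by (simp add: dist_commute)
          then have "c q = p" using p(1,3) cinv_chart[OF \<mu>A(1)] by metis
          then show ?thesis using p(2) by simp
        qed (use W in simp)
        then show ?thesis using \<delta>(1) \<epsilon> by (intro exI[of _ "min \<delta> \<epsilon>"]) auto
      qed
      show ?case
      \<comment> \<open>In the open ball of radius \<open>R\<close> the coordinate speed is at most
        \<open>1 / m\<close>. Outside it, the curve locally avoids the compact ball of radius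
        \<open>r < R\<close>, so \<open>f\<close> is locally constant along it. The gap between the
        two radii is what gives each case a whole neighbourhood of \<open>s\<close>.\<close>
      proof (cases "c s \<in> snd \<kappa> -` ball (snd \<kappa> x) R \<inter> fst \<kappa>")
        case True
        have "open (snd \<kappa> -` ball (snd \<kappa> x) R \<inter> fst \<kappa>)" using \<kappa>A(1) open_ball by (rule open_chart_preimage)
        from cont[OF this True] obtain \<delta> where \<delta>: "\<delta> > 0"
          "\<And>q. q \<in> {u0..v0} \<Longrightarrow> dist q s < \<delta> \<Longrightarrow> c q \<in> snd \<kappa> -` ball (snd \<kappa> x) R \<inter> fst \<kappa>" by blast
        have "\<bar>f (c v) - f (c u)\<bar> \<le> (v - u) / m"
          if uv: "u \<le> s" "s \<le> v" "v - u < \<delta>" "u0 \<le> u" "v \<le> v0" for u v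
        proof (cases "u = v")
          case False
          then have "u < v" using uv by simp
          have cin: "c q \<in> fst \<kappa>" "snd \<kappa> (c q) \<in> cball (snd \<kappa> x) R" "\<kappa> \<in> charts_at A (c q)"
            if "q \<in> {u..v}" for q
          proof -
            have "c q \<in> snd \<kappa> -` ball (snd \<kappa> x) R \<inter> fst \<kappa>"
              by (rule \<delta>(2)) (use that uv in \<open>auto simp: dist_real_def\<close>)
            then show "c q \<in> fst \<kappa>" "snd \<kappa> (c q) \<in> cball (snd \<kappa> x) R" "\<kappa> \<in> charts_at A (c q)"
              using \<kappa>A(1) by (simp_all add: charts_at_def)
          qed
          let ?w = "\<lambda>q. velocity A c {u0..v0} q \<kappa>"
          have hv: "((snd \<kappa> \<circ> c) has_vector_derivative ?w q) (at q within {u0..v0})" if "q \<in> {u..v}" for q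
            by (rule has_vector_derivative_velocity[OF uv0(1) c _ cin(3)[OF that]]) (use that uv in auto)
          have wle: "norm (?w q) \<le> 1 / m" if q: "q \<in> {u..v}" for q
          proof -
            have q0: "q \<in> {u0..v0}" using q uv by auto
            have "m * norm (?w q) \<le> fc \<kappa> (snd \<kappa> (c q)) (?w q)" by (rule m(2)[OF cin(2)[OF q]])
            also have "\<dots> = F (c q) (velocity A c {u0..v0} q)"
              by (rule F_velocity_chart[OF uv0(1) c q0 cin(3)[OF q] hv[OF q], symmetric])
            also have "\<dots> < 1" by (rule sp[OF q0])
            finally show ?thesis using m(1) by (simp add: field_simps)
          qed
          have "continuous_on {u..v} (snd \<kappa> \<circ> c)"
            unfolding continuous_on_eq_continuous_within
          proof
            fix q assume q: "q \<in> {u..v}"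
            have "continuous (at q within {u0..v0}) (snd \<kappa> \<circ> c)"
              using hv[OF q] by (rule has_vector_derivative_continuous)
            then show "continuous (at q within {u..v}) (snd \<kappa> \<circ> c)"
              by (rule continuous_within_subset) (use uv in auto)
          qed
          moreover have "((snd \<kappa> \<circ> c) has_derivative (\<lambda>h. h *\<^sub>R ?w q)) (at q)" if "u < q" "q < v" for q
          proof -
            have "at q within {u0..v0} = at q" using that uv by (simp add: at_within_Icc_at)
            then show ?thesis using hv[of q] that unfolding has_vector_derivative_def by simp
          qed
          ultimately obtain q where q: "q \<in> {u<..<v}"
            "norm ((snd \<kappa> \<circ> c) v - (snd \<kappa> \<circ> c) u) \<le> norm ((v - u) *\<^sub>R ?w q)"
            using mvt_general[OF \<open>u < v\<close>, of "snd \<kappa> \<circ> c" "\<lambda>q h. h *\<^sub>R ?w q"] by auto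
          have "norm ((v - u) *\<^sub>R ?w q) = (v - u) * norm (?w q)" using \<open>u < v\<close> by simp
          also have "\<dots> \<le> (v - u) * (1 / m)"
            by (rule mult_left_mono) (use wle[of q] q(1) \<open>u < v\<close> in auto)
          finally have le: "dist (snd \<kappa> (c v)) (snd \<kappa> (c u)) \<le> (v - u) / m" using q(2) by (simp add: dist_norm)
          have fe: "f (c q) = min (dist (snd \<kappa> (c q)) (snd \<kappa> x)) r" if "q \<in> {u..v}" for q
            unfolding f using cin(1)[OF that] by simp
          have "\<bar>min p r - min q r\<bar> \<le> \<bar>p - q\<bar>" for p q :: real by (simp add: min_def)
          then have "\<bar>f (c v) - f (c u)\<bar> \<le> \<bar>dist (snd \<kappa> (c v)) (snd \<kappa> x) - dist (snd \<kappa> (c u)) (snd \<kappa> x)\<bar>"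
            using fe[of u] fe[of v] \<open>u < v\<close> by simp
          also have "\<dots> \<le> dist (snd \<kappa> (c v)) (snd \<kappa> (c u))"
            using dist_triangle[of "snd \<kappa> (c v)" "snd \<kappa> x" "snd \<kappa> (c u)"]
              dist_triangle[of "snd \<kappa> (c u)" "snd \<kappa> x" "snd \<kappa> (c v)"] by (simp add: dist_commute abs_le_iff)
          finally show ?thesis using le by linarith
        qed simp
        then show ?thesis using \<delta>(1) by (intro exI[of _ \<delta>]) auto
      next
        case False
        let ?C = "cinv \<kappa> ` cball (snd \<kappa> x) r"
        have sub: "cball (snd \<kappa> x) r \<subseteq> snd \<kappa> ` fst \<kappa>" "cball (snd \<kappa> x) r \<subseteq> ball (snd \<kappa> x) R"
          using r by (auto intro: subsetD[OF r(3)])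
        have "compact ?C"
          using continuous_on_subset[OF continuous_on_cinv[OF \<kappa>A(1)] sub(1)] compact_cball
          by (rule compact_continuous_image)
        then have op: "open (- ?C)" by (simp add: compact_imp_closed open_Compl)
        have notin: "c s \<in> - ?C"
        proof
          assume "c s \<in> ?C"
          then obtain y where y: "y \<in> cball (snd \<kappa> x) r" "c s = cinv \<kappa> y" by blast
          then have "snd \<kappa> (c s) = y" "c s \<in> fst \<kappa>"
            using sub(1) chart_cinv[of y \<kappa>] cinv_in[of y \<kappa>] by auto
          then show False using False y(1) sub(2) by auto
        qed
        from cont[OF op notin] obtain \<delta> where \<delta>: "\<delta> > 0"
          "\<And>q. q \<in> {u0..v0} \<Longrightarrow> dist q s < \<delta> \<Longrightarrow> c q \<in> - ?C" by blast
        have fr: "f z = r" if "z \<in> - ?C" for z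
        proof (cases "z \<in> fst \<kappa>")
          case True
          have "snd \<kappa> z \<notin> cball (snd \<kappa> x) r"
            using that cinv_chart[OF \<kappa>A(1) True] by (metis ComplD imageI)
          then show ?thesis unfolding f using True by (simp add: dist_commute min_def)
        qed (simp add: f)
        have "\<bar>f (c v) - f (c u)\<bar> \<le> (v - u) / m"
          if uv: "u \<le> s" "s \<le> v" "v - u < \<delta>" "u0 \<le> u" "v \<le> v0" for u v
        proof -
          have "c u \<in> - ?C" "c v \<in> - ?C" by (rule \<delta>(2); use uv in \<open>simp add: dist_real_def\<close>)+
          then show ?thesis using fr uv m(1) by simp
        qed
        then show ?thesis using \<delta>(1) by (intro exI[of _ \<delta>]) auto
      qed
    qed
    then show "\<bar>f (c v0) - f (c u0)\<bar> \<le> (v0 - u0) / m" by simp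
  qed
qed

text \<open>\<open>S\<close> is the coordinate sphere of radius \<open>r / 2\<close> and
  \<open>K\<close> the coordinate ball of radius \<open>r\<close>. Along an almost shortest curve
  from \<open>x\<close> to a point off \<open>K\<close> the truncated radius \<open>f\<close> rises
  from \<open>0\<close> to \<open>r\<close>, so the curve meets \<open>S\<close>; reaching
  \<open>S\<close> takes at least the time \<open>m * (r / 2)\<close>.\<close>

lemma fermat_dist_shell:
  "\<exists>S K. compact S \<and> compact K \<and> (\<forall>y\<in>S. 0 < d x y) \<and>
    (\<forall>z e. z \<notin> K \<longrightarrow> 0 < e \<longrightarrow> (\<exists>y\<in>S. d x y + d y z \<le> d x z + e))"
proof -
  obtain \<kappa> R where \<kappa>: "\<kappa> \<in> charts_at A x" and R: "0 < R" "cball (snd \<kappa> x) R \<subseteq> snd \<kappa> ` fst \<kappa>"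
    by (rule chart_cball)
  have \<kappa>A: "\<kappa> \<in> A" "x \<in> fst \<kappa>" using charts_atD[OF \<kappa>] by simp_all
  obtain m M where m: "0 < m" and "0 < M"
    and m2: "\<forall>y\<in>cball (snd \<kappa> x) R. \<forall>a. m * norm a \<le> fc \<kappa> y a \<and> fc \<kappa> y a \<le> M * norm a"
    using \<kappa>A(1) compact_cball R(2) by (rule fc_bounds)
  define r where "r = R / 2"
  have r: "0 < r" "r < R" using R(1) by (simp_all add: r_def)
  define f where "f = (\<lambda>z. if z \<in> fst \<kappa> then min (dist (snd \<kappa> z) (snd \<kappa> x)) r else r)"
  have lip: "\<bar>f (c v) - f (c u)\<bar> \<le> (v - u) / m"
    if "arcs_on A speed_lt_1 c I S" "{u..v} \<subseteq> I" "u < v" for c I S u v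
  proof (rule radial_Lipschitz[OF \<kappa> r R(2) m _ f_def])
    show "arcs_on A speed_lt_1 c {u..v} S" using that(1,2) by (rule arcs_on_subset)
    show "m * norm a \<le> fc \<kappa> y a" if "y \<in> cball (snd \<kappa> x) R" for y a using m2 that by blast
  qed (rule that(3))
  have fx: "f x = 0" using \<kappa>A(2) r(1) by (simp add: f_def)
  let ?S = "cinv \<kappa> ` sphere (snd \<kappa> x) (r / 2)" and ?K = "cinv \<kappa> ` cball (snd \<kappa> x) r"
  have sub: "cball (snd \<kappa> x) r \<subseteq> snd \<kappa> ` fst \<kappa>" "sphere (snd \<kappa> x) (r / 2) \<subseteq> snd \<kappa> ` fst \<kappa>"
    using r by (auto intro!: subsetD[OF R(2)])
  have "compact ?S" "compact ?K"
    using continuous_on_subset[OF continuous_on_cinv[OF \<kappa>A(1)]] sub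
    by (auto intro!: compact_continuous_image)
  moreover have "0 < d x y" if y: "y \<in> ?S" for y
  proof -
    obtain w where w: "w \<in> sphere (snd \<kappa> x) (r / 2)" "y = cinv \<kappa> w" using y by blast
    then have "w \<in> snd \<kappa> ` fst \<kappa>" using sub(2) by blast
    then have fy: "f y = r / 2"
      unfolding f_def using w r(1) chart_cinv[of w \<kappa>] cinv_in[of w \<kappa>] by (simp add: dist_commute)
    have "m * (r / 2) \<le> d x y"
    proof (rule ccontr)
      assume "\<not> m * (r / 2) \<le> d x y"
      then have "d x y < m * (r / 2)" by simp
      from dense[OF this] obtain T where T: "d x y < T" "T < m * (r / 2)" by blast
      then obtain c S where c: "c 0 = x" "c T = y" "arcs_on A speed_lt_1 c {0..T} S" "0 < T"
        unfolding fermat_dist_less_iff link_def by blast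
      have "\<bar>f (c T) - f (c 0)\<bar> \<le> (T - 0) / m" using lip[OF c(3) order_refl c(4)] .
      then have "r / 2 \<le> T / m" using c fx fy r(1) by simp
      then show False using T(2) m by (simp add: field_simps)
    qed
    then show ?thesis using m r(1) by (smt (verit) half_gt_zero mult_pos_pos)
  qed
  moreover have "\<exists>y\<in>?S. d x y + d y z \<le> d x z + e" if z: "z \<notin> ?K" and e: "0 < e" for z e
  proof -
    have fz: "f z = r"
    proof (cases "z \<in> fst \<kappa>")
      case True
      have "snd \<kappa> z \<notin> cball (snd \<kappa> x) r"
        using z cinv_chart[OF \<kappa>A(1) True] by (metis imageI)
      then show ?thesis unfolding f_def using True by (simp add: dist_commute min_def)
    qed (simp add: f_def)
    have "link x z (d x z + e)" unfolding fermat_dist_less_iff[symmetric] using e by simp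
    then obtain c S where c: "c 0 = x" "c (d x z + e) = z" "arcs_on A speed_lt_1 c {0..d x z + e} S"
      "0 < d x z + e"
      unfolding link_def by blast
    let ?T = "d x z + e"
    have "continuous_on {0..?T} (\<lambda>s. f (c s))"
    proof (rule lipschitz_on_continuous_on[OF lipschitz_onI])
      fix u v assume "u \<in> {0..?T}" "v \<in> {0..?T}"
      then show "dist (f (c u)) (f (c v)) \<le> (1 / m) * dist u v"
        using lip[OF c(3), of u v] lip[OF c(3), of v u]
        by (cases u v rule: linorder_cases) (auto simp: dist_real_def)
    qed (use m in simp)
    then obtain s where s: "0 \<le> s" "s \<le> ?T" "f (c s) = r / 2"
      using IVT'[of "\<lambda>s. f (c s)" 0 "r / 2" ?T] c fx fz r(1) by auto
    have ne: "s \<noteq> 0" "s \<noteq> ?T" using s(3) c(1,2) fx fz r(1) by auto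
    have "c s \<in> fst \<kappa>" "dist (snd \<kappa> (c s)) (snd \<kappa> x) = r / 2"
      using s(3) r(1) unfolding f_def by (auto split: if_splits simp: min_def)
    then have "c s \<in> ?S"
      using cinv_chart[OF \<kappa>A(1)] by (intro image_eqI[of _ _ "snd \<kappa> (c s)"]) (simp_all add: dist_commute)
    moreover have "d (c 0) (c s) < s - 0" "d (c s) (c ?T) < ?T - s"
      unfolding fermat_dist_less_iff by (rule link_of_arcs[OF c(3)]; use s ne in auto)+
    ultimately show ?thesis using c(1,2) by (intro bexI[of _ "c s"]) simp_all
  qed
  ultimately show ?thesis by blast
qed

end

section \<open>Indecomposable past sets and Busemann functions\<close>

lemma IP_limit_subseq:
  assumes r: "strict_mono r"
  shows "IP_limit A g0 \<omega> \<sigma> \<subseteq> IP_limit A g0 \<omega> (\<sigma> \<circ> r)"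
proof
  fix P assume P: "P \<in> IP_limit A g0 \<omega> \<sigma>"
  have "P \<subseteq> liminf (\<sigma> \<circ> r)"
    using P liminf_le_subseq[OF r, of \<sigma>] unfolding IP_limit_def by blast
  moreover have "liminf (\<sigma> \<circ> r) \<subseteq> limsup (\<sigma> \<circ> r)"
    by (rule Liminf_le_Limsup) simp
  ultimately show "P \<in> IP_limit A g0 \<omega> (\<sigma> \<circ> r)"
    using P limsup_subseq_le[OF r, of \<sigma>] unfolding IP_limit_def by blast
qed

lemma frequently_subseq:
  assumes "\<exists>\<^sub>F n in sequentially. Q n"
  obtains r :: "nat \<Rightarrow> nat" where "strict_mono r" "\<And>n. Q (r n)"
proof -
  have "infinite {n. Q n}"
    using assms unfolding frequently_sequentially infinite_nat_iff_unbounded_le by auto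
  from infinite_enumerate[OF this] show ?thesis using that by blast
qed

lemma busemann_past_subset: "busemann_past b \<subseteq> busemann_past b' \<longleftrightarrow> b \<le> b'"
proof
  assume l: "busemann_past b \<subseteq> busemann_past b'"
  show "b \<le> b'"
  proof (rule le_funI, rule dense_le)
    fix x t assume "t < b x"
    then have "(t, x) \<in> busemann_past b'" using l by (auto simp: busemann_past_def)
    then show "t \<le> b' x" by (simp add: busemann_past_def)
  qed
next
  assume "b \<le> b'"
  then show "busemann_past b \<subseteq> busemann_past b'"
    by (auto simp: busemann_past_def le_fun_def intro: less_le_trans)
qed

lemma busemann_past_inject: "busemann_past b = busemann_past b' \<longleftrightarrow> b = b'"
  by (metis busemann_past_subset order_antisym order_refl)

lemma busemann_past_neq_UNIV: "busemann_past b \<noteq> UNIV"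
proof -
  have "(b undefined, undefined) \<notin> busemann_past b" by (simp add: busemann_past_def)
  then show ?thesis by blast
qed

lemma tendsto_fun_iff:
  fixes \<sigma> :: "nat \<Rightarrow> 'a \<Rightarrow> 'b::topological_space"
  shows "\<sigma> \<longlonglongrightarrow> f \<longleftrightarrow> (\<forall>x. (\<lambda>n. \<sigma> n x) \<longlonglongrightarrow> f x)"
  using limitin_componentwise[of "\<lambda>_. euclidean" UNIV \<sigma> f sequentially]
  by (simp add: euclidean_product_topology)

lemma compact_PiE_UNIV:
  fixes S :: "'a \<Rightarrow> 'b::topological_space set"
  assumes "\<And>i. compact (S i)"
  shows "compact (Pi\<^sub>E UNIV S)"
  using assms compactin_PiE[of "\<lambda>_. euclidean" UNIV S]
  by (simp add: euclidean_product_topology)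

text \<open>Chronological limits are topological limits: a subsequence avoiding an open
  \<open>U\<close> keeps the limit \<open>f\<close> by \<open>sub\<close>, but lies in the closed
  complement of \<open>U\<close>.\<close>

lemma openin_limit_topology_sequence:
  assumes U: "\<And>\<sigma>. range \<sigma> \<subseteq> X - U \<Longrightarrow> L \<sigma> \<subseteq> X - U"
    and sub: "\<And>r. strict_mono (r :: nat \<Rightarrow> nat) \<Longrightarrow> L \<sigma> \<subseteq> L (\<sigma> \<circ> r)"
    and \<sigma>: "range \<sigma> \<subseteq> X" "f \<in> L \<sigma>" "f \<in> U"
  shows "\<forall>\<^sub>F n in sequentially. \<sigma> n \<in> U"
proof (rule ccontr)
  assume "\<not> ?thesis"
  then have "\<exists>\<^sub>F n in sequentially. \<sigma> n \<notin> U" by (simp add: frequently_def)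
  then obtain r :: "nat \<Rightarrow> nat" where r: "strict_mono r" "\<And>n. \<sigma> (r n) \<notin> U"
    by (rule frequently_subseq) blast
  have "range (\<sigma> \<circ> r) \<subseteq> X - U" using \<sigma>(1) r(2) by auto
  from U[OF this] show False using sub[OF r(1)] \<sigma> by blast
qed

lemma ereal_le_liminf_iff:
  fixes a :: real and h :: "nat \<Rightarrow> real"
  shows "ereal a \<le> liminf (\<lambda>n. ereal (h n)) \<longleftrightarrow> (\<forall>t<a. \<forall>\<^sub>F n in sequentially. t < h n)"
  unfolding le_Liminf_iff
proof (intro iffI allI impI)
  fix t assume y: "\<forall>y<ereal a. \<forall>\<^sub>F n in sequentially. y < ereal (h n)" and "t < a"
  then have "ereal t < ereal a" by simp
  then have "\<forall>\<^sub>F n in sequentially. ereal t < ereal (h n)" using y by blast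
  then show "\<forall>\<^sub>F n in sequentially. t < h n" by simp
next
  fix y assume "\<forall>t<a. \<forall>\<^sub>F n in sequentially. t < h n" "y < ereal a"
  then show "\<forall>\<^sub>F n in sequentially. y < ereal (h n)" by (cases y) auto
qed

lemma limsup_ge_imp_frequently:
  assumes "ereal a \<le> limsup (\<lambda>n. ereal (h n))" "t < a"
  shows "\<exists>\<^sub>F n in sequentially. t < h n"
proof (rule ccontr)
  assume "\<not> ?thesis"
  then have "\<forall>\<^sub>F n in sequentially. ereal (h n) \<le> ereal t" by (simp add: frequently_def not_less)
  then have "limsup (\<lambda>n. ereal (h n)) \<le> ereal t" by (rule Limsup_bounded)
  then show False using assms by (meson ereal_less_eq(3) not_le order_trans)
qed

lemma frequently_imp_limsup_ge:
  assumes "\<And>t. t < a \<Longrightarrow> \<exists>\<^sub>F n in sequentially. t < h n"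
  shows "ereal a \<le> limsup (\<lambda>n. ereal (h n))"
proof (rule ccontr)
  assume "\<not> ?thesis"
  then obtain t where t: "limsup (\<lambda>n. ereal (h n)) < ereal t" "ereal t < ereal a"
    using ereal_dense2 not_le by metis
  then have "\<forall>\<^sub>F n in sequentially. ereal (h n) < ereal t" by (intro Limsup_lessD)
  then have "\<forall>\<^sub>F n in sequentially. \<not> t < h n" by (rule eventually_mono) simp
  moreover have "\<exists>\<^sub>F n in sequentially. t < h n" using assms t(2) by simp
  ultimately show False by (simp add: frequently_def)
qed

lemma busemann_past_subset_liminf:
  "busemann_past f \<subseteq> liminf (\<lambda>n. busemann_past (\<sigma> n)) \<longleftrightarrow>
    (\<forall>x. ereal (f x) \<le> liminf (\<lambda>n. ereal (\<sigma> n x)))"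
  unfolding ereal_le_liminf_iff by (auto simp: busemann_past_def subset_iff mem_liminf_iff)

lemma busemann_past_subset_limsup:
  "busemann_past f \<subseteq> limsup (\<lambda>n. busemann_past (\<sigma> n)) \<longleftrightarrow>
    (\<forall>x. ereal (f x) \<le> limsup (\<lambda>n. ereal (\<sigma> n x)))"
  (is "?l \<longleftrightarrow> ?r")
proof -
  have "?l \<longleftrightarrow> (\<forall>x. \<forall>t<f x. \<exists>\<^sub>F n in sequentially. t < \<sigma> n x)"
    by (auto simp: busemann_past_def subset_iff mem_limsup_iff)
  also have "\<dots> \<longleftrightarrow> ?r"
    by (intro all_cong1 iffI frequently_imp_limsup_ge) (auto dest: limsup_ge_imp_frequently)
  finally show ?thesis .
qed

text \<open>The projection along a compact factor is closed.\<close>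

lemma tube_at_infinity:
  assumes "compact_space T" and W: "openin (prod_topology (top_of_set {-\<infinity><..}) T) W"
    and inf: "{\<infinity>} \<times> topspace T \<subseteq> W"
  obtains K :: real where "\<And>t \<xi>. K < t \<Longrightarrow> \<xi> \<in> topspace T \<Longrightarrow> (ereal t, \<xi>) \<in> W"
proof -
  let ?X = "top_of_set {-\<infinity><..} :: ereal topology" and ?C = "({-\<infinity><..} \<times> topspace T) - W"
  have "closedin (prod_topology ?X T) ?C" using closedin_diff[OF closedin_topspace W] by simp
  then have "closedin ?X (fst ` ?C)" using closed_map_fst[OF assms(1)] unfolding closed_map_def by blast
  then have op: "openin ?X ({-\<infinity><..} - fst ` ?C)" unfolding closedin_def by simp
  have "\<infinity> \<in> {-\<infinity><..} - fst ` ?C" using inf by auto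
  moreover have "open ({-\<infinity><..} - fst ` ?C)"
    using op open_greaterThan[of "-\<infinity>::ereal"] openin_open_eq by blast
  ultimately obtain K where K: "{ereal K<..} \<subseteq> {-\<infinity><..} - fst ` ?C"
    using open_PInfty by blast
  have "(ereal t, \<xi>) \<in> W" if "K < t" "\<xi> \<in> topspace T" for t \<xi>
  proof (rule ccontr)
    assume "(ereal t, \<xi>) \<notin> W"
    then have "(ereal t, \<xi>) \<in> ?C" using that by simp
    then have "ereal t \<in> fst ` ?C" by (rule image_eqI[rotated]) simp
    moreover have "ereal t \<in> {ereal K<..}" using that by simp
    ultimately show False using K by blast
  qed
  then show ?thesis by (rule that)
qed

text \<open>The causal part of the argument uses the geometry of \<open>M\<close> only through the following facts. In
  the shell condition, \<open>S\<close> is a small coordinate sphere around \<open>x\<close> and \<open>K\<close> a larger ball.\<close>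

locale fermat_causality =
  fixes A :: "('m::{t2_space, second_countable_topology}, 'e::euclidean_space) chart set"
    and g0 :: "'m \<Rightarrow> ('m, 'e) tvec \<Rightarrow> ('m, 'e) tvec \<Rightarrow> real"
    and \<omega> :: "'m \<Rightarrow> ('m, 'e) tvec \<Rightarrow> real"
  assumes d_nonneg: "0 \<le> fermat_dist A g0 \<omega> x y"
    and d_self [simp]: "fermat_dist A g0 \<omega> x x = 0"
    and d_triangle: "fermat_dist A g0 \<omega> x z \<le> fermat_dist A g0 \<omega> x y + fermat_dist A g0 \<omega> y z"
    and d_small: "0 < e \<Longrightarrow> \<exists>N. open N \<and> x \<in> N \<and>
      (\<forall>y\<in>N. fermat_dist A g0 \<omega> x y < e \<and> fermat_dist A g0 \<omega> y x < e)"
    and d_shell: "\<exists>S K. compact S \<and> compact K \<and> (\<forall>y\<in>S. 0 < fermat_dist A g0 \<omega> x y) \<and>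
      (\<forall>z e. z \<notin> K \<longrightarrow> 0 < e \<longrightarrow> (\<exists>y\<in>S. fermat_dist A g0 \<omega> x y + fermat_dist A g0 \<omega> y z
         \<le> fermat_dist A g0 \<omega> x z + e))"
    and chronological_iff: "chronological A g0 \<omega> (t, x) (t', x') \<longleftrightarrow>
      t + fermat_dist A g0 \<omega> x x' < t'"
    and C_plus_less: "\<lbrakk>C_plus A g0 \<omega> \<alpha> \<Omega> c; \<alpha> \<le> s; s < s'; ereal s' < \<Omega>\<rbrakk> \<Longrightarrow>
      fermat_dist A g0 \<omega> (c s) (c s') < s' - s"
    and C_plus_chain: "(\<And>n. T n + fermat_dist A g0 \<omega> (X n) (X (Suc n)) < T (Suc n)) \<Longrightarrow>
      \<exists>c. C_plus A g0 \<omega> (T 0) (SUP n. ereal (T n)) c \<and> (\<forall>n. c (T n) = X n)"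
begin

abbreviation "d \<equiv> fermat_dist A g0 \<omega>"
abbreviation "BB \<equiv> B_plus A g0 \<omega>"
abbreviation "past \<equiv> I_minus A g0 \<omega>"
abbreviation "cls \<equiv> B_class A g0 \<omega>"

section \<open>Past sets and indecomposability in terms of \<open>d\<close>\<close>

lemma mem_past: "q \<in> past p \<longleftrightarrow> fst q + d (snd q) (snd p) < fst p"
  unfolding I_minus_def using chronological_iff[of "fst q" "snd q" "fst p" "snd p"] by simp

lemma past_trans: "q \<in> past p \<Longrightarrow> p \<in> past r \<Longrightarrow> q \<in> past r"
  unfolding mem_past using d_triangle[of "snd q" "snd r" "snd p"] by linarith

lemma past_dense:
  assumes "q \<in> past p"
  obtains r where "q \<in> past r" "r \<in> past p"
proof -
  obtain t where "fst q + d (snd q) (snd p) < t" "t < fst p" using assms dense mem_past by blast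
  then have "q \<in> past (t, snd p)" "(t, snd p) \<in> past p" by (simp_all add: mem_past)
  then show ?thesis by (rule that)
qed

lemma past_nonempty: "past p \<noteq> {}"
proof -
  have "(fst p - 1, snd p) \<in> past p" by (simp add: mem_past)
  then show ?thesis by blast
qed

lemma past_set_iff:
  "past_set A g0 \<omega> P \<longleftrightarrow> P \<noteq> {} \<and> (\<forall>p\<in>P. past p \<subseteq> P) \<and> (\<forall>q\<in>P. \<exists>p\<in>P. q \<in> past p)"
proof -
  have "P = (\<Union>p\<in>P. past p) \<longleftrightarrow> (\<Union>p\<in>P. past p) \<subseteq> P \<and> P \<subseteq> (\<Union>p\<in>P. past p)" by blast
  then show ?thesis unfolding past_set_def by (auto simp: subset_iff)
qed

lemma past_set_UN_past: "S \<noteq> {} \<Longrightarrow> past_set A g0 \<omega> (\<Union>p\<in>S. past p)"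
  unfolding past_set_iff
proof (intro conjI ballI)
  assume "S \<noteq> {}"
  then show "(\<Union>p\<in>S. past p) \<noteq> {}" using past_nonempty by fastforce
  show "past p \<subseteq> (\<Union>p\<in>S. past p)" if "p \<in> (\<Union>p\<in>S. past p)" for p
    using that past_trans by blast
  fix q assume "q \<in> (\<Union>p\<in>S. past p)"
  then obtain p where "p \<in> S" "q \<in> past p" by blast
  moreover from this(2) obtain r where "q \<in> past r" "r \<in> past p" by (rule past_dense)
  ultimately show "\<exists>p\<in>(\<Union>p\<in>S. past p). q \<in> past p" by blast
qed

text \<open>For \<open>p\<close> in \<open>P\<close>, the past set splits into the pasts of the
  points after \<open>p\<close> and the pasts of the other points. The second part misses
  \<open>p\<close>, so indecomposability makes the first part all of \<open>P\<close>, and any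
  \<open>q\<close> then shares a later point with \<open>p\<close>.\<close>

lemma IP_iff:
  "IP A g0 \<omega> P \<longleftrightarrow> P \<noteq> {} \<and> (\<forall>p\<in>P. past p \<subseteq> P) \<and> (\<forall>p\<in>P. \<forall>q\<in>P. \<exists>r\<in>P. p \<in> past r \<and> q \<in> past r)"
  (is "?l \<longleftrightarrow> ?r")
proof
  assume ?l
  then have P: "past_set A g0 \<omega> P"
    and irr: "\<And>Q R. past_set A g0 \<omega> Q \<Longrightarrow> past_set A g0 \<omega> R \<Longrightarrow> P = Q \<union> R \<Longrightarrow> P = Q \<or> P = R"
    unfolding IP_def by blast+
  have "\<exists>r\<in>P. p \<in> past r \<and> q \<in> past r" if pq: "p \<in> P" "q \<in> P" for p q
  proof -
    let ?S = "{r \<in> P. p \<in> past r}" and ?T = "{r \<in> P. p \<notin> past r}"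
    have S: "?S \<noteq> {}" using P pq(1) unfolding past_set_iff by auto
    have "P = (\<Union>p\<in>P. past p)" using P unfolding past_set_def by (rule conjunct2)
    also have "\<dots> = (\<Union>p\<in>?S. past p) \<union> (\<Union>p\<in>?T. past p)" by auto
    finally have PST: "P = (\<Union>p\<in>?S. past p) \<union> (\<Union>p\<in>?T. past p)" .
    have "P = (\<Union>p\<in>?S. past p)"
    proof (cases "?T = {}")
      case True
      then show ?thesis using PST by (simp only: True) simp
    next
      case False
      have "p \<notin> (\<Union>p\<in>?T. past p)" by simp
      then have "P \<noteq> (\<Union>p\<in>?T. past p)" using pq(1) by metis
      then show ?thesis
        using irr[OF past_set_UN_past[OF S] past_set_UN_past[OF False] PST] by simp
    qed
    then have "q \<in> (\<Union>p\<in>?S. past p)" using pq(2) by simp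
    then show ?thesis by auto
  qed
  then show ?r using P unfolding past_set_iff by auto
next
  assume r: ?r
  then have P: "past_set A g0 \<omega> P" unfolding past_set_iff by auto
  have False if QR: "past_set A g0 \<omega> Q" "past_set A g0 \<omega> R" "Q \<subset> P" "R \<subset> P" "P = Q \<union> R" for Q R
  proof -
    obtain p q where pq: "p \<in> P" "p \<notin> Q" "q \<in> P" "q \<notin> R" using QR by blast
    then obtain s where s: "s \<in> P" "p \<in> past s" "q \<in> past s" using r by metis
    have "s \<notin> Q" "s \<notin> R" using s pq QR(1,2) unfolding past_set_iff by auto
    then show False using QR(5) s(1) by blast
  qed
  then show ?l using P unfolding IP_def by blast
qed

lemma past_common:
  obtains r where "p \<in> past r" "q \<in> past r"
proof
  let ?r = "(max (fst p) (fst q) + d (snd p) (snd q) + 1, snd q)"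
  show "p \<in> past ?r" "q \<in> past ?r" using d_nonneg[of "snd p" "snd q"] by (auto simp: mem_past)
qed

lemma IP_UNIV: "IP A g0 \<omega> UNIV"
  unfolding IP_iff by (metis past_common UNIV_I UNIV_not_empty subset_UNIV)

lemma IP_past: "IP A g0 \<omega> (past p)"
  unfolding IP_iff
proof (intro conjI ballI past_nonempty)
  show "past q \<subseteq> past p" if "q \<in> past p" for q using that by (blast intro: past_trans)
  fix q r assume "q \<in> past p" "r \<in> past p"
  then have "max (fst q + d (snd q) (snd p)) (fst r + d (snd r) (snd p)) < fst p"
    by (simp add: mem_past)
  then obtain t where "max (fst q + d (snd q) (snd p)) (fst r + d (snd r) (snd p)) < t" "t < fst p"
    using dense by blast
  then have "(t, snd p) \<in> past p" "q \<in> past (t, snd p)" "r \<in> past (t, snd p)" by (simp_all add: mem_past)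
  then show "\<exists>s\<in>past p. q \<in> past s \<and> r \<in> past s" by blast
qed

lemma IP_Union_chain:
  assumes "\<C> \<noteq> {}" "subset.chain (Collect (IP A g0 \<omega>)) \<C>"
  shows "IP A g0 \<omega> (\<Union>\<C>)"
proof -
  have ip: "IP A g0 \<omega> P" if "P \<in> \<C>" for P using assms(2) that unfolding subset.chain_def by blast
  have lin: "P \<subseteq> Q \<or> Q \<subseteq> P" if "P \<in> \<C>" "Q \<in> \<C>" for P Q
    using assms(2) that unfolding subset.chain_def by blast
  show ?thesis
    unfolding IP_iff
  proof (intro conjI ballI)
    show "\<Union>\<C> \<noteq> {}" using assms(1) ip unfolding IP_iff by blast
    show "past p \<subseteq> \<Union>\<C>" if "p \<in> \<Union>\<C>" for p using ip that unfolding IP_iff by blast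
    fix p q assume "p \<in> \<Union>\<C>" "q \<in> \<Union>\<C>"
    then obtain P where "P \<in> \<C>" "p \<in> P" "q \<in> P" using lin by blast
    then show "\<exists>r\<in>\<Union>\<C>. p \<in> past r \<and> q \<in> past r" using ip unfolding IP_iff by blast
  qed
qed

lemma past_eq: "past (t, x) = busemann_past (\<lambda>y. t - d y x)"
  unfolding busemann_past_def by (auto simp: mem_past)

text \<open>\<open>b\<close> is the height of \<open>P\<close> over each point of \<open>M\<close>.
  A single point \<open>(s, y)\<close> outside \<open>P\<close> bounds all heights, because it must
  not lie in the past of any point of \<open>P\<close>.\<close>

lemma past_set_repr:
  assumes P: "past_set A g0 \<omega> P" and U: "P \<noteq> UNIV"
  shows "\<exists>b. P = busemann_past b"
proof -
  have down: "q \<in> P" if "p \<in> P" "q \<in> past p" for p q using P that unfolding past_set_iff by blast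
  obtain t0 x0 where 0: "(t0, x0) \<in> P" using P unfolding past_set_iff by fastforce
  obtain s y where sy: "(s, y) \<notin> P" using U by fastforce
  define b where "b x = Sup {t. (t, x) \<in> P}" for x
  have ne: "{t. (t, x) \<in> P} \<noteq> {}" for x
  proof -
    have "(t0 - d x x0 - 1, x) \<in> P" by (rule down[OF 0]) (simp add: mem_past)
    then show ?thesis by blast
  qed
  have bdd: "bdd_above {t. (t, x) \<in> P}" for x
  proof (rule bdd_aboveI)
    fix t assume "t \<in> {t. (t, x) \<in> P}"
    then have "\<not> (s, y) \<in> past (t, x)" using down sy by blast
    then show "t \<le> s + d y x" by (simp add: mem_past)
  qed
  have "(t, x) \<in> P \<longleftrightarrow> t < b x" for t x
  proof
    assume "(t, x) \<in> P"
    then obtain p where p: "p \<in> P" "(t, x) \<in> past p" using P unfolding past_set_iff by blast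
    then have "t < fst p - d x (snd p)" by (simp add: mem_past)
    then obtain t' where t': "t < t'" "t' < fst p - d x (snd p)" using dense by blast
    have "(t', x) \<in> P" by (rule down[OF p(1)]) (use t' in \<open>simp add: mem_past\<close>)
    then have "t' \<le> b x" unfolding b_def by (intro cSup_upper bdd) simp
    then show "t < b x" using t' by simp
  next
    assume "t < b x"
    then obtain t' where "(t', x) \<in> P" "t < t'"
      unfolding b_def using less_cSup_iff[OF ne bdd] by blast
    then show "(t, x) \<in> P" by (metis down[of "(t', x)" "(t, x)"] d_self add.right_neutral fst_conv snd_conv mem_past)
  qed
  then show ?thesis unfolding busemann_past_def by blast
qed

text \<open>A Lipschitz condition adapted to the nonsymmetric \<open>d\<close>: it expresses that
  \<open>P(b)\<close> contains the pasts of its points. Being a closed condition, it passes to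
  pointwise limits.\<close>

definition is_lip :: "('m \<Rightarrow> real) \<Rightarrow> bool" where
  "is_lip b \<longleftrightarrow> (\<forall>x y. b y - d x y \<le> b x)"

lemma past_subset_iff_lip: "(\<forall>p\<in>busemann_past b. past p \<subseteq> busemann_past b) \<longleftrightarrow> is_lip b"
proof
  assume l: "\<forall>p\<in>busemann_past b. past p \<subseteq> busemann_past b"
  show "is_lip b"
    unfolding is_lip_def
  proof (intro allI)
    fix x y
    show "b y - d x y \<le> b x"
    proof (rule dense_le)
      fix s assume "s < b y - d x y"
      then obtain t where t: "s + d x y < t" "t < b y" using dense[of "s + d x y" "b y"] by auto
      then have "(t, y) \<in> busemann_past b" "(s, x) \<in> past (t, y)"
        by (simp_all add: busemann_past_def mem_past)
      then show "s \<le> b x" using l unfolding busemann_past_def by fastforce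
    qed
  qed
next
  assume "is_lip b"
  then have b: "b y - d x y \<le> b x" for x y unfolding is_lip_def by blast
  have "fst q < b (snd q)" if "fst p < b (snd p)" "fst q + d (snd q) (snd p) < fst p" for p q :: "real \<times> 'm"
    using b[of "snd p" "snd q"] that by linarith
  then show "\<forall>p\<in>busemann_past b. past p \<subseteq> busemann_past b"
    unfolding busemann_past_def by (auto simp: mem_past)
qed

lemma IP_busemann_past_iff:
  "IP A g0 \<omega> (busemann_past b) \<longleftrightarrow> is_lip b \<and>
     (\<forall>x y s t. s < b x \<longrightarrow> t < b y \<longrightarrow> (\<exists>r z. r < b z \<and> s + d x z < r \<and> t + d y z < r))"
proof -
  have "(b undefined - 1, undefined) \<in> busemann_past b" by (simp add: busemann_past_def)
  then have "busemann_past b \<noteq> {}" by blast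
  then show ?thesis
    unfolding IP_iff past_subset_iff_lip by (auto simp: busemann_past_def mem_past)
qed

section \<open>Continuity of \<open>d\<close>, openness of pasts and futures\<close>

lemma d_cont_bound:
  assumes "0 < e"
  shows "\<exists>N. open N \<and> x \<in> N \<and> (\<forall>y\<in>N. \<forall>z. \<bar>d z y - d z x\<bar> < e \<and> \<bar>d y z - d x z\<bar> < e)"
proof -
  obtain N where N: "open N" "x \<in> N" "\<And>y. y \<in> N \<Longrightarrow> d x y < e \<and> d y x < e"
    using d_small[OF assms] by meson
  have "\<bar>d z y - d z x\<bar> < e \<and> \<bar>d y z - d x z\<bar> < e" if "y \<in> N" for y z
    using N(3)[OF that] d_triangle[of z y x] d_triangle[of z x y] d_triangle[of y z x] d_triangle[of x z y]
    unfolding abs_less_iff by (intro conjI; linarith)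
  then show ?thesis using N by blast
qed

lemma continuous_on_d1 [continuous_intros]: "continuous_on S (\<lambda>x. d x z)"
  unfolding continuous_on_topological
proof (intro ballI allI impI)
  fix x V assume "x \<in> S" "open V" "d x z \<in> V"
  then obtain e where e: "e > 0" "ball (d x z) e \<subseteq> V" using open_contains_ball by blast
  obtain N where "open N" "x \<in> N" "\<forall>y\<in>N. \<forall>z. \<bar>d z y - d z x\<bar> < e \<and> \<bar>d y z - d x z\<bar> < e"
    using d_cont_bound[OF e(1)] by blast
  then show "\<exists>N. open N \<and> x \<in> N \<and> (\<forall>y\<in>S. y \<in> N \<longrightarrow> d y z \<in> V)"
    using e(2) by (intro exI[of _ N]) (auto simp: subset_iff dist_real_def abs_minus_commute)
qed

lemma continuous_on_d2 [continuous_intros]: "continuous_on S (\<lambda>x. d z x)"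
  unfolding continuous_on_topological
proof (intro ballI allI impI)
  fix x V assume "x \<in> S" "open V" "d z x \<in> V"
  then obtain e where e: "e > 0" "ball (d z x) e \<subseteq> V" using open_contains_ball by blast
  obtain N where "open N" "x \<in> N" "\<forall>y\<in>N. \<forall>z. \<bar>d z y - d z x\<bar> < e \<and> \<bar>d y z - d x z\<bar> < e"
    using d_cont_bound[OF e(1)] by blast
  then show "\<exists>N. open N \<and> x \<in> N \<and> (\<forall>y\<in>S. y \<in> N \<longrightarrow> d z y \<in> V)"
    using e(2) by (intro exI[of _ N]) (auto simp: subset_iff dist_real_def abs_minus_commute)
qed

lemma tendsto_d:
  assumes "X \<longlonglongrightarrow> x"
  shows "(\<lambda>n. d z (X n)) \<longlonglongrightarrow> d z x" "(\<lambda>n. d (X n) z) \<longlonglongrightarrow> d x z"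
  using assms continuous_on_tendsto_compose[OF continuous_on_d2[of UNIV z] assms]
    continuous_on_tendsto_compose[OF continuous_on_d1[of UNIV z] assms] by auto

lemma open_past: "open (past p)"
proof -
  have "past p = {q. fst q + d (snd q) (snd p) < fst p}" using mem_past by blast
  moreover have "continuous_on UNIV (\<lambda>q :: real \<times> 'm. fst q + d (snd q) (snd p))"
    by (intro continuous_intros continuous_on_compose2[OF continuous_on_d1[of UNIV]]) auto
  ultimately show ?thesis by (simp add: open_Collect_less)
qed

lemma open_future: "open {q. p \<in> past q}"
proof -
  have "continuous_on UNIV (\<lambda>q :: real \<times> 'm. fst p + d (snd p) (snd q))"
    by (intro continuous_intros continuous_on_compose2[OF continuous_on_d2[of UNIV]]) auto
  then show ?thesis unfolding mem_past by (intro open_Collect_less) (auto intro: continuous_intros)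
qed

text \<open>Geroch--Kronheimer--Penrose: an IP is directed and open in a separable space, hence the
  chronological past of a chronological chain.\<close>

lemma IP_chain:
  assumes "IP A g0 \<omega> P"
  obtains r where "\<And>n. r n \<in> P" "\<And>n. r n \<in> past (r (Suc n))" "P = (\<Union>n. past (r n))"
proof -
  have ne: "P \<noteq> {}" and down: "\<And>p. p \<in> P \<Longrightarrow> past p \<subseteq> P"
    and dir: "\<And>p q. p \<in> P \<Longrightarrow> q \<in> P \<Longrightarrow> \<exists>r\<in>P. p \<in> past r \<and> q \<in> past r"
    using assms unfolding IP_iff by blast+
  have "P = (\<Union>p\<in>P. past p)" using dir down by blast
  then have "open P" using open_past by (metis open_UN)
  obtain D :: "(real \<times> 'm) set" where D: "countable D" "\<And>X. open X \<Longrightarrow> X \<noteq> {} \<Longrightarrow> \<exists>q\<in>D. q \<in> X"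
    using countable_dense_setE by blast
  have "D \<inter> P \<noteq> {}" using D(2)[OF \<open>open P\<close> ne] by blast
  define e where "e = from_nat_into (D \<inter> P)"
  have e: "range e = D \<inter> P"
    unfolding e_def using D(1) \<open>D \<inter> P \<noteq> {}\<close> by (simp add: range_from_nat_into)
  \<comment> \<open>\<open>r (Suc n)\<close> is taken after both \<open>r n\<close> and the
    \<open>n\<close>-th dense point, so the chain is chronological and cofinal in
    \<open>P\<close>.\<close>
  have "\<exists>r. \<forall>n. r n \<in> P \<and> (e n \<in> past (r (Suc n)) \<and> r n \<in> past (r (Suc n)))"
  proof -
    have "\<exists>r. \<forall>n. (\<lambda>n p. p \<in> P) n (r n) \<and> (\<lambda>n p q. e n \<in> past q \<and> p \<in> past q) n (r n) (r (Suc n))"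
    proof (rule dependent_nat_choice)
      show "\<exists>x. x \<in> P" using ne by blast
      show "\<exists>y. y \<in> P \<and> e n \<in> past y \<and> x \<in> past y" if "x \<in> P" for x n
        using dir[of "e n" x] that e by blast
    qed
    then show ?thesis by simp
  qed
  then obtain r where r: "\<And>n. r n \<in> P" "\<And>n. e n \<in> past (r (Suc n))" "\<And>n. r n \<in> past (r (Suc n))" by blast
  have "p \<in> (\<Union>n. past (r n))" if p: "p \<in> P" for p
  proof -
    have "{q. p \<in> past q} \<inter> P \<noteq> {}" using dir p by blast
    then obtain q where "q \<in> D" "p \<in> past q" "q \<in> P"
      using D(2)[of "{q. p \<in> past q} \<inter> P"] open_future \<open>open P\<close> by blast
    then obtain n where "q = e n" using e by (metis IntI imageE)
    then have "p \<in> past (r (Suc n))" using r(2) \<open>p \<in> past q\<close> past_trans by blast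
    then show ?thesis by blast
  qed
  then have "P = (\<Union>n. past (r n))" using r(1) down by blast
  with r show ?thesis using that by blast
qed

text \<open>The quantity \<open>s - d x (c s)\<close> increases with \<open>s\<close>, because
  \<open>c\<close> has speed less than one, so its limit is a supremum.\<close>

lemma busemann_eq:
  assumes c: "C_plus A g0 \<omega> \<alpha> \<Omega> c"
  shows "busemann A g0 \<omega> \<Omega> c x = (SUP s\<in>{s. \<alpha> \<le> s \<and> ereal s < \<Omega>}. ereal (s - d x (c s)))"
proof -
  let ?I = "{s. \<alpha> \<le> s \<and> ereal s < \<Omega>}" and ?f = "\<lambda>s. ereal (s - d x (c s))"
  let ?F = "filtercomap ereal (at_left \<Omega>)"
  have \<alpha>: "ereal \<alpha> < \<Omega>" using c unfolding C_plus_def by blast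
  \<comment> \<open>One filter covers finite and infinite \<open>\<Omega>\<close>. The witness on
    \<open>ereal\<close> holds vacuously at values that are not real.\<close>
  have ev: "eventually Q ?F" if "\<beta> < \<Omega>" "\<And>s. \<beta> < ereal s \<Longrightarrow> ereal s < \<Omega> \<Longrightarrow> Q s" for Q \<beta>
    unfolding eventually_filtercomap eventually_at_left[OF \<alpha>]
    by (rule exI[of _ "\<lambda>u. \<forall>s. u = ereal s \<longrightarrow> Q s"]) (use that in auto)
  have nt: "?F \<noteq> bot"
  proof -
    have "\<exists>s. R (ereal s)" if R: "eventually R (at_left \<Omega>)" for R
    proof -
      obtain \<beta> where \<beta>: "\<beta> < \<Omega>" "\<And>y. \<beta> < y \<Longrightarrow> y < \<Omega> \<Longrightarrow> R y"
        using R eventually_at_left[OF \<alpha>] by blast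
      obtain s where "\<beta> < ereal s" "ereal s < \<Omega>" using ereal_dense2[OF \<beta>(1)] by blast
      then show ?thesis using \<beta> by blast
    qed
    then show ?thesis unfolding trivial_limit_def eventually_filtercomap by blast
  qed
  have mono: "?f s \<le> ?f s'" if "s \<in> ?I" "s' \<in> ?I" "s \<le> s'" for s s'
  proof (cases "s = s'")
    case False
    then have "d (c s) (c s') < s' - s" using that C_plus_less[OF c] by auto
    then show ?thesis using d_triangle[of x "c s'" "c s"] by simp
  qed simp
  have "(?f \<longlongrightarrow> (SUP s\<in>?I. ?f s)) ?F"
  proof (rule order_tendstoI)
    fix a assume "a < (SUP s\<in>?I. ?f s)"
    then have "\<exists>s\<in>?I. a < ?f s" by (simp only: less_SUP_iff)
    then obtain s where s: "s \<in> ?I" "a < ?f s" ..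
    show "\<forall>\<^sub>F s in ?F. a < ?f s"
    proof (rule ev[of "ereal s"])
      show "ereal s < \<Omega>" using s by simp
      fix s' assume "ereal s < ereal s'" "ereal s' < \<Omega>"
      then show "a < ?f s'" using mono[of s s'] s by (auto intro: less_le_trans)
    qed
  next
    fix a assume a: "(SUP s\<in>?I. ?f s) < a"
    show "\<forall>\<^sub>F s in ?F. ?f s < a"
    proof (rule ev[of "ereal \<alpha>", OF \<alpha>])
      fix s' assume "ereal \<alpha> < ereal s'" "ereal s' < \<Omega>"
      then have "?f s' \<le> (SUP s\<in>?I. ?f s)" by (intro SUP_upper) auto
      then show "?f s' < a" using a by (rule le_less_trans)
    qed
  qed
  then show ?thesis unfolding busemann_def by (rule tendsto_Lim[OF nt])
qed

text \<open>Forwards, \<open>P(b)\<close> is the increasing union of the pasts of the points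
  \<open>(s, c s)\<close>, hence directed. Backwards, a chain generating the IP is joined by a curve
  in \<open>C_plus\<close>; every point of this curve precedes a point of the chain, so both have
  the same supremum \<open>b\<close>.\<close>

lemma B_plus_iff_IP: "b \<in> BB \<longleftrightarrow> IP A g0 \<omega> (busemann_past b)"
proof
  assume "b \<in> BB"
  then obtain \<alpha> \<Omega> c where c: "C_plus A g0 \<omega> \<alpha> \<Omega> c" and bc: "\<And>x. busemann A g0 \<omega> \<Omega> c x = ereal (b x)"
    unfolding B_plus_def by blast
  let ?I = "{s. \<alpha> \<le> s \<and> ereal s < \<Omega>}"
  have b: "ereal (b x) = (SUP s\<in>?I. ereal (s - d x (c s)))" for x
    using bc busemann_eq[OF c] by simp
  have \<alpha>: "ereal \<alpha> < \<Omega>" using c unfolding C_plus_def by blast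
  have later: "\<exists>s'\<in>?I. s < s'" if "s \<in> ?I" for s
  proof -
    obtain s' where "ereal s < ereal s'" "ereal s' < \<Omega>" using ereal_dense2[of "ereal s" \<Omega>] \<open>s \<in> ?I\<close> by auto
    then have "s' \<in> ?I" "s < s'" using that by auto
    then show ?thesis by blast
  qed
  have lt: "(s, c s) \<in> past (s', c s')" if "s \<in> ?I" "s' \<in> ?I" "s < s'" for s s'
    using C_plus_less[OF c, of s s'] that by (auto simp: mem_past)
  have P: "busemann_past b = (\<Union>s\<in>?I. past (s, c s))"
  proof -
    have "t < b x \<longleftrightarrow> (\<exists>s\<in>?I. t + d x (c s) < s)" for t x
    proof -
      have "t < b x \<longleftrightarrow> (\<exists>s\<in>?I. ereal t < ereal (s - d x (c s)))"
        using b[of x] less_SUP_iff[of "ereal t" "\<lambda>s. ereal (s - d x (c s))" ?I] by (metis less_ereal.simps(1))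
      then show ?thesis by (auto simp: algebra_simps)
    qed
    then show ?thesis unfolding busemann_past_def by (auto simp: mem_past)
  qed
  have memP: "(s, c s) \<in> busemann_past b" if "s \<in> ?I" for s
    using later[OF that] lt[OF that] unfolding P by blast
  show "IP A g0 \<omega> (busemann_past b)"
    unfolding IP_iff
  proof (intro conjI ballI)
    show "busemann_past b \<noteq> {}" using memP[of \<alpha>] \<alpha> by auto
    show "past p \<subseteq> busemann_past b" if "p \<in> busemann_past b" for p
      using that past_trans unfolding P by blast
    fix p q assume "p \<in> busemann_past b" "q \<in> busemann_past b"
    then obtain s s' where s: "s \<in> ?I" "p \<in> past (s, c s)" and s': "s' \<in> ?I" "q \<in> past (s', c s')"
      unfolding P by blast
    show "\<exists>r\<in>busemann_past b. p \<in> past r \<and> q \<in> past r"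
    proof (cases s s' rule: linorder_cases)
      case less
      then have "p \<in> past (s', c s')" using past_trans[OF s(2)] lt[OF s(1) s'(1)] by simp
      then show ?thesis using s'(2) memP[OF s'(1)] by blast
    next
      case equal
      then show ?thesis using s(2) s'(2) memP[OF s'(1)] by blast
    next
      case greater
      then have "q \<in> past (s, c s)" using past_trans[OF s'(2)] lt[OF s'(1) s(1)] by simp
      then show ?thesis using s(2) memP[OF s(1)] by blast
    qed
  qed
next
  assume ip: "IP A g0 \<omega> (busemann_past b)"
  obtain r where r: "\<And>n. r n \<in> busemann_past b" "\<And>n. r n \<in> past (r (Suc n))"
    "busemann_past b = (\<Union>n. past (r n))" using IP_chain[OF ip] by blast
  define T X where "T n = fst (r n)" and "X n = snd (r n)" for n
  have step: "T n + d (X n) (X (Suc n)) < T (Suc n)" for n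
    using r(2)[of n] unfolding mem_past T_def X_def .
  obtain c where c: "C_plus A g0 \<omega> (T 0) (SUP n. ereal (T n)) c" and cT: "\<And>n. c (T n) = X n"
    using C_plus_chain[of T X, OF step] by blast
  have Tmono: "strict_mono T"
  proof (rule strict_monoI_Suc)
    show "T n < T (Suc n)" for n using step[of n] d_nonneg[of "X n" "X (Suc n)"] by linarith
  qed
  let ?I = "{s. T 0 \<le> s \<and> ereal s < (SUP n. ereal (T n))}"
  have TI: "T n \<in> ?I" for n
  proof -
    have "ereal (T n) < ereal (T (Suc n))" using Tmono by (simp add: strict_mono_Suc_iff)
    also have "\<dots> \<le> (SUP n. ereal (T n))" by (rule SUP_upper) simp
    finally show ?thesis using Tmono by (auto simp: strict_mono_less_eq)
  qed
  have "(SUP s\<in>?I. ereal (s - d x (c s))) = ereal (b x)" for x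
  proof (rule antisym)
    show "(SUP s\<in>?I. ereal (s - d x (c s))) \<le> ereal (b x)"
    proof (rule SUP_least)
      fix s assume s: "s \<in> ?I"
      then obtain n where n: "s < T n" using less_SUP_iff[of "ereal s" "\<lambda>n. ereal (T n)" UNIV] by auto
      have "d (c s) (X n) < T n - s" using C_plus_less[OF c, of s "T n"] s n TI[of n] cT by auto
      moreover have "T n < b (X n)" using r(1)[of n] by (auto simp: busemann_past_def T_def X_def)
      moreover have "b (X n) - d x (X n) \<le> b x"
        using ip unfolding IP_busemann_past_iff is_lip_def by blast
      ultimately show "ereal (s - d x (c s)) \<le> ereal (b x)"
        using d_triangle[of x "X n" "c s"] by simp
    qed
    show "ereal (b x) \<le> (SUP s\<in>?I. ereal (s - d x (c s)))"
    proof (rule dense_le)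
      fix a assume a: "a < ereal (b x)"
      show "a \<le> (SUP s\<in>?I. ereal (s - d x (c s)))"
      proof (cases a)
        case (real t)
        then have "(t, x) \<in> busemann_past b" using a by (simp add: busemann_past_def)
        then obtain n where "(t, x) \<in> past (r n)" using r(3) by blast
        then have "t \<le> T n - d x (c (T n))" unfolding cT by (simp add: mem_past T_def X_def)
        then have "a \<le> ereal (T n - d x (c (T n)))" using real by simp
        also have "\<dots> \<le> (SUP s\<in>?I. ereal (s - d x (c s)))" by (rule SUP_upper[OF TI])
        finally show ?thesis .
      qed (use a in auto)
    qed
  qed
  then have "\<forall>x. busemann A g0 \<omega> (SUP n. ereal (T n)) c x = ereal (b x)"
    using busemann_eq[OF c] by simp
  then show "b \<in> BB" unfolding B_plus_def using c by blast
qed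

lemma IP_cases:
  assumes "IP A g0 \<omega> P"
  obtains "P = UNIV" | b where "b \<in> BB" "P = busemann_past b"
proof (cases "P = UNIV")
  case False
  have "past_set A g0 \<omega> P" using assms unfolding IP_def by (rule conjunct1)
  then obtain b where "P = busemann_past b" using past_set_repr False by blast
  then show ?thesis using assms B_plus_iff_IP that(2) by simp
qed (rule that(1))

lemma B_plus_lip: "b \<in> BB \<Longrightarrow> is_lip b"
  unfolding B_plus_iff_IP IP_busemann_past_iff by blast

text \<open>Translation in time preserves directedness; arguing with IPs avoids shifting the
  parameter of a generating curve.\<close>

lemma B_plus_shift:
  assumes "b \<in> BB"
  shows "(\<lambda>x. b x + k) \<in> BB"
proof -
  have b: "is_lip b" "\<And>x y s t. s < b x \<Longrightarrow> t < b y \<Longrightarrow> \<exists>r z. r < b z \<and> s + d x z < r \<and> t + d y z < r"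
    using assms unfolding B_plus_iff_IP IP_busemann_past_iff by blast+
  have "\<exists>r z. r < b z + k \<and> s + d x z < r \<and> t + d y z < r" if "s < b x + k" "t < b y + k" for x y s t
  proof -
    have "s - k < b x" "t - k < b y" using that by auto
    from b(2)[OF this] obtain r z where "r < b z" "s - k + d x z < r" "t - k + d y z < r" by blast
    then show ?thesis by (intro exI[of _ "r + k"] exI[of _ z]) auto
  qed
  moreover have "is_lip (\<lambda>x. b x + k)" using b(1) unfolding is_lip_def by (auto simp: algebra_simps)
  ultimately show ?thesis unfolding B_plus_iff_IP IP_busemann_past_iff by blast
qed

text \<open>The functions \<open>T n - d y (X n)\<close> bound the pasts of a chain exhausting
  \<open>P(b)\<close>, so they increase to \<open>b\<close>. Whether the points \<open>X n\<close>
  accumulate in \<open>M\<close> tells whether \<open>b\<close> comes from a point of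
  \<open>M\<close>.\<close>

lemma B_plus_chain:
  assumes "b \<in> BB"
  obtains T X where "\<And>n. T n < b (X n)" "incseq T" "\<And>y. (\<lambda>n. T n - d y (X n)) \<longlonglongrightarrow> b y"
proof -
  obtain r where r: "\<And>n. r n \<in> busemann_past b" "\<And>n. r n \<in> past (r (Suc n))"
    "busemann_past b = (\<Union>n. past (r n))" using IP_chain assms B_plus_iff_IP by blast
  define T X where "T n = fst (r n)" and "X n = snd (r n)" for n
  have step: "T n + d (X n) (X (Suc n)) < T (Suc n)" for n
    using r(2)[of n] unfolding mem_past T_def X_def .
  have T: "T n < b (X n)" for n using r(1)[of n] by (auto simp: busemann_past_def T_def X_def)
  have inc: "incseq T"
  proof (rule incseq_SucI)
    show "T n \<le> T (Suc n)" for n using step[of n] d_nonneg[of "X n" "X (Suc n)"] by linarith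
  qed
  have "(\<lambda>n. T n - d y (X n)) \<longlonglongrightarrow> b y" for y
  proof -
    have up: "T n - d y (X n) \<le> b y" for n
      using T[of n] B_plus_lip[OF assms] unfolding is_lip_def by (smt (verit))
    have mono: "incseq (\<lambda>n. T n - d y (X n))"
    proof (rule incseq_SucI)
      show "T n - d y (X n) \<le> T (Suc n) - d y (X (Suc n))" for n
        using step[of n] d_triangle[of y "X (Suc n)" "X n"] by linarith
    qed
    show ?thesis
    proof (rule order_tendstoI)
      fix a assume "a < b y"
      then obtain n where "(a, y) \<in> past (r n)" using r(3) by (auto simp: busemann_past_def)
      then have "a < T n - d y (X n)" by (simp add: mem_past T_def X_def)
      then show "\<forall>\<^sub>F n in sequentially. a < T n - d y (X n)"
        using mono unfolding eventually_sequentially incseq_def by (meson less_le_trans)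
    next
      fix a assume "b y < a"
      then show "\<forall>\<^sub>F n in sequentially. T n - d y (X n) < a"
        using up by (auto intro: always_eventually le_less_trans)
    qed
  qed
  then show ?thesis using that T inc by blast
qed

text \<open>Zorn's lemma is applied to the IPs inside \<open>P(h)\<close> that contain
  \<open>(t, x)\<close>. The past of a point \<open>(t', x)\<close> with \<open>t < t' < h x\<close>
  is one of them, and demanding \<open>(t, x)\<close> is what makes the maximal function reach the
  height \<open>t\<close>.\<close>

lemma exists_maximal:
  assumes h: "is_lip h" and t: "t < h x"
  shows "\<exists>b\<in>BB. b \<le> h \<and> t < b x \<and> (\<forall>g\<in>BB. b \<le> g \<longrightarrow> g \<le> h \<longrightarrow> g = b)"
proof -
  let ?S = "{Q. IP A g0 \<omega> Q \<and> Q \<subseteq> busemann_past h \<and> (t, x) \<in> Q}"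
  have "\<exists>M\<in>?S. \<forall>X\<in>?S. M \<subseteq> X \<longrightarrow> X = M"
  proof (rule subset_Zorn_nonempty)
    obtain t' where t': "t < t'" "t' < h x" using t dense by blast
    then have "(t', x) \<in> busemann_past h" "(t, x) \<in> past (t', x)"
      by (simp_all add: busemann_past_def mem_past)
    moreover from this(1) have "past (t', x) \<subseteq> busemann_past h" using h past_subset_iff_lip by blast
    ultimately have "past (t', x) \<in> ?S" using IP_past by simp
    then show "?S \<noteq> {}" by auto
    fix \<C> assume \<C>: "\<C> \<noteq> {}" "subset.chain ?S \<C>"
    then have "IP A g0 \<omega> (\<Union>\<C>)" by (intro IP_Union_chain) (auto simp: subset.chain_def)
    then show "\<Union>\<C> \<in> ?S" using \<C> unfolding subset.chain_def by blast
  qed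
  then obtain M where M: "M \<in> ?S" and max: "\<forall>X\<in>?S. M \<subseteq> X \<longrightarrow> X = M" ..
  then have "M \<noteq> UNIV" using busemann_past_neq_UNIV[of h] by auto
  then obtain b where b: "b \<in> BB" "M = busemann_past b" using IP_cases M(1) by (metis mem_Collect_eq)
  have "b \<le> h" "t < b x" using M(1) b busemann_past_subset by (auto simp: busemann_past_def)
  moreover have "g = b" if "g \<in> BB" "b \<le> g" "g \<le> h" for g
  proof -
    have "(t, x) \<in> busemann_past g" using that(2) M(1) b(2) busemann_past_subset[of b g] by auto
    then have "busemann_past g = M" using that b B_plus_iff_IP busemann_past_subset by (intro max[rule_format]) auto
    then show ?thesis using b busemann_past_inject by blast
  qed
  ultimately show ?thesis using b by blast
qed

section \<open>Chronological limits\<close>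

lemma B_limit_subseq:
  assumes r: "strict_mono r"
  shows "B_limit A g0 \<omega> \<sigma> \<subseteq> B_limit A g0 \<omega> (\<sigma> \<circ> r)"
proof
  fix f assume f: "f \<in> B_limit A g0 \<omega> \<sigma>"
  have lo: "liminf (\<lambda>n. ereal (\<sigma> n x)) \<le> liminf (\<lambda>n. ereal ((\<sigma> \<circ> r) n x))" for x
    using liminf_le_subseq[OF r, of "\<lambda>n. ereal (\<sigma> n x)"] by (simp add: comp_def)
  have up: "limsup (\<lambda>n. ereal ((\<sigma> \<circ> r) n x)) \<le> limsup (\<lambda>n. ereal (\<sigma> n x))" for x
    using limsup_subseq_le[OF r, of "\<lambda>n. ereal (\<sigma> n x)"] by (simp add: comp_def)
  show "f \<in> B_limit A g0 \<omega> (\<sigma> \<circ> r)"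
    using f order_trans[OF _ lo] order_trans[OF _ up] unfolding B_limit_def by blast
qed

lemma limsup_real: "h \<longlonglongrightarrow> (l::real) \<Longrightarrow> limsup (\<lambda>n. ereal (h n)) = ereal l"
  and liminf_real: "h \<longlonglongrightarrow> l \<Longrightarrow> liminf (\<lambda>n. ereal (h n)) = ereal l"
  by (intro lim_imp_Limsup lim_imp_Liminf; simp)+

lemma B_limit_pointwise:
  assumes "f \<in> BB" and "\<And>x. (\<lambda>n. \<sigma> n x) \<longlonglongrightarrow> f x"
  shows "f \<in> B_limit A g0 \<omega> \<sigma>"
proof -
  have "liminf (\<lambda>n. ereal (\<sigma> n x)) = ereal (f x)" "limsup (\<lambda>n. ereal (\<sigma> n x)) = ereal (f x)" for x
    using liminf_real limsup_real assms(2) by blast+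
  then show ?thesis
    using assms(1) unfolding B_limit_def by (auto simp: le_fun_def intro!: ext antisym)
qed

text \<open>For a convergent sequence \<open>liminf\<close> and \<open>limsup\<close> both equal
  \<open>h\<close>, so membership in \<open>B_limit\<close> reduces to maximality below
  \<open>h\<close>.\<close>

lemma B_limit_maximal:
  assumes "b \<in> BB" "b \<le> h" "\<And>g. g \<in> BB \<Longrightarrow> b \<le> g \<Longrightarrow> g \<le> h \<Longrightarrow> g = b"
    and "\<And>x. (\<lambda>n. \<sigma> n x) \<longlonglongrightarrow> h x"
  shows "b \<in> B_limit A g0 \<omega> \<sigma>"
proof -
  have "liminf (\<lambda>n. ereal (\<sigma> n x)) = ereal (h x)" "limsup (\<lambda>n. ereal (\<sigma> n x)) = ereal (h x)" for x
    using liminf_real limsup_real assms(4) by blast+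
  then show ?thesis
    using assms(1-3) unfolding B_limit_def by (auto simp: le_fun_def)
qed

section \<open>Equicontinuity, convergent subsequences and closures\<close>

lemma lip_near:
  assumes "0 < e"
  shows "\<exists>N. open N \<and> x \<in> N \<and> (\<forall>y\<in>N. \<forall>b. is_lip b \<longrightarrow> \<bar>b x - b y\<bar> < e)"
proof -
  obtain N where N: "open N" "x \<in> N" "\<forall>y\<in>N. d x y < e \<and> d y x < e"
    using d_small[OF assms, of x] by blast
  have "\<bar>b x - b y\<bar> < e" if "y \<in> N" "is_lip b" for y b
  proof -
    have "b y - d x y \<le> b x" "b x - d y x \<le> b y" "d x y < e" "d y x < e"
      using N(3) that unfolding is_lip_def by blast+
    then show ?thesis by linarith
  qed
  then show ?thesis using N by blast
qed

lemma lip_tendsto_moving: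
  assumes "\<And>n. is_lip (\<sigma> n)" "X \<longlonglongrightarrow> x" "(\<lambda>n. \<sigma> n x) \<longlonglongrightarrow> l"
  shows "(\<lambda>n. \<sigma> n (X n)) \<longlonglongrightarrow> l"
proof -
  have "(\<lambda>n. \<sigma> n x - \<sigma> n (X n)) \<longlonglongrightarrow> 0"
  proof (rule LIMSEQ_I)
    fix e :: real assume "0 < e"
    then obtain N where N: "open N" "x \<in> N" "\<forall>y\<in>N. \<forall>b. is_lip b \<longrightarrow> \<bar>b x - b y\<bar> < e"
      using lip_near by blast
    then have "\<forall>\<^sub>F n in sequentially. X n \<in> N" using assms(2) topological_tendstoD by blast
    then show "\<exists>no. \<forall>n\<ge>no. norm (\<sigma> n x - \<sigma> n (X n) - 0) < e"
      unfolding eventually_sequentially using N(3) assms(1) by auto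
  qed
  from tendsto_diff[OF assms(3) this] show ?thesis by simp
qed

text \<open>Fixed once and for all, so that countably many evaluations control the convergence of
  equicontinuous functions.\<close>

definition dense_seq :: "nat \<Rightarrow> 'm" where
  "dense_seq = (SOME e. \<forall>X. open X \<longrightarrow> X \<noteq> {} \<longrightarrow> (\<exists>i. e i \<in> X))"

lemma dense_seq: "open X \<Longrightarrow> X \<noteq> {} \<Longrightarrow> \<exists>i. dense_seq i \<in> X"
proof -
  obtain D :: "'m set" where D: "countable D" "\<And>X. open X \<Longrightarrow> X \<noteq> {} \<Longrightarrow> \<exists>q\<in>D. q \<in> X"
    using countable_dense_setE by blast
  have "D \<noteq> {}" using D(2)[of UNIV] by auto
  then have "range (from_nat_into D) = D" using D(1) by (rule range_from_nat_into)
  then have "\<forall>X. open X \<longrightarrow> X \<noteq> {} \<longrightarrow> (\<exists>i. from_nat_into D i \<in> X)" using D(2) by (metis imageE)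
  then have "\<forall>X. open X \<longrightarrow> X \<noteq> {} \<longrightarrow> (\<exists>i. dense_seq i \<in> X)"
    unfolding dense_seq_def by (rule someI[where P = "\<lambda>e. \<forall>X. open X \<longrightarrow> X \<noteq> {} \<longrightarrow> (\<exists>i. e i \<in> X)"])
  then show "open X \<Longrightarrow> X \<noteq> {} \<Longrightarrow> ?thesis" by blast
qed

lemma lip_near_dense:
  assumes "0 < e"
  shows "\<exists>i. \<forall>b. is_lip b \<longrightarrow> \<bar>b x - b (dense_seq i)\<bar> < e"
proof -
  obtain N where "open N" "x \<in> N" "\<forall>y\<in>N. \<forall>b. is_lip b \<longrightarrow> \<bar>b x - b y\<bar> < e"
    using lip_near[OF assms, of x] by blast
  then show ?thesis using dense_seq[of N] by blast
qed

lemma lip_convergent: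
  assumes "\<And>n. is_lip (\<sigma> n)" "\<And>i. convergent (\<lambda>n. \<sigma> n (dense_seq i))"
  shows "convergent (\<lambda>n. \<sigma> n x)"
proof (rule Cauchy_convergent, rule CauchyI)
  fix e :: real assume "0 < e"
  then obtain i where i: "\<And>b. is_lip b \<Longrightarrow> \<bar>b x - b (dense_seq i)\<bar> < e / 3"
    using lip_near_dense[of "e / 3" x] by auto
  obtain M where M: "\<And>m n. m \<ge> M \<Longrightarrow> n \<ge> M \<Longrightarrow> norm (\<sigma> m (dense_seq i) - \<sigma> n (dense_seq i)) < e / 3"
    using CauchyD[OF convergent_Cauchy[OF assms(2)], of "e / 3" i] \<open>0 < e\<close> by auto
  have "norm (\<sigma> m x - \<sigma> n x) < e" if "m \<ge> M" "n \<ge> M" for m n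
    using M[OF that] i[OF assms(1)[of m]] i[OF assms(1)[of n]] unfolding real_norm_def by linarith
  then show "\<exists>M. \<forall>m\<ge>M. \<forall>n\<ge>M. norm (\<sigma> m x - \<sigma> n x) < e" by blast
qed

lemma lip_limit:
  assumes "\<And>n. is_lip (\<sigma> n)" "\<And>x. (\<lambda>n. \<sigma> n x) \<longlonglongrightarrow> h x"
  shows "is_lip h"
  unfolding is_lip_def
proof (intro allI)
  fix x y
  have "(\<lambda>n. \<sigma> n y - d x y) \<longlonglongrightarrow> h y - d x y" by (intro tendsto_intros assms)
  then show "h y - d x y \<le> h x"
    by (rule LIMSEQ_le[OF _ assms(2)]) (use assms(1) in \<open>auto simp: is_lip_def\<close>)
qed

text \<open>Arzela-Ascoli for \<open>is_lip\<close> functions. Tychonoff's theorem is used on the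
  countable dense set only, because a product over \<open>nat\<close> is first countable, so that
  compactness yields convergent subsequences.\<close>

lemma lip_subseq:
  assumes lip: "\<And>n. is_lip (\<sigma> n)" and bd: "\<And>n. \<bar>\<sigma> n x0\<bar> \<le> C"
  obtains r h where "strict_mono (r :: nat \<Rightarrow> nat)" "\<And>x. (\<lambda>n. \<sigma> (r n) x) \<longlonglongrightarrow> h x"
proof -
  let ?K = "\<lambda>i. {- (C + d (dense_seq i) x0 + d x0 (dense_seq i))..C + d (dense_seq i) x0 + d x0 (dense_seq i)}"
  let ?s = "\<lambda>n i. \<sigma> n (dense_seq i)"
  have "\<sigma> n y \<in> {- (C + d y x0 + d x0 y)..C + d y x0 + d x0 y}" for n y
  proof -
    have "\<sigma> n y - d x0 y \<le> \<sigma> n x0" "\<sigma> n x0 - d y x0 \<le> \<sigma> n y"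
      using lip[of n] unfolding is_lip_def by blast+
    then show ?thesis using bd[of n] d_nonneg[of x0 y] d_nonneg[of y x0] by (simp add: abs_le_iff)
  qed
  then have mem: "\<forall>n. ?s n \<in> Pi\<^sub>E UNIV ?K" by (simp add: PiE_def Pi_def)
  have "compact (Pi\<^sub>E UNIV ?K)" by (rule compact_PiE_UNIV) simp
  then have "seq_compact (Pi\<^sub>E UNIV ?K)" by (rule compact_imp_seq_compact)
  then obtain l r where r: "strict_mono r" "(?s \<circ> r) \<longlonglongrightarrow> l" using mem by (rule seq_compactE)
  have "convergent (\<lambda>n. \<sigma> (r n) (dense_seq i))" for i
    using r(2) unfolding tendsto_fun_iff by (auto simp: convergent_def)
  then have "convergent (\<lambda>n. \<sigma> (r n) x)" for x by (rule lip_convergent[OF lip])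
  then have "(\<lambda>n. \<sigma> (r n) x) \<longlonglongrightarrow> lim (\<lambda>n. \<sigma> (r n) x)" for x by (simp add: convergent_LIMSEQ_iff)
  with r(1) show ?thesis by (rule that)
qed

text \<open>Being within \<open>1 / real (Suc n)\<close> of \<open>f\<close> at the dense points of
  index at most \<open>n\<close> is an open condition, hence met by some member of \<open>S\<close>;
  equicontinuity then spreads the convergence from the dense points to all of
  \<open>M\<close>.\<close>

lemma lip_closure_sequence:
  assumes S: "\<And>b. b \<in> S \<Longrightarrow> is_lip b" and f: "f \<in> closure S"
  obtains \<sigma> where "range \<sigma> \<subseteq> S" "\<And>x. (\<lambda>n. \<sigma> n x) \<longlonglongrightarrow> f x" "is_lip f"
proof -
  have "continuous_on UNIV (\<lambda>b :: 'm \<Rightarrow> real. b y - d x y)" "continuous_on UNIV (\<lambda>b :: 'm \<Rightarrow> real. b x)" for x y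
    by (intro continuous_intros continuous_on_product_coordinates)+
  then have "closed {b :: 'm \<Rightarrow> real. b y - d x y \<le> b x}" for x y by (rule closed_Collect_le)
  then have "closed (\<Inter>x. \<Inter>y. {b :: 'm \<Rightarrow> real. b y - d x y \<le> b x})" by blast
  then have "closure S \<subseteq> (\<Inter>x. \<Inter>y. {b :: 'm \<Rightarrow> real. b y - d x y \<le> b x})"
    using S by (intro closure_minimal) (auto simp: is_lip_def)
  then have lipf: "is_lip f" using f unfolding is_lip_def by blast
  have "\<exists>b\<in>S. \<forall>i\<le>n. \<bar>b (dense_seq i) - f (dense_seq i)\<bar> < 1 / real (Suc n)" for n
  proof -
    let ?U = "\<Inter>i\<in>{..n}. {b :: 'm \<Rightarrow> real. \<bar>b (dense_seq i) - f (dense_seq i)\<bar> < 1 / real (Suc n)}"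
    have "open ?U" by (intro open_INT finite_atMost ballI open_Collect_less continuous_intros
          continuous_on_product_coordinates)
    moreover have "f \<in> ?U" by simp
    ultimately have "?U \<inter> S \<noteq> {}" using f open_Int_closure_eq_empty by blast
    then show ?thesis by blast
  qed
  then obtain \<sigma> where \<sigma>: "\<And>n. \<sigma> n \<in> S"
    "\<And>n i. i \<le> n \<Longrightarrow> \<bar>\<sigma> n (dense_seq i) - f (dense_seq i)\<bar> < 1 / real (Suc n)" by metis
  have "(\<lambda>n. \<sigma> n x) \<longlonglongrightarrow> f x" for x
  proof (rule LIMSEQ_I)
    fix e :: real assume "0 < e"
    then obtain i where i: "\<And>b. is_lip b \<Longrightarrow> \<bar>b x - b (dense_seq i)\<bar> < e / 3"
      using lip_near_dense[of "e / 3" x] by auto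
    obtain M where M: "1 / real (Suc M) < e / 3" using nat_approx_posE \<open>0 < e\<close> by (metis divide_pos_pos zero_less_numeral)
    have "norm (\<sigma> n x - f x) < e" if "n \<ge> max M i" for n
    proof -
      have "1 / real (Suc n) \<le> 1 / real (Suc M)" using that by (simp add: frac_le)
      then have "\<bar>\<sigma> n (dense_seq i) - f (dense_seq i)\<bar> < e / 3" using \<sigma>(2)[of i n] that M by simp
      then show ?thesis using i[OF S[OF \<sigma>(1)[of n]]] i[OF lipf] unfolding real_norm_def by linarith
    qed
    then show "\<exists>no. \<forall>n\<ge>no. norm (\<sigma> n x - f x) < e" by blast
  qed
  then show ?thesis using that \<sigma>(1) lipf by blast
qed

section \<open>The quotient \<open>M_B\<close> and the comparison of the two chronological
  limits\<close>

lemma topspace_B: "topspace (B_topology A g0 \<omega>) = BB"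
proof
  show "topspace (B_topology A g0 \<omega>) \<subseteq> BB"
    using openin_topspace[of "B_topology A g0 \<omega>"] unfolding openin_B_topology by blast
  have "openin (B_topology A g0 \<omega>) BB" unfolding openin_B_topology by (auto simp: B_limit_def)
  then show "BB \<subseteq> topspace (B_topology A g0 \<omega>)" by (rule openin_subset)
qed

lemma openin_M_B: "openin (M_B A g0 \<omega>) U \<longleftrightarrow>
    U \<subseteq> cls ` BB \<and> openin (B_topology A g0 \<omega>) {b \<in> BB. cls b \<in> U}"
  unfolding M_B_def openin_quotient_topology topspace_B ..

lemma topspace_M_B: "topspace (M_B A g0 \<omega>) = cls ` BB"
proof
  show "topspace (M_B A g0 \<omega>) \<subseteq> cls ` BB"
    using openin_topspace[of "M_B A g0 \<omega>"] unfolding openin_M_B by blast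
  have "{b \<in> BB. cls b \<in> cls ` BB} = topspace (B_topology A g0 \<omega>)" unfolding topspace_B by blast
  then have "openin (M_B A g0 \<omega>) (cls ` BB)" unfolding openin_M_B by (metis openin_topspace order_refl)
  then show "cls ` BB \<subseteq> topspace (M_B A g0 \<omega>)" by (rule openin_subset)
qed

lemma mem_cls: "b \<in> BB \<Longrightarrow> b \<in> cls b"
  unfolding B_class_def by (auto intro: exI[of _ 0])

lemma cls_eq_iff: "b \<in> BB \<Longrightarrow> cls f = cls b \<longleftrightarrow> (\<exists>k. \<forall>x. b x = f x + k)"
proof
  assume b: "b \<in> BB"
  show "cls f = cls b \<Longrightarrow> \<exists>k. \<forall>x. b x = f x + k" using mem_cls[OF b] unfolding B_class_def by blast
  assume "\<exists>k. \<forall>x. b x = f x + k"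
  then obtain k where k: "\<And>x. b x = f x + k" by blast
  have "(\<exists>l. \<forall>x. g x = f x + l) \<longleftrightarrow> (\<exists>l. \<forall>x. g x = b x + l)" for g
  proof
    assume "\<exists>l. \<forall>x. g x = f x + l"
    then obtain l where "\<forall>x. g x = f x + l" ..
    then have "\<forall>x. g x = b x + (l - k)" using k by simp
    then show "\<exists>l. \<forall>x. g x = b x + l" ..
  next
    assume "\<exists>l. \<forall>x. g x = b x + l"
    then obtain l where "\<forall>x. g x = b x + l" ..
    then have "\<forall>x. g x = f x + (k + l)" using k by simp
    then show "\<exists>l. \<forall>x. g x = f x + l" ..
  qed
  then show "cls f = cls b" unfolding B_class_def by blast
qed

text \<open>Turns chronological limits into topological limits of classes, to which the Hausdorff
  property can be applied.\<close>

lemma limitin_M_B: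
  assumes "range \<sigma> \<subseteq> BB" "f \<in> B_limit A g0 \<omega> \<sigma>"
  shows "limitin (M_B A g0 \<omega>) (\<lambda>n. cls (\<sigma> n)) (cls f) sequentially"
  unfolding limitin_def
proof (intro conjI allI impI)
  have f: "f \<in> BB" using assms(2) unfolding B_limit_def by blast
  then show "cls f \<in> topspace (M_B A g0 \<omega>)" unfolding topspace_M_B by blast
  fix U assume U: "openin (M_B A g0 \<omega>) U \<and> cls f \<in> U"
  then have "openin (B_topology A g0 \<omega>) {b \<in> BB. cls b \<in> U}" unfolding openin_M_B by simp
  then have "B_limit A g0 \<omega> \<tau> \<subseteq> BB - {b \<in> BB. cls b \<in> U}"
    if "range \<tau> \<subseteq> BB - {b \<in> BB. cls b \<in> U}" for \<tau>
    using that unfolding openin_B_topology by simp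
  from openin_limit_topology_sequence[of BB _ "B_limit A g0 \<omega>", OF this B_limit_subseq assms]
  have "\<forall>\<^sub>F n in sequentially. \<sigma> n \<in> {b \<in> BB. cls b \<in> U}" using f U by simp
  then show "\<forall>\<^sub>F n in sequentially. cls (\<sigma> n) \<in> U" by (rule eventually_mono) simp
qed

lemma busemann_past_in_IP_limit_iff:
  assumes f: "f \<in> BB"
  shows "busemann_past f \<in> IP_limit A g0 \<omega> (\<lambda>n. busemann_past (\<sigma> n)) \<longleftrightarrow> f \<in> B_limit A g0 \<omega> \<sigma>"
proof
  assume P: "busemann_past f \<in> IP_limit A g0 \<omega> (\<lambda>n. busemann_past (\<sigma> n))"
  have "g = f" if "g \<in> BB" "f \<le> g" "\<forall>x. ereal (g x) \<le> limsup (\<lambda>n. ereal (\<sigma> n x))" for g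
  proof -
    have "IP A g0 \<omega> (busemann_past g)" using that(1) B_plus_iff_IP by simp
    moreover have "busemann_past f \<subseteq> busemann_past g" using that(2) by (simp add: busemann_past_subset)
    moreover have "busemann_past g \<subseteq> limsup (\<lambda>n. busemann_past (\<sigma> n))"
      using that(3) by (simp add: busemann_past_subset_limsup)
    ultimately have "busemann_past g = busemann_past f" using P unfolding IP_limit_def by simp
    then show "g = f" by (simp only: busemann_past_inject)
  qed
  moreover have "\<forall>x. ereal (f x) \<le> liminf (\<lambda>n. ereal (\<sigma> n x))"
    using P unfolding IP_limit_def busemann_past_subset_liminf[symmetric] by simp
  ultimately show "f \<in> B_limit A g0 \<omega> \<sigma>" using f unfolding B_limit_def by simp
next
  assume l: "f \<in> B_limit A g0 \<omega> \<sigma>"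
  then have lo: "busemann_past f \<subseteq> liminf (\<lambda>n. busemann_past (\<sigma> n))"
    unfolding busemann_past_subset_liminf B_limit_def by simp
  moreover have "liminf (\<lambda>n. busemann_past (\<sigma> n)) \<subseteq> limsup (\<lambda>n. busemann_past (\<sigma> n))"
    by (rule Liminf_le_Limsup) simp
  ultimately have up: "busemann_past f \<subseteq> limsup (\<lambda>n. busemann_past (\<sigma> n))" by (rule order_trans)
  have max: "g = f" if "g \<in> BB" "f \<le> g" "busemann_past g \<subseteq> limsup (\<lambda>n. busemann_past (\<sigma> n))" for g
    using l that unfolding B_limit_def busemann_past_subset_limsup by simp
  have "Q = busemann_past f"
    if Q: "IP A g0 \<omega> Q" "busemann_past f \<subseteq> Q" "Q \<subseteq> limsup (\<lambda>n. busemann_past (\<sigma> n))" for Q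
    using Q(1)
  proof (cases rule: IP_cases)
    \<comment> \<open>The competitor \<open>V\<close> has no counterpart in \<open>B_plus\<close>.
      If it lay in the upper limit, so would the region below \<open>f + 1\<close>, against the
      maximality of \<open>f\<close>.\<close>
    case 1
    then have "busemann_past (\<lambda>x. f x + 1) \<subseteq> limsup (\<lambda>n. busemann_past (\<sigma> n))" using Q(3) by blast
    then have "(\<lambda>x. f x + 1) = f" by (intro max B_plus_shift f) (simp_all add: le_fun_def)
    then have "f undefined + 1 = f undefined" by (rule fun_cong)
    then show ?thesis by simp
  next
    case (2 g)
    then show ?thesis using max[of g] Q(2,3) by (simp add: busemann_past_subset)
  qed
  moreover have "IP A g0 \<omega> (busemann_past f)" using f B_plus_iff_IP by simp
  ultimately show "busemann_past f \<in> IP_limit A g0 \<omega> (\<lambda>n. busemann_past (\<sigma> n))"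
    using lo up unfolding IP_limit_def by simp
qed

end

locale fermat_causality_Hausdorff = fermat_causality A g0 \<omega>
  for A :: "('m::{t2_space, second_countable_topology}, 'e::euclidean_space) chart set"
    and g0 :: "'m \<Rightarrow> ('m, 'e) tvec \<Rightarrow> ('m, 'e) tvec \<Rightarrow> real"
    and \<omega> :: "'m \<Rightarrow> ('m, 'e) tvec \<Rightarrow> real" +
  assumes Hausdorff: "Hausdorff_space (M_B A g0 \<omega>)"
begin

text \<open>If the chronological limit were not the pointwise one, a maximal Busemann function below
  the limit of a subsequence would exceed it by a constant, in contradiction with maximality.\<close>

lemma B_limit_imp_pointwise:
  assumes \<sigma>: "range \<sigma> \<subseteq> BB" and f: "f \<in> B_limit A g0 \<omega> \<sigma>"
  shows "(\<lambda>n. \<sigma> n x) \<longlonglongrightarrow> f x"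
proof (rule ccontr)
  assume nc: "\<not> (\<lambda>n. \<sigma> n x) \<longlonglongrightarrow> f x"
  have fB: "f \<in> BB" and fmax: "\<And>\<tau> g. f \<in> B_limit A g0 \<omega> \<tau> \<Longrightarrow> g \<in> BB \<Longrightarrow> f \<le> g \<Longrightarrow>
      (\<And>x. ereal (g x) \<le> limsup (\<lambda>n. ereal (\<tau> n x))) \<Longrightarrow> g = f"
    using f unfolding B_limit_def by blast+
  have lower: "\<forall>\<^sub>F n in sequentially. a < \<sigma> n x" if "a < f x" for a
  proof -
    have "ereal a < liminf (\<lambda>n. ereal (\<sigma> n x))"
      using f that unfolding B_limit_def by (auto intro: less_le_trans[of "ereal a" "ereal (f x)"])
    then have "\<forall>\<^sub>F n in sequentially. ereal a < ereal (\<sigma> n x)" by (rule less_LiminfD)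
    then show ?thesis by simp
  qed
  \<comment> \<open>The lower estimate is part of being a chronological limit, so failure of
    convergence means exceeding \<open>f x\<close> by a fixed amount infinitely often.\<close>
  obtain u where u: "f x < u" "\<exists>\<^sub>F n in sequentially. u \<le> \<sigma> n x"
    using nc lower unfolding order_tendsto_iff frequently_def not_le by auto
  from u(2) obtain r :: "nat \<Rightarrow> nat" where r: "strict_mono r" "\<And>n. u \<le> \<sigma> (r n) x"
    by (rule frequently_subseq) blast
  define \<tau> where "\<tau> = \<sigma> \<circ> r"
  have f\<tau>: "f \<in> B_limit A g0 \<omega> \<tau>" using B_limit_subseq[OF r(1)] f unfolding \<tau>_def by blast
  have \<tau>B: "\<tau> n \<in> BB" and \<tau>u: "u \<le> \<tau> n x" for n using \<sigma> r(2) unfolding \<tau>_def by auto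
  show False
  proof (cases "\<exists>C. \<exists>\<^sub>F n in sequentially. \<tau> n x \<le> C")
    case True
    then obtain C where "\<exists>\<^sub>F n in sequentially. \<tau> n x \<le> C" by blast
    then obtain p :: "nat \<Rightarrow> nat" where p: "strict_mono p" "\<And>n. \<tau> (p n) x \<le> C"
      by (rule frequently_subseq) blast
    have "\<bar>\<tau> (p n) x\<bar> \<le> \<bar>u\<bar> + \<bar>C\<bar>" for n using \<tau>u[of "p n"] p(2)[of n] by linarith
    then obtain q h where q: "strict_mono q" and h: "\<And>y. (\<lambda>n. \<tau> (p (q n)) y) \<longlonglongrightarrow> h y"
      using lip_subseq[of "\<lambda>n. \<tau> (p n)" x "\<bar>u\<bar> + \<bar>C\<bar>"] B_plus_lip[OF \<tau>B] by blast
    define \<rho> where "\<rho> = \<tau> \<circ> (p \<circ> q)"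
    have h: "(\<lambda>n. \<rho> n y) \<longlonglongrightarrow> h y" for y using h[of y] by (simp add: \<rho>_def)
    have "strict_mono (p \<circ> q)" using p(1) q by (simp add: strict_mono_o)
    then have f\<rho>: "f \<in> B_limit A g0 \<omega> \<rho>" using B_limit_subseq f\<tau> unfolding \<rho>_def by blast
    have \<rho>B: "\<rho> n \<in> BB" for n using \<tau>B unfolding \<rho>_def by simp
    have "u \<le> h x" using h[of x] by (rule LIMSEQ_le_const) (use \<tau>u in \<open>auto simp: \<rho>_def\<close>)
    then have "f x < h x" using u(1) by simp
    moreover have "is_lip h" using lip_limit[of \<rho> h] h B_plus_lip[OF \<rho>B] by blast
    ultimately obtain b where b: "b \<in> BB" "b \<le> h" "f x < b x"
      "\<And>g. g \<in> BB \<Longrightarrow> b \<le> g \<Longrightarrow> g \<le> h \<Longrightarrow> g = b"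
      using exists_maximal[of h "f x" x] by blast
    have b\<rho>: "b \<in> B_limit A g0 \<omega> \<rho>" by (rule B_limit_maximal[OF b(1,2) b(4) h])
    have "range \<rho> \<subseteq> BB" using \<rho>B by blast
    from limitin_M_B[OF this f\<rho>] limitin_M_B[OF this b\<rho>] have "cls f = cls b"
      by (rule limitin_Hausdorff_unique) (simp_all add: Hausdorff)
    then obtain k where k: "\<And>y. b y = f y + k" using cls_eq_iff[OF b(1)] by blast
    have "f \<le> b" using k b(3) k[of x] by (auto simp: le_fun_def)
    moreover have "ereal (b y) \<le> limsup (\<lambda>n. ereal (\<rho> n y))" for y
      using limsup_real[OF h[of y]] b(2) by (simp add: le_fun_def)
    ultimately have "b = f" using fmax[OF f\<rho> b(1)] by blast
    then show False using b(3) by simp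
  next
    \<comment> \<open>Now the values tend to infinity at every point, which makes
      \<open>f + 1\<close> an admissible competitor of \<open>f\<close>.\<close>
    case False
    then have inf: "\<forall>\<^sub>F n in sequentially. C < \<tau> n x" for C by (auto simp: frequently_def not_le)
    have "limsup (\<lambda>n. ereal (\<tau> n y)) = \<infinity>" for y
    proof -
      have "(\<lambda>n. ereal (\<tau> n y)) \<longlonglongrightarrow> \<infinity>"
        unfolding tendsto_PInfty
      proof
        fix C
        have "\<tau> n x - d y x \<le> \<tau> n y" for n using B_plus_lip[OF \<tau>B[of n]] unfolding is_lip_def by blast
        then have "C < \<tau> n y" if "C + d y x < \<tau> n x" for n using that by (smt (verit))
        then show "\<forall>\<^sub>F n in sequentially. ereal C < ereal (\<tau> n y)"
          using inf[of "C + d y x"] by (auto elim: eventually_mono)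
      qed
      then show ?thesis by (intro lim_imp_Limsup) simp
    qed
    then have "(\<lambda>y. f y + 1) = f" by (intro fmax[OF f\<tau> B_plus_shift[OF fB]]) (auto simp: le_fun_def)
    then have "f x + 1 = f x" by (rule fun_cong)
    then show False by simp
  qed
qed

text \<open>Pointwise closed sets contain their chronological limits by
  \<open>B_limit_imp_pointwise\<close>. Conversely, pointwise limits in \<open>B_plus\<close> are
  chronological limits, and by \<open>lip_closure_sequence\<close> sequences suffice to describe
  pointwise closures.\<close>

lemma B_topology_eq: "B_topology A g0 \<omega> = top_of_set BB"
  unfolding topology_eq
proof (intro allI iffI)
  fix U assume U: "openin (top_of_set BB) U"
  then obtain T where T: "open T" "U = BB \<inter> T" unfolding openin_open by blast
  show "openin (B_topology A g0 \<omega>) U"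
    unfolding openin_B_topology
  proof (intro conjI allI impI subsetI)
    show "f \<in> BB" if "f \<in> U" for f using that T(2) by blast
    fix \<sigma> f assume \<sigma>: "range \<sigma> \<subseteq> BB - U" and f: "f \<in> B_limit A g0 \<omega> \<sigma>"
    have "\<sigma> \<longlonglongrightarrow> f" unfolding tendsto_fun_iff using B_limit_imp_pointwise \<sigma> f by blast
    then have "f \<notin> T" using topological_tendstoD[OF _ T(1)] \<sigma> T(2)
      by (fastforce simp: eventually_sequentially)
    then show "f \<in> BB - U" using f T(2) unfolding B_limit_def by blast
  qed
next
  fix U assume U: "openin (B_topology A g0 \<omega>) U"
  have "f \<notin> closure (BB - U)" if fU: "f \<in> U" for f
  proof
    assume "f \<in> closure (BB - U)"
    from _ this obtain \<sigma> where \<sigma>: "range \<sigma> \<subseteq> BB - U" "\<And>x. (\<lambda>n. \<sigma> n x) \<longlonglongrightarrow> f x"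
      by (rule lip_closure_sequence) (blast intro: B_plus_lip)+
    have "f \<in> BB" using U fU unfolding openin_B_topology by blast
    then have "f \<in> B_limit A g0 \<omega> \<sigma>" using B_limit_pointwise \<sigma>(2) by blast
    then show False using U \<sigma>(1) fU unfolding openin_B_topology by blast
  qed
  moreover have "U \<subseteq> BB" using U unfolding openin_B_topology by blast
  ultimately have "U = BB \<inter> - closure (BB - U)" using closure_subset[of "BB - U"] by blast
  then show "openin (top_of_set BB) U" unfolding openin_open by blast
qed

text \<open>A single maximal Busemann function below \<open>h\<close> is enough: it is a
  chronological limit of \<open>\<sigma>\<close>, hence the pointwise limit, hence \<open>h\<close>
  itself.\<close>

lemma pointwise_limit_in_B_plus:
  assumes \<sigma>: "range \<sigma> \<subseteq> BB" and h: "\<And>x. (\<lambda>n. \<sigma> n x) \<longlonglongrightarrow> h x"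
  shows "h \<in> BB"
proof -
  have "is_lip (\<sigma> n)" for n using \<sigma> by (intro B_plus_lip) blast
  then have "is_lip h" using h by (rule lip_limit)
  then obtain b where b: "b \<in> BB" "b \<le> h" "\<And>g. g \<in> BB \<Longrightarrow> b \<le> g \<Longrightarrow> g \<le> h \<Longrightarrow> g = b"
    using exists_maximal[of h "h undefined - 1" undefined] by auto
  have "b \<in> B_limit A g0 \<omega> \<sigma>" by (rule B_limit_maximal[OF b h])
  then have "b x = h x" for x using LIMSEQ_unique[OF B_limit_imp_pointwise[OF \<sigma>] h] by blast
  then have "b = h" by blast
  then show ?thesis using b(1) by simp
qed

lemma closed_B_plus: "closed BB"
  unfolding closure_subset_eq[symmetric]
proof
  fix f assume "f \<in> closure BB"
  with B_plus_lip obtain \<sigma> where "range \<sigma> \<subseteq> BB" "\<And>x. (\<lambda>n. \<sigma> n x) \<longlonglongrightarrow> f x"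
    by (rule lip_closure_sequence) blast+
  then show "f \<in> BB" by (rule pointwise_limit_in_B_plus)
qed

text \<open>The normalization and \<open>is_lip\<close> confine each value to a compact interval, so
  Tychonoff's theorem and the closedness of \<open>B_plus\<close> apply.\<close>

lemma compact_normalized: "compact {b \<in> BB. b x0 = 0}"
proof -
  let ?K = "Pi\<^sub>E UNIV (\<lambda>x. {- d x x0..d x0 x})"
  have "compact ?K" by (rule compact_PiE_UNIV) simp
  moreover have "{b \<in> BB. b x0 = 0} = ?K \<inter> (BB \<inter> {b. b x0 = 0})"
  proof -
    have "b \<in> ?K" if "b \<in> BB" "b x0 = 0" for b
    proof -
      have "- d x x0 \<le> b x \<and> b x \<le> d x0 x" for x
      proof -
        have "b x - d x0 x \<le> b x0" "b x0 - d x x0 \<le> b x"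
          using B_plus_lip[OF that(1)] unfolding is_lip_def by blast+
        then show ?thesis using that(2) by simp
      qed
      then show ?thesis by (simp add: PiE_def Pi_def)
    qed
    then show ?thesis by blast
  qed
  moreover have "closed {b :: 'm \<Rightarrow> real. b x0 = 0}"
    by (intro closed_Collect_eq continuous_intros continuous_on_product_coordinates)
  ultimately show ?thesis by (simp only: compact_Int_closed closed_Int closed_B_plus)
qed

text \<open>The neighbourhoods of \<open>V\<close> can be tested at an arbitrary point
  \<open>x0\<close>, since \<open>is_lip\<close> spreads divergence to infinity from one point to
  all others.\<close>

lemma openin_future_completion_iff:
  "openin (future_completion A g0 \<omega>) U \<longleftrightarrow> U \<subseteq> Collect (IP A g0 \<omega>) \<and>
     openin (top_of_set BB) {b \<in> BB. busemann_past b \<in> U} \<and>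
     (UNIV \<in> U \<longrightarrow> (\<exists>K. \<forall>b\<in>BB. K < b x0 \<longrightarrow> busemann_past b \<in> U))"
  (is "?l \<longleftrightarrow> ?r")
proof
  assume l: ?l
  then have U: "U \<subseteq> Collect (IP A g0 \<omega>)"
    and lim: "\<And>\<sigma>. range \<sigma> \<subseteq> Collect (IP A g0 \<omega>) - U \<Longrightarrow> IP_limit A g0 \<omega> \<sigma> \<subseteq> Collect (IP A g0 \<omega>) - U"
    unfolding openin_future_completion by simp_all
  have range: "range (\<lambda>n. busemann_past (\<sigma> n)) \<subseteq> Collect (IP A g0 \<omega>) - U"
    if "\<And>n. \<sigma> n \<in> BB" "\<And>n. busemann_past (\<sigma> n) \<notin> U" for \<sigma>
    using that B_plus_iff_IP by auto
  have "openin (B_topology A g0 \<omega>) {b \<in> BB. busemann_past b \<in> U}"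
    unfolding openin_B_topology
  proof (intro conjI allI impI subsetI)
    fix \<sigma> f assume \<sigma>: "range \<sigma> \<subseteq> BB - {b \<in> BB. busemann_past b \<in> U}" and f: "f \<in> B_limit A g0 \<omega> \<sigma>"
    have fB: "f \<in> BB" using f unfolding B_limit_def by simp
    have "\<sigma> n \<in> BB \<and> busemann_past (\<sigma> n) \<notin> U" for n using \<sigma> by blast
    then have "range (\<lambda>n. busemann_past (\<sigma> n)) \<subseteq> Collect (IP A g0 \<omega>) - U" by (intro range) auto
    from lim[OF this] busemann_past_in_IP_limit_iff[OF fB, of \<sigma>] f
    show "f \<in> BB - {b \<in> BB. busemann_past b \<in> U}" using fB by auto
  qed auto
  \<comment> \<open>Otherwise there are functions with \<open>P(b)\<close> outside \<open>U\<close>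
    whose values at \<open>x0\<close> exceed every \<open>n\<close>, and their pasts have
    \<open>V\<close> as a limit.\<close>
  moreover have "\<exists>K. \<forall>b\<in>BB. K < b x0 \<longrightarrow> busemann_past b \<in> U" if "UNIV \<in> U"
  proof (rule ccontr)
    assume "\<not> ?thesis"
    then have "\<forall>n. \<exists>b. b \<in> BB \<and> real n < b x0 \<and> busemann_past b \<notin> U" by blast
    then obtain \<sigma> where \<sigma>: "\<And>n. \<sigma> n \<in> BB" "\<And>n. real n < \<sigma> n x0" "\<And>n. busemann_past (\<sigma> n) \<notin> U" by metis
    have "p \<in> liminf (\<lambda>n. busemann_past (\<sigma> n))" for p
    proof -
      obtain N :: nat where N: "fst p + d (snd p) x0 < real N" using reals_Archimedean2 by blast
      have "p \<in> busemann_past (\<sigma> n)" if "N \<le> n" for n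
      proof -
        have "\<sigma> n x0 - d (snd p) x0 \<le> \<sigma> n (snd p)" using B_plus_lip[OF \<sigma>(1)] unfolding is_lip_def by simp
        then have "fst p < \<sigma> n (snd p)" using N \<sigma>(2)[of n] that by linarith
        then show ?thesis by (simp add: busemann_past_def case_prod_unfold)
      qed
      then show ?thesis unfolding mem_liminf_iff eventually_sequentially by blast
    qed
    then have lo: "liminf (\<lambda>n. busemann_past (\<sigma> n)) = UNIV" by blast
    have "liminf (\<lambda>n. busemann_past (\<sigma> n)) \<subseteq> limsup (\<lambda>n. busemann_past (\<sigma> n))"
      by (rule Liminf_le_Limsup) simp
    then have "UNIV \<in> IP_limit A g0 \<omega> (\<lambda>n. busemann_past (\<sigma> n))"
      using lo IP_UNIV unfolding IP_limit_def by auto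
    moreover have "range (\<lambda>n. busemann_past (\<sigma> n)) \<subseteq> Collect (IP A g0 \<omega>) - U" using \<sigma>(1,3) by (rule range)
    ultimately have "UNIV \<notin> U" using lim by blast
    then show False using that by simp
  qed
  ultimately show ?r using U unfolding B_topology_eq by simp
next
  assume r: ?r
  then have lim: "\<And>\<sigma>. range \<sigma> \<subseteq> BB - {b \<in> BB. busemann_past b \<in> U} \<Longrightarrow>
      B_limit A g0 \<omega> \<sigma> \<subseteq> BB - {b \<in> BB. busemann_past b \<in> U}"
    unfolding B_topology_eq[symmetric] openin_B_topology by simp
  show ?l
    unfolding openin_future_completion
  proof (intro conjI allI impI subsetI)
    show "P \<in> Collect (IP A g0 \<omega>)" if "P \<in> U" for P using r that by blast
    fix \<sigma> P assume \<sigma>: "range \<sigma> \<subseteq> Collect (IP A g0 \<omega>) - U" and P: "P \<in> IP_limit A g0 \<omega> \<sigma>"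
    have PIP: "IP A g0 \<omega> P" using P unfolding IP_limit_def by simp
    have "P \<notin> U"
    \<comment> \<open>If infinitely many terms differ from \<open>V\<close>, a subsequence consists
      of sets \<open>P(b)\<close>. Otherwise the upper limit is \<open>V\<close>, and maximality
      forces the limit to be \<open>V\<close> too.\<close>
    proof (cases "\<exists>\<^sub>F n in sequentially. \<sigma> n \<noteq> UNIV")
      case True
      then obtain r :: "nat \<Rightarrow> nat" where rr: "strict_mono r" "\<And>n. \<sigma> (r n) \<noteq> UNIV"
        by (rule frequently_subseq) blast
      have "\<exists>b. b \<in> BB \<and> \<sigma> (r n) = busemann_past b" for n
      proof -
        have "IP A g0 \<omega> (\<sigma> (r n))" using \<sigma> by blast
        then show ?thesis by (cases rule: IP_cases) (use rr(2) in auto)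
      qed
      then obtain \<tau> where \<tau>: "\<And>n. \<tau> n \<in> BB" "\<And>n. \<sigma> (r n) = busemann_past (\<tau> n)" by metis
      have eq: "\<sigma> \<circ> r = (\<lambda>n. busemann_past (\<tau> n))" using \<tau>(2) by (simp add: comp_def)
      have P\<tau>: "P \<in> IP_limit A g0 \<omega> (\<lambda>n. busemann_past (\<tau> n))"
        using IP_limit_subseq[OF rr(1)] P unfolding eq[symmetric] by blast
      have \<tau>U: "busemann_past (\<tau> n) \<notin> U" for n using \<sigma> \<tau>(2)[of n] by blast
      show ?thesis
        using PIP
      proof (cases rule: IP_cases)
        case 1
        have "\<not> (\<forall>b\<in>BB. K < b x0 \<longrightarrow> busemann_past b \<in> U)" for K
        proof -
          have "(K, x0) \<in> liminf (\<lambda>n. busemann_past (\<tau> n))" using P\<tau> 1 unfolding IP_limit_def by blast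
          then have "\<forall>\<^sub>F n in sequentially. K < \<tau> n x0" by (simp add: mem_liminf_iff busemann_past_def)
          then obtain n where "K < \<tau> n x0" unfolding eventually_sequentially by blast
          then show ?thesis using \<tau>(1) \<tau>U by blast
        qed
        then show ?thesis using r 1 by blast
      next
        case (2 f)
        then have "f \<in> B_limit A g0 \<omega> \<tau>" using P\<tau> busemann_past_in_IP_limit_iff by simp
        moreover have "range \<tau> \<subseteq> BB - {b \<in> BB. busemann_past b \<in> U}" using \<tau>(1) \<tau>U by auto
        ultimately show ?thesis using lim 2 by blast
      qed
    next
      case False
      then have ev: "\<forall>\<^sub>F n in sequentially. \<sigma> n = UNIV" by (simp add: frequently_def)
      then obtain n where n: "\<sigma> n = UNIV" unfolding eventually_sequentially by blast
      have "p \<in> limsup \<sigma>" for p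
      proof -
        have "\<forall>\<^sub>F n in sequentially. p \<in> \<sigma> n" using ev by (rule eventually_mono) simp
        then show ?thesis unfolding mem_limsup_iff by (rule eventually_frequently[rotated]) simp
      qed
      then have "UNIV \<subseteq> limsup \<sigma>" by blast
      then have "P = UNIV" using P IP_UNIV unfolding IP_limit_def by blast
      then show ?thesis using n \<sigma> by (metis DiffD2 rangeI subset_iff)
    qed
    then show "P \<in> Collect (IP A g0 \<omega>) - U" using PIP by simp
  qed
qed

lemma topspace_future_completion: "topspace (future_completion A g0 \<omega>) = Collect (IP A g0 \<omega>)"
proof
  show "topspace (future_completion A g0 \<omega>) \<subseteq> Collect (IP A g0 \<omega>)"
    using openin_topspace[of "future_completion A g0 \<omega>"] unfolding openin_future_completion by blast
  have "openin (future_completion A g0 \<omega>) (Collect (IP A g0 \<omega>))"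
    unfolding openin_future_completion by (auto simp: IP_limit_def)
  then show "Collect (IP A g0 \<omega>) \<subseteq> topspace (future_completion A g0 \<omega>)" by (rule openin_subset)
qed

section \<open>The product decomposition and compactness of \<open>M_B\<close>\<close>

definition rep :: "'m \<Rightarrow> ('m \<Rightarrow> real) set \<Rightarrow> 'm \<Rightarrow> real" where
  "rep x0 \<xi> = (\<lambda>y. (SOME b. b \<in> \<xi>) y - (SOME b. b \<in> \<xi>) x0)"

text \<open>The choice of representative does not matter, because the members of a class differ by
  constants.\<close>

lemma rep_cls:
  assumes b: "b \<in> BB"
  shows "rep x0 (cls b) = (\<lambda>y. b y - b x0)"
proof -
  have "(SOME g. g \<in> cls b) \<in> cls b" using mem_cls[OF b] by (rule someI[where P = "\<lambda>g. g \<in> cls b"])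
  then obtain k where "\<And>x. (SOME g. g \<in> cls b) x = b x + k" unfolding B_class_def by blast
  then show ?thesis unfolding rep_def by simp
qed

lemma rep_shift: "b \<in> BB \<Longrightarrow> (\<lambda>y. rep x0 (cls b) y + t) = (\<lambda>y. b y + (t - b x0))"
  by (simp add: rep_cls algebra_simps)

lemma rep_shift_in: "b \<in> BB \<Longrightarrow> (\<lambda>y. rep x0 (cls b) y + t) \<in> BB"
  unfolding rep_shift by (rule B_plus_shift)

lemma cls_shift: "b \<in> BB \<Longrightarrow> cls (\<lambda>y. b y + k) = cls b"
  using cls_eq_iff[OF B_plus_shift, of b b k] by auto

lemma rep_at: "b \<in> BB \<Longrightarrow> rep x0 (cls b) x0 = 0"
  by (simp add: rep_cls)

lemma continuous_cls: "continuous_map (top_of_set BB) (M_B A g0 \<omega>) cls"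
  unfolding continuous_map_def topspace_M_B openin_M_B B_topology_eq by auto

lemma continuous_rep: "continuous_map (M_B A g0 \<omega>) euclidean (rep x0)"
  unfolding continuous_map_def
proof (intro conjI allI impI)
  fix U :: "('m \<Rightarrow> real) set" assume U: "openin euclidean U"
  have cont: "continuous_on BB (\<lambda>b y. b y - b x0)"
    by (intro continuous_intros continuous_on_coordinatewise_then_product)
      (auto intro: continuous_on_subset[OF continuous_on_product_coordinates])
  have "{b \<in> BB. cls b \<in> {\<xi> \<in> cls ` BB. rep x0 \<xi> \<in> U}} = BB \<inter> (\<lambda>b y. b y - b x0) -` U"
    using rep_cls by auto
  moreover have "openin (top_of_set BB) (BB \<inter> (\<lambda>b y. b y - b x0) -` U)"
    using cont U by (simp add: continuous_openin_preimage_gen)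
  ultimately show "openin (M_B A g0 \<omega>) {\<xi> \<in> topspace (M_B A g0 \<omega>). rep x0 \<xi> \<in> U}"
    unfolding openin_M_B topspace_M_B B_topology_eq by auto
qed simp

lemma continuous_rep_shift:
  "continuous_map (prod_topology euclideanreal (M_B A g0 \<omega>)) euclidean (\<lambda>z y. rep x0 (snd z) y + fst z)"
proof -
  let ?X = "prod_topology euclideanreal (M_B A g0 \<omega>)"
  have r: "continuous_map ?X euclidean (\<lambda>z. rep x0 (snd z))"
    using continuous_map_compose[OF continuous_map_snd continuous_rep] by (simp add: comp_def)
  have "continuous_map ?X euclideanreal (\<lambda>z. rep x0 (snd z) y + fst z)" for y
  proof (intro continuous_map_add continuous_map_fst)
    have "continuous_map euclidean euclideanreal (\<lambda>b :: 'm \<Rightarrow> real. b y)"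
      by (simp add: continuous_on_product_coordinates)
    from continuous_map_compose[OF r this]
    show "continuous_map ?X euclideanreal (\<lambda>z. rep x0 (snd z) y)" by (simp add: comp_def)
  qed
  then show ?thesis
    unfolding euclidean_product_topology[symmetric] by (simp add: continuous_map_componentwise_UNIV)
qed

lemma continuous_eval_cls:
  "continuous_map (top_of_set BB) (prod_topology euclideanreal (M_B A g0 \<omega>)) (\<lambda>b. (b x0, cls b))"
  using continuous_cls
  by (simp add: continuous_map_paired continuous_on_subset[OF continuous_on_product_coordinates])

text \<open>The inverse adds the first coordinate to the representative vanishing at
  \<open>x0\<close>. Its continuity rests on the pointwise description of the topology.\<close>

lemma homeomorphic_eval_cls:
  "homeomorphic_map (B_topology A g0 \<omega>) (prod_topology euclideanreal (M_B A g0 \<omega>)) (\<lambda>b. (b x0, cls b))"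
proof (rule homeomorphic_maps_imp_map)
  show "homeomorphic_maps (B_topology A g0 \<omega>) (prod_topology euclideanreal (M_B A g0 \<omega>))
      (\<lambda>b. (b x0, cls b)) (\<lambda>z y. rep x0 (snd z) y + fst z)"
    unfolding homeomorphic_maps_def B_topology_eq
  proof (intro conjI continuous_eval_cls ballI)
    show "continuous_map (prod_topology euclideanreal (M_B A g0 \<omega>)) (top_of_set BB)
        (\<lambda>z y. rep x0 (snd z) y + fst z)"
      using continuous_rep_shift rep_shift_in
      by (auto simp: continuous_map_in_subtopology topspace_M_B)
    show "(\<lambda>y. rep x0 (snd (b x0, cls b)) y + fst (b x0, cls b)) = b" if "b \<in> topspace (top_of_set BB)" for b
      using that rep_cls by simp
    show "(rep x0 (snd z) x0 + fst z, cls (\<lambda>y. rep x0 (snd z) y + fst z)) = z"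
      if "z \<in> topspace (prod_topology euclideanreal (M_B A g0 \<omega>))" for z
      using that by (auto simp: topspace_M_B rep_shift cls_shift rep_at)
  qed
qed

text \<open>Every class has a representative vanishing at a fixed point, so \<open>M_B\<close> is a
  continuous image of the compact set of normalized functions.\<close>

lemma compact_M_B: "compact_space (M_B A g0 \<omega>)"
proof -
  let ?N = "{b \<in> BB. b undefined = 0}"
  have "compactin (top_of_set BB) ?N"
    using compact_normalized by (auto simp: compactin_subtopology)
  then have "compactin (M_B A g0 \<omega>) (cls ` ?N)" using continuous_cls by (rule image_compactin)
  moreover have "cls ` ?N = cls ` BB"
  proof -
    have "cls b \<in> cls ` ?N" if b: "b \<in> BB" for b
    proof -
      let ?b = "\<lambda>y. b y + (- b undefined)"
      have "?b \<in> ?N" using B_plus_shift[OF b, of "- b undefined"] by simp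
      then have "cls ?b \<in> cls ` ?N" by (rule imageI)
      then show ?thesis by (simp only: cls_shift[OF b])
    qed
    then show ?thesis by blast
  qed
  ultimately show ?thesis unfolding compact_space_def topspace_M_B by simp
qed

end

section \<open>Cones\<close>

text \<open>The cone is constructed once, for a closed family \<open>C\<close> invariant under
  adding constants, and then applied to all of \<open>B_plus\<close> and to the functions of the
  boundary. Closedness is what makes the base compact.\<close>

locale busemann_cone = fermat_causality_Hausdorff A g0 \<omega>
  for A :: "('m::{t2_space, second_countable_topology}, 'e::euclidean_space) chart set"
    and g0 :: "'m \<Rightarrow> ('m, 'e) tvec \<Rightarrow> ('m, 'e) tvec \<Rightarrow> real"
    and \<omega> :: "'m \<Rightarrow> ('m, 'e) tvec \<Rightarrow> real" +
  fixes C :: "('m \<Rightarrow> real) set" and x0 :: 'm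
  assumes C_sub: "C \<subseteq> BB"
    and C_closed: "closedin (top_of_set BB) C"
    and C_shift: "b \<in> C \<Longrightarrow> (\<lambda>y. b y + k) \<in> C"
begin

abbreviation "base \<equiv> subtopology (M_B A g0 \<omega>) (cls ` C)"
abbreviation "past_space \<equiv> subtopology (future_completion A g0 \<omega>) (insert UNIV (busemann_past ` C))"
abbreviation "cone_prod \<equiv> prod_topology (top_of_set {-\<infinity> :: ereal<..}) base"

definition cone_point :: "('m \<Rightarrow> real) \<Rightarrow> ereal \<times> ('m \<Rightarrow> real) set" where
  "cone_point b = (ereal (b x0), cls b)"

lemma C_BB: "b \<in> C \<Longrightarrow> b \<in> BB"
  using C_sub by blast

lemma topspace_base: "topspace base = cls ` C"
  using C_sub by (auto simp: topspace_M_B)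

lemma topspace_cone_prod: "topspace cone_prod = {-\<infinity><..} \<times> cls ` C"
  by (simp add: topspace_base del: topspace_subtopology)

lemma topspace_past_space: "topspace past_space = insert UNIV (busemann_past ` C)"
  using C_sub IP_UNIV by (auto simp: topspace_future_completion B_plus_iff_IP)

lemma cls_in_iff: "b \<in> BB \<Longrightarrow> cls b \<in> cls ` C \<longleftrightarrow> b \<in> C"
proof
  assume b: "b \<in> BB" "cls b \<in> cls ` C"
  then obtain c where c: "c \<in> C" "cls c = cls b" by auto
  then obtain k where "\<forall>x. b x = c x + k" using cls_eq_iff[OF b(1)] by blast
  then have "b = (\<lambda>x. c x + k)" by blast
  then show "b \<in> C" using C_shift[OF c(1)] by simp
qed simp

lemma compact_base: "compact_space base"
proof -
  have "{b \<in> BB. cls b \<in> cls ` BB - cls ` C} = BB - C" using cls_in_iff by auto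
  then have "openin (M_B A g0 \<omega>) (cls ` BB - cls ` C)"
    using C_closed unfolding openin_M_B B_topology_eq closedin_def by simp
  then have "closedin (M_B A g0 \<omega>) (cls ` C)"
    using C_sub unfolding closedin_def topspace_M_B by blast
  then show ?thesis
    using compact_M_B by (simp add: closedin_compact_space compact_space_subtopology)
qed

text \<open>An open set of the subspace extends to the completion by adding every
  \<open>P(b)\<close> with \<open>b\<close> outside \<open>C\<close>. Closedness of \<open>C\<close>
  makes the enlarged set open, and the condition at \<open>V\<close> then concerns members of
  \<open>C\<close> only.\<close>

lemma openin_past_space:
  "openin past_space U \<longleftrightarrow> U \<subseteq> insert UNIV (busemann_past ` C) \<and>
     openin (top_of_set C) {b \<in> C. busemann_past b \<in> U} \<and>
     (UNIV \<in> U \<longrightarrow> (\<exists>K. \<forall>b\<in>C. K < b x0 \<longrightarrow> busemann_past b \<in> U))"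
  (is "?l \<longleftrightarrow> ?r")
proof
  assume ?l
  then obtain U' where U': "openin (future_completion A g0 \<omega>) U'"
    "U = U' \<inter> insert UNIV (busemann_past ` C)"
    unfolding openin_subtopology by blast
  have eq: "{b \<in> C. busemann_past b \<in> U} = C \<inter> {b \<in> BB. busemann_past b \<in> U'}"
    using U'(2) C_sub by auto
  have "openin (top_of_set BB) {b \<in> BB. busemann_past b \<in> U'}"
    using U'(1) unfolding openin_future_completion_iff[of _ x0] by simp
  then obtain T where "open T" "{b \<in> BB. busemann_past b \<in> U'} = BB \<inter> T" unfolding openin_open by blast
  moreover from this(2) have "C \<inter> {b \<in> BB. busemann_past b \<in> U'} = C \<inter> T" using C_sub by blast
  ultimately have "openin (top_of_set C) {b \<in> C. busemann_past b \<in> U}"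
    unfolding eq openin_open by blast
  moreover have "\<exists>K. \<forall>b\<in>C. K < b x0 \<longrightarrow> busemann_past b \<in> U" if "UNIV \<in> U"
  proof -
    have "UNIV \<in> U'" using that U'(2) by blast
    then obtain K where "\<forall>b\<in>BB. K < b x0 \<longrightarrow> busemann_past b \<in> U'"
      using U'(1) unfolding openin_future_completion_iff[of _ x0] by blast
    then show ?thesis using U'(2) C_sub by (intro exI[of _ K]) auto
  qed
  ultimately show ?r using U'(2) by simp
next
  assume r: ?r
  let ?U = "U \<union> busemann_past ` (BB - C)"
  obtain V where V: "openin (top_of_set BB) V" "{b \<in> C. busemann_past b \<in> U} = V \<inter> C"
  proof -
    obtain T where T: "open T" "{b \<in> C. busemann_past b \<in> U} = C \<inter> T" using r unfolding openin_open by blast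
    have "openin (top_of_set BB) (BB \<inter> T)" using T(1) by (rule openin_open_Int)
    moreover have "C \<inter> T = (BB \<inter> T) \<inter> C" using C_sub by blast
    ultimately show ?thesis using T(2) by (intro that[of "BB \<inter> T"]) simp_all
  qed
  have "{b \<in> BB. busemann_past b \<in> ?U} = V \<union> (BB - C)"
  proof -
    have "b \<in> C \<or> busemann_past b \<notin> U" if "b \<in> BB" for b
      using r busemann_past_neq_UNIV[of b] by (auto simp: busemann_past_inject)
    moreover have "V \<subseteq> BB" using V(1) openin_subset by fastforce
    ultimately show ?thesis using V(2) C_sub by (auto simp: busemann_past_inject)
  qed
  moreover have "openin (top_of_set BB) (V \<union> (BB - C))"
    using V(1) C_closed unfolding closedin_def by (intro openin_Un) auto
  ultimately have op: "openin (top_of_set BB) {b \<in> BB. busemann_past b \<in> ?U}" by simp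
  have "insert UNIV (busemann_past ` BB) \<subseteq> Collect (IP A g0 \<omega>)"
    using IP_UNIV by (auto simp: B_plus_iff_IP)
  moreover have "?U \<subseteq> insert UNIV (busemann_past ` BB)" using r C_sub by blast
  ultimately have "?U \<subseteq> Collect (IP A g0 \<omega>)" by (rule order_trans[rotated])
  moreover have "\<exists>K. \<forall>b\<in>BB. K < b x0 \<longrightarrow> busemann_past b \<in> ?U" if "UNIV \<in> ?U"
  proof -
    have "UNIV \<in> U" using that by (auto simp: busemann_past_neq_UNIV[symmetric])
    then obtain K where "\<forall>b\<in>C. K < b x0 \<longrightarrow> busemann_past b \<in> U" using r by blast
    then show ?thesis by (intro exI[of _ K]) auto
  qed
  ultimately have "openin (future_completion A g0 \<omega>) ?U"
    using op unfolding openin_future_completion_iff[of _ x0] by simp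
  moreover have "U = ?U \<inter> insert UNIV (busemann_past ` C)"
    using r by (auto simp: busemann_past_inject busemann_past_neq_UNIV[symmetric])
  ultimately show ?l unfolding openin_subtopology by blast
qed

lemma cone_point_inject: "b \<in> BB \<Longrightarrow> b' \<in> BB \<Longrightarrow> cone_point b = cone_point b' \<longleftrightarrow> b = b'"
  using rep_cls[of b x0] rep_cls[of b' x0]
  by (auto simp: cone_point_def) (metis (no_types) diff_add_cancel ext)

lemma cone_point_surj:
  assumes "z \<in> topspace cone_prod" "fst z \<noteq> \<infinity>"
  shows "z = cone_point (\<lambda>y. rep x0 (snd z) y + real_of_ereal (fst z))"
    and "(\<lambda>y. rep x0 (snd z) y + real_of_ereal (fst z)) \<in> C"
proof -
  obtain t c where z: "z = (ereal t, cls c)" "c \<in> C"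
    using assms unfolding topspace_cone_prod by (cases "fst z"; cases z) auto
  have eq: "(\<lambda>y. rep x0 (snd z) y + real_of_ereal (fst z)) = (\<lambda>y. c y + (t - c x0))"
    using z C_BB by (simp add: rep_shift)
  show "z = cone_point (\<lambda>y. rep x0 (snd z) y + real_of_ereal (fst z))"
    unfolding eq using z C_BB by (simp add: cone_point_def cls_shift)
  show "(\<lambda>y. rep x0 (snd z) y + real_of_ereal (fst z)) \<in> C"
    unfolding eq using C_shift[OF z(2)] .
qed

lemma continuous_cone_point: "continuous_map (top_of_set C) cone_prod cone_point"
proof -
  have "continuous_map (top_of_set C) (M_B A g0 \<omega>) cls"
    using continuous_map_from_subtopology_mono[OF continuous_cls C_sub] .
  moreover have "continuous_on C (\<lambda>b :: 'm \<Rightarrow> real. ereal (b x0))"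
    by (intro continuous_on_ereal continuous_on_subset[OF continuous_on_product_coordinates]) simp
  ultimately show ?thesis
    unfolding cone_point_def continuous_map_paired by (auto simp: continuous_map_in_subtopology)
qed

text \<open>On the open set of finite heights, \<open>?G\<close> recovers a function continuously
  from its value at \<open>x0\<close> and its class, so \<open>cone_point\<close> is an open
  map.\<close>

lemma openin_finite_part:
  assumes D: "openin (top_of_set C) D"
  shows "openin cone_prod (cone_point ` D)"
proof -
  have DC: "D \<subseteq> C" using openin_subset[OF D] by simp
  let ?F = "(UNIV - {\<infinity>, -\<infinity>}) \<times> cls ` C :: (ereal \<times> ('m \<Rightarrow> real) set) set"
  let ?G = "\<lambda>z y. rep x0 (snd z) y + real_of_ereal (fst z)"
  have "openin (top_of_set {-\<infinity><..}) (UNIV - {\<infinity>, -\<infinity>} :: ereal set)"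
    by (rule open_subset) (auto intro!: open_Diff finite_imp_closed)
  moreover have "openin base (cls ` C)" using openin_topspace[of base] unfolding topspace_base .
  ultimately have F: "openin cone_prod ?F" by (simp add: openin_prod_Times_iff)
  have sub: "topspace (subtopology cone_prod ?F) = ?F"
    using openin_subset[OF F] by (auto simp: topspace_subtopology)
  have 1: "continuous_map (subtopology cone_prod ?F) (top_of_set (UNIV - {\<infinity>, -\<infinity>})) fst"
    unfolding continuous_map_in_subtopology sub
    by (auto intro!: continuous_map_from_subtopology
        continuous_map_into_fulltopology[OF continuous_map_fst])
  have "continuous_map (top_of_set (UNIV - {\<infinity>, -\<infinity>})) euclideanreal real_of_ereal"
    using continuous_on_real by simp
  from continuous_map_compose[OF 1 this]
  have 2: "continuous_map (subtopology cone_prod ?F) euclideanreal (\<lambda>z. real_of_ereal (fst z))"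
    by (simp add: comp_def)
  have 3: "continuous_map (subtopology cone_prod ?F) (M_B A g0 \<omega>) snd"
    by (intro continuous_map_from_subtopology continuous_map_into_fulltopology[OF continuous_map_snd])
  have "continuous_map (subtopology cone_prod ?F) euclidean ?G"
    using continuous_map_compose[OF continuous_map_pairedI[OF 2 3] continuous_rep_shift]
    by (simp add: comp_def)
  moreover have "?G \<in> ?F \<rightarrow> C"
  proof
    fix z assume "z \<in> ?F"
    then show "?G z \<in> C" by (intro cone_point_surj(2)) (auto simp: topspace_M_B C_BB)
  qed
  ultimately have "continuous_map (subtopology cone_prod ?F) (top_of_set C) ?G"
    unfolding continuous_map_in_subtopology sub by blast
  from openin_continuous_map_preimage[OF this D]
  have "openin cone_prod {z \<in> ?F. ?G z \<in> D}"
    unfolding sub openin_open_subtopology[OF F] by simp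
  moreover have "{z \<in> ?F. ?G z \<in> D} = cone_point ` D"
  proof (intro set_eqI iffI)
    fix z assume z: "z \<in> {z \<in> ?F. ?G z \<in> D}"
    then have "z = cone_point (?G z)"
      by (intro cone_point_surj(1)) (auto simp: topspace_M_B C_BB)
    then show "z \<in> cone_point ` D" using z by blast
  next
    fix z assume "z \<in> cone_point ` D"
    then obtain b where b: "b \<in> D" "z = cone_point b" by blast
    then have "?G z = b" using C_BB DC by (auto simp: cone_point_def rep_shift)
    then show "z \<in> {z \<in> ?F. ?G z \<in> D}" using b DC by (auto simp: cone_point_def)
  qed
  ultimately show ?thesis by simp
qed

text \<open>Sets of this form are the saturated subsets of the product, with \<open>Q\<close>
  telling whether they contain the level at infinity. The bound \<open>K\<close> comes from
  compactness of the base, through \<open>tube_at_infinity\<close>.\<close>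

lemma openin_cone_prod_iff:
  assumes D: "D \<subseteq> C"
  shows "openin cone_prod (cone_point ` D \<union> (if Q then {\<infinity>} \<times> cls ` C else {})) \<longleftrightarrow>
    openin (top_of_set C) D \<and> (Q \<longrightarrow> (\<exists>K. \<forall>b\<in>C. K < b x0 \<longrightarrow> b \<in> D))"
    (is "openin _ ?W \<longleftrightarrow> _")
proof (intro iffI conjI impI)
  assume W: "openin cone_prod ?W"
  have mem: "cone_point b \<in> ?W \<longleftrightarrow> b \<in> D" if "b \<in> C" for b
  proof -
    have "cone_point b \<in> cone_point ` D \<longleftrightarrow> b \<in> D"
    proof
      assume "cone_point b \<in> cone_point ` D"
      then obtain b' where b': "b' \<in> D" "cone_point b = cone_point b'" by blast
      then have "b = b'" using cone_point_inject[of b b'] that D C_BB by blast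
      then show "b \<in> D" using b' by simp
    qed simp
    moreover have "cone_point b \<notin> (if Q then {\<infinity>} \<times> cls ` C else {})" by (simp add: cone_point_def)
    ultimately show ?thesis by simp
  qed
  have "openin (top_of_set C) {b \<in> C. cone_point b \<in> ?W}"
    using openin_continuous_map_preimage[OF continuous_cone_point W] by simp
  moreover have "{b \<in> C. cone_point b \<in> ?W} = D" using mem D by blast
  ultimately show "openin (top_of_set C) D" by simp
  assume Q
  then have "{\<infinity>} \<times> topspace base \<subseteq> ?W" unfolding topspace_base by auto
  then obtain K where K: "\<And>t \<xi>. K < t \<Longrightarrow> \<xi> \<in> topspace base \<Longrightarrow> (ereal t, \<xi>) \<in> ?W"
    using tube_at_infinity[OF compact_base W] by blast
  have "b \<in> D" if "b \<in> C" "K < b x0" for b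
    using K[OF that(2), of "cls b"] that(1) mem[OF that(1)] unfolding topspace_base cone_point_def by blast
  then show "\<exists>K. \<forall>b\<in>C. K < b x0 \<longrightarrow> b \<in> D" by blast
next
  assume r: "openin (top_of_set C) D \<and> (Q \<longrightarrow> (\<exists>K. \<forall>b\<in>C. K < b x0 \<longrightarrow> b \<in> D))"
  then have f: "openin cone_prod (cone_point ` D)" using openin_finite_part by blast
  show "openin cone_prod ?W"
  proof (cases Q)
    case True
    then obtain K where K: "\<forall>b\<in>C. K < b x0 \<longrightarrow> b \<in> D" using r by blast
    have "openin (top_of_set {-\<infinity><..}) {ereal K<..}" by (rule open_subset) auto
    moreover have "openin base (cls ` C)" using openin_topspace[of base] unfolding topspace_base .
    ultimately have "openin cone_prod ({ereal K<..} \<times> cls ` C)" by (simp add: openin_prod_Times_iff)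
    then have "openin cone_prod (cone_point ` D \<union> {ereal K<..} \<times> cls ` C)" using f by blast
    moreover have "cone_point ` D \<union> {ereal K<..} \<times> cls ` C = ?W"
    proof (intro set_eqI iffI)
      fix z assume z: "z \<in> cone_point ` D \<union> {ereal K<..} \<times> cls ` C"
      show "z \<in> ?W"
      proof (cases "z \<in> cone_point ` D \<or> fst z = \<infinity>")
        case False
        then have zK: "ereal K < fst z" "snd z \<in> cls ` C" "fst z \<noteq> \<infinity>" using z by auto
        let ?b = "\<lambda>y. rep x0 (snd z) y + real_of_ereal (fst z)"
        have "z \<in> topspace cone_prod" using zK z by (auto simp: topspace_M_B C_BB cone_point_def)
        then have b: "z = cone_point ?b" "?b \<in> C" using cone_point_surj zK(3) by blast+
        have "fst z = ereal (?b x0)" using arg_cong[OF b(1), of fst] by (simp add: cone_point_def)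
        with zK(1) have "ereal K < ereal (?b x0)" by (rule ord_less_eq_trans)
        then have "K < ?b x0" by simp
        moreover have "K < ?b x0 \<longrightarrow> ?b \<in> D" using K b(2) by (rule bspec)
        ultimately have "cone_point ?b \<in> cone_point ` D" by (intro imageI) blast
        then have "z \<in> cone_point ` D" by (simp only: b(1)[symmetric])
        then show ?thesis by (rule UnI1)
      qed (use z True in auto)
    next
      fix z assume "z \<in> ?W"
      then show "z \<in> cone_point ` D \<union> {ereal K<..} \<times> cls ` C" using True by auto
    qed
    ultimately show ?thesis by simp
  qed (use f in simp)
qed

section \<open>The quotient cone\<close>

abbreviation "cone_points \<equiv>
  insert (cone_apex base) (cone_class base ` ({-\<infinity> :: ereal<..} \<times> topspace base))"

lemma openin_cone_space: "openin (cone_space base) W \<longleftrightarrow> W \<subseteq> cone_points \<and>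
    openin cone_prod {z \<in> topspace cone_prod. cone_class base z \<in> W}"
  unfolding cone_space_def openin_quotient_topology ..

lemma topspace_cone_space: "topspace (cone_space base) = cone_points"
proof
  show "topspace (cone_space base) \<subseteq> cone_points"
    using openin_topspace[of "cone_space base"] unfolding openin_cone_space by blast
  have "{z \<in> topspace cone_prod. cone_class base z \<in> cone_points} = topspace cone_prod"
    unfolding topspace_cone_prod topspace_base by blast
  then have "openin (cone_space base) cone_points"
    unfolding openin_cone_space using openin_topspace[of cone_prod] by simp
  then show "cone_points \<subseteq> topspace (cone_space base)" by (rule openin_subset)
qed

text \<open>Classes other than the apex are singletons, hence \<open>the_elem\<close>; the apex is
  the whole level at infinity, empty for an empty base, and has to be treated separately.\<close>

definition cone_map :: "(ereal \<times> ('m \<Rightarrow> real) set) set \<Rightarrow> (real \<times> 'm) set" where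
  "cone_map u = (if u = cone_apex base then UNIV
     else busemann_past (\<lambda>y. rep x0 (snd (the_elem u)) y + real_of_ereal (fst (the_elem u))))"

lemma cone_map_apex: "cone_map (cone_apex base) = UNIV"
  by (simp add: cone_map_def)

lemma cone_class_cone_point: "cone_class base (cone_point b) = {cone_point b}"
  by (simp add: cone_class_def cone_point_def)

lemma cone_point_not_apex: "{cone_point b} \<noteq> cone_apex base"
proof
  assume "{cone_point b} = cone_apex base"
  then have "cone_point b \<in> cone_apex base" by (rule subst) simp
  then have "fst (cone_point b) = \<infinity>" unfolding cone_apex_def mem_Times_iff by simp
  then show False by (simp add: cone_point_def)
qed

lemma cone_map_cone_point:
  assumes "b \<in> BB"
  shows "cone_map {cone_point b} = busemann_past b"
proof -
  have "cone_map {cone_point b} =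
      busemann_past (\<lambda>y. rep x0 (snd (cone_point b)) y + real_of_ereal (fst (cone_point b)))"
    using cone_point_not_apex[of b] by (simp add: cone_map_def)
  also have "\<dots> = busemann_past b" using assms by (simp add: cone_point_def rep_shift)
  finally show ?thesis .
qed

lemma cone_points_eq: "cone_points = insert (cone_apex base) ((\<lambda>b. {cone_point b}) ` C)"
proof (intro set_eqI iffI)
  fix u assume "u \<in> cone_points"
  then consider "u = cone_apex base"
    | z where "z \<in> topspace cone_prod" "u = cone_class base z"
    unfolding topspace_cone_prod topspace_base by blast
  then show "u \<in> insert (cone_apex base) ((\<lambda>b. {cone_point b}) ` C)"
  proof cases
    case (2 z)
    show ?thesis
    proof (cases "fst z = \<infinity>")
      case False
      then obtain b where "z = cone_point b" "b \<in> C" using cone_point_surj[OF 2(1)] by blast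
      then show ?thesis using 2(2) cone_class_cone_point[of b] by simp
    qed (use 2 in \<open>simp add: cone_class_def\<close>)
  qed simp
next
  fix u assume "u \<in> insert (cone_apex base) ((\<lambda>b. {cone_point b}) ` C)"
  then consider "u = cone_apex base" | b where "b \<in> C" "u = cone_class base (cone_point b)"
    using cone_class_cone_point by blast
  then show "u \<in> cone_points"
  proof cases
    case (2 b)
    have "cone_point b \<in> {-\<infinity><..} \<times> topspace base"
      unfolding topspace_base using 2(1) by (simp add: cone_point_def)
    then show ?thesis unfolding 2(2) by (intro insertI2 imageI)
  qed simp
qed

text \<open>An injective quotient map is a homeomorphism, so it suffices to match open sets. On both
  sides openness reduces to the same condition on \<open>?D\<close> and, if
  \<open>UNIV \<in> U\<close>, on the functions with large value at \<open>x0\<close>.\<close>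

lemma homeomorphic_cone_map: "homeomorphic_map (cone_space base) past_space cone_map"
  unfolding homeomorphic_map_def quotient_map_def
proof (intro conjI allI impI)
  have C: "cone_map {cone_point b} = busemann_past b" if "b \<in> C" for b
    using that by (simp add: C_BB cone_map_cone_point)
  show "cone_map ` topspace (cone_space base) = topspace past_space"
    unfolding topspace_cone_space cone_points_eq topspace_past_space
    by (simp add: cone_map_apex C image_image)
  show "inj_on cone_map (topspace (cone_space base))"
    unfolding topspace_cone_space cone_points_eq
  proof (rule inj_onI)
    fix u v
    assume u: "u \<in> insert (cone_apex base) ((\<lambda>b. {cone_point b}) ` C)"
      and v: "v \<in> insert (cone_apex base) ((\<lambda>b. {cone_point b}) ` C)"
      and eq: "cone_map u = cone_map v"
    show "u = v"
    proof (cases "u = cone_apex base"; cases "v = cone_apex base")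
      assume u': "u = cone_apex base" and "v \<noteq> cone_apex base"
      then obtain b where "b \<in> C" "v = {cone_point b}" using v by blast
      then have "busemann_past b = UNIV" using eq C u' by (simp add: cone_map_apex)
      then show ?thesis using busemann_past_neq_UNIV by blast
    next
      assume "u \<noteq> cone_apex base" and v': "v = cone_apex base"
      then obtain b where "b \<in> C" "u = {cone_point b}" using u by blast
      then have "busemann_past b = UNIV" using eq C v' by (simp add: cone_map_apex)
      then show ?thesis using busemann_past_neq_UNIV by blast
    next
      assume "u \<noteq> cone_apex base" "v \<noteq> cone_apex base"
      then obtain b b' where "b \<in> C" "u = {cone_point b}" "b' \<in> C" "v = {cone_point b'}"
        using u v by blast
      then show ?thesis using eq by (simp add: C busemann_past_inject)
    qed simp
  qed
  fix U assume "U \<subseteq> topspace past_space"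
  then have U: "U \<subseteq> insert UNIV (busemann_past ` C)" unfolding topspace_past_space .
  let ?W = "{x \<in> topspace (cone_space base). cone_map x \<in> U}"
  let ?D = "{b \<in> C. busemann_past b \<in> U}"
  have "{z \<in> topspace cone_prod. cone_class base z \<in> ?W} =
      cone_point ` ?D \<union> (if UNIV \<in> U then {\<infinity>} \<times> cls ` C else {})" (is "?L = ?R")
  proof (intro set_eqI)
    fix z
    show "z \<in> ?L \<longleftrightarrow> z \<in> ?R"
    proof (cases "z \<in> topspace cone_prod")
      case z: True
      have "cone_class base z \<in> cone_points"
        using z unfolding topspace_cone_prod topspace_base by (intro insertI2 imageI)
      then have L: "z \<in> ?L \<longleftrightarrow> cone_map (cone_class base z) \<in> U"
        using z unfolding topspace_cone_space by simp
      show ?thesis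
      proof (cases "fst z = \<infinity>")
        case True
        then have "z \<notin> cone_point ` ?D" by (auto simp: cone_point_def)
        moreover have "z \<in> {\<infinity>} \<times> cls ` C" using z True unfolding topspace_cone_prod mem_Times_iff by simp
        moreover have "cone_map (cone_class base z) = UNIV"
          using True by (simp add: cone_class_def cone_map_apex)
        ultimately show ?thesis unfolding L by simp
      next
        case False
        then obtain b where b: "b \<in> C" "z = cone_point b" using cone_point_surj[OF z] by blast
        have "cone_map (cone_class base z) = busemann_past b"
          using b C_BB by (simp add: cone_class_cone_point cone_map_cone_point)
        moreover have "z \<notin> {\<infinity>} \<times> cls ` C" using False by auto
        moreover have "z \<in> cone_point ` ?D \<longleftrightarrow> busemann_past b \<in> U"
        proof
          assume "z \<in> cone_point ` ?D"
          then obtain b' where b': "z = cone_point b'" "b' \<in> ?D" by (rule imageE)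
          then have "b = b'" using cone_point_inject[of b b'] b C_BB by simp
          then show "busemann_past b \<in> U" using b' by simp
        next
          assume "busemann_past b \<in> U"
          then show "z \<in> cone_point ` ?D" using b by (intro image_eqI[of z cone_point b]) simp_all
        qed
        ultimately show ?thesis unfolding L by simp
      qed
    next
      case False
      have "cone_point ` C \<subseteq> topspace cone_prod" "{\<infinity>} \<times> cls ` C \<subseteq> topspace cone_prod"
        unfolding topspace_cone_prod by (auto simp: cone_point_def)
      moreover have "?R \<subseteq> cone_point ` C \<union> {\<infinity>} \<times> cls ` C" by auto
      ultimately have "z \<notin> ?R" using False by blast
      then show ?thesis using False by blast
    qed
  qed
  then have "openin (cone_space base) ?W \<longleftrightarrow>
      openin cone_prod (cone_point ` ?D \<union> (if UNIV \<in> U then {\<infinity>} \<times> cls ` C else {}))"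
    unfolding openin_cone_space topspace_cone_space by (simp only: Collect_subset simp_thms)
  also have "\<dots> \<longleftrightarrow> openin (top_of_set C) ?D \<and>
      (UNIV \<in> U \<longrightarrow> (\<exists>K. \<forall>b\<in>C. K < b x0 \<longrightarrow> b \<in> ?D))"
    by (rule openin_cone_prod_iff) blast
  also have "\<dots> \<longleftrightarrow> openin past_space U" unfolding openin_past_space using U by auto
  finally show "openin (cone_space base) ?W \<longleftrightarrow> openin past_space U" .
qed

end

section \<open>The functions of the boundary and the two cones\<close>

context fermat_causality_Hausdorff
begin

text \<open>The functions \<open>k - d y x\<close> are those whose IP is the past of the point
  \<open>(k, x)\<close>; what remains corresponds to the TIPs other than \<open>V\<close> and to the
  classes outside the image of \<open>M\<close>.\<close>

definition boundary_functions :: "('m \<Rightarrow> real) set" where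
  "boundary_functions = {b \<in> BB. \<forall>x k. b \<noteq> (\<lambda>y. k - d y x)}"

text \<open>A chain generating a boundary function leaves every compact set, so it eventually crosses the
  shell around \<open>x\<close>; functions of \<open>M\<close> violate the inequality, which is a closed condition.\<close>

lemma boundary_function_shell:
  assumes b: "b \<in> boundary_functions" and S: "compact S" and K: "compact K"
    and cross: "\<And>z e. z \<notin> K \<Longrightarrow> 0 < e \<Longrightarrow> \<exists>y\<in>S. d x y + d y z \<le> d x z + e"
  shows "\<exists>y\<in>S. b x \<le> b y - d x y"
proof -
  have bB: "b \<in> BB" and nM: "\<And>x k. b \<noteq> (\<lambda>y. k - d y x)"
    using b unfolding boundary_functions_def by blast+
  obtain T X where TX: "\<And>n. T n < b (X n)" "incseq T" "\<And>y. (\<lambda>n. T n - d y (X n)) \<longlonglongrightarrow> b y"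
    using B_plus_chain[OF bB] by metis
  have "\<not> (\<exists>\<^sub>F n in sequentially. X n \<in> K)"
  proof
    assume "\<exists>\<^sub>F n in sequentially. X n \<in> K"
    then obtain r :: "nat \<Rightarrow> nat" where r: "strict_mono r" "\<And>n. X (r n) \<in> K"
      by (rule frequently_subseq) blast
    have "\<forall>n. (X \<circ> r) n \<in> K" using r(2) by simp
    then obtain z q where z: "strict_mono q" "((X \<circ> r) \<circ> q) \<longlonglongrightarrow> z"
      using compact_imp_seq_compact[OF K] by (elim seq_compactE)
    have lim: "(\<lambda>n. T (r (q n)) - d y (X (r (q n)))) \<longlonglongrightarrow> b y" for y
      using LIMSEQ_subseq_LIMSEQ[OF TX(3) strict_mono_o[OF r(1) z(1)]] by (simp add: comp_def)
    have dz: "(\<lambda>n. d y (X (r (q n)))) \<longlonglongrightarrow> d y z" for y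
      using tendsto_d(1)[OF z(2)] by (simp add: comp_def)
    have Tlim: "(\<lambda>n. T (r (q n))) \<longlonglongrightarrow> b y + d y z" for y
      using tendsto_add[OF lim[of y] dz[of y]] by simp
    \<comment> \<open>The limit of the times does not depend on \<open>y\<close>, so
      \<open>b\<close> would be \<open>k - d y z\<close> with \<open>k = b z\<close>.\<close>
    have "b y + d y z = b z + d z z" for y by (rule LIMSEQ_unique[OF Tlim Tlim])
    then have "b = (\<lambda>y. b z - d y z)" by (intro ext) (simp add: eq_diff_eq)
    then show False using nM by blast
  qed
  then have "\<forall>\<^sub>F n in sequentially. X n \<notin> K" by (simp add: frequently_def)
  then obtain N where N: "\<And>n. N \<le> n \<Longrightarrow> X n \<notin> K" unfolding eventually_sequentially by blast
  have "\<forall>n. \<exists>y\<in>S. d x y + d y (X (n + N)) \<le> d x (X (n + N)) + inverse (real (Suc n))"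
    using cross N by simp
  then obtain Y where Y: "\<And>n. Y n \<in> S"
    "\<And>n. d x (Y n) + d (Y n) (X (n + N)) \<le> d x (X (n + N)) + inverse (real (Suc n))" by metis
  have "\<forall>n. Y n \<in> S" using Y(1) by simp
  then obtain y r where y: "y \<in> S" "strict_mono r" "(Y \<circ> r) \<longlonglongrightarrow> y"
    using compact_imp_seq_compact[OF S] by (elim seq_compactE)
  have Yr: "(\<lambda>n. Y (r n)) \<longlonglongrightarrow> y" using y(3) by (simp add: comp_def)
  have "(\<lambda>n. T (n + N) - d x (X (n + N))) \<longlonglongrightarrow> b x" by (rule LIMSEQ_ignore_initial_segment[OF TX(3)])
  from LIMSEQ_subseq_LIMSEQ[OF this y(2)]
  have l: "(\<lambda>n. T (r n + N) - d x (X (r n + N))) \<longlonglongrightarrow> b x" by (simp add: comp_def)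
  have "(\<lambda>n. b (Y (r n))) \<longlonglongrightarrow> b y"
    using lip_tendsto_moving[where \<sigma> = "\<lambda>_. b", OF _ Yr tendsto_const] B_plus_lip[OF bB] by simp
  moreover have "(\<lambda>n. inverse (real (Suc (r n)))) \<longlonglongrightarrow> 0"
    using LIMSEQ_subseq_LIMSEQ[OF LIMSEQ_inverse_real_of_nat y(2)] by (simp add: comp_def)
  ultimately have u: "(\<lambda>n. b (Y (r n)) - d x (Y (r n)) + inverse (real (Suc (r n)))) \<longlonglongrightarrow> b y - d x y + 0"
    by (intro tendsto_add tendsto_diff tendsto_d(1)[OF Yr])
  \<comment> \<open>Combines \<open>T < b\<close> at the chain point, the Lipschitz bound from there
    to the shell point, and the almost additivity of \<open>d\<close> across the shell.\<close>
  have "T (r n + N) - d x (X (r n + N)) \<le> b (Y (r n)) - d x (Y (r n)) + inverse (real (Suc (r n)))" for n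
  proof -
    have "b (X (r n + N)) - d (Y (r n)) (X (r n + N)) \<le> b (Y (r n))"
      using B_plus_lip[OF bB] unfolding is_lip_def by blast
    then show ?thesis using Y(2)[of "r n"] TX(1)[of "r n + N"] by linarith
  qed
  then have "b x \<le> b y - d x y + 0" by (intro LIMSEQ_le[OF l u]) blast
  then show ?thesis using y(1) by auto
qed

text \<open>The shell around \<open>x\<close> does not depend on the function, so the points
  supplied by \<open>boundary_function_shell\<close> accumulate in the compact \<open>S\<close>, and
  equicontinuity carries the inequality over to the limit.\<close>

lemma closed_boundary_functions: "closed boundary_functions"
  unfolding closure_subset_eq[symmetric]
proof
  fix f assume f: "f \<in> closure boundary_functions"
  have sub: "boundary_functions \<subseteq> BB" unfolding boundary_functions_def by blast
  from _ f obtain \<sigma> where \<sigma>: "range \<sigma> \<subseteq> boundary_functions" "\<And>x. (\<lambda>n. \<sigma> n x) \<longlonglongrightarrow> f x"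
    by (rule lip_closure_sequence) (use sub B_plus_lip in blast)+
  have \<sigma>B: "range \<sigma> \<subseteq> BB" using \<sigma>(1) sub by (rule order_trans)
  then have fB: "f \<in> BB" using \<sigma>(2) by (rule pointwise_limit_in_B_plus)
  have lip: "is_lip (\<sigma> n)" for n by (rule B_plus_lip) (use \<sigma>B in blast)
  have "f \<noteq> (\<lambda>y. k - d y x)" for x k
  proof
    assume eq: "f = (\<lambda>y. k - d y x)"
    obtain S K where SK: "compact S \<and> compact K \<and> (\<forall>y\<in>S. 0 < d x y) \<and>
        (\<forall>z e. z \<notin> K \<longrightarrow> 0 < e \<longrightarrow> (\<exists>y\<in>S. d x y + d y z \<le> d x z + e))"
      using d_shell[of x] by (elim exE)
    then have S: "compact S" "\<And>y. y \<in> S \<Longrightarrow> 0 < d x y" and K: "compact K"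
      "\<And>z e. z \<notin> K \<Longrightarrow> 0 < e \<Longrightarrow> \<exists>y\<in>S. d x y + d y z \<le> d x z + e"
      by simp_all
    have "\<sigma> n \<in> boundary_functions" for n using \<sigma>(1) by blast
    then have "\<forall>n. \<exists>y\<in>S. \<sigma> n x \<le> \<sigma> n y - d x y"
      using S(1) K by (intro allI boundary_function_shell)
    then obtain Y where Y: "\<And>n. Y n \<in> S" "\<And>n. \<sigma> n x \<le> \<sigma> n (Y n) - d x (Y n)" by metis
    have "\<forall>n. Y n \<in> S" using Y(1) by simp
    then obtain y r where y: "y \<in> S" "strict_mono r" "(Y \<circ> r) \<longlonglongrightarrow> y"
      using compact_imp_seq_compact[OF S(1)] by (elim seq_compactE)
    have Yr: "(\<lambda>n. Y (r n)) \<longlonglongrightarrow> y" using y(3) by (simp add: comp_def)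
    have sr: "(\<lambda>n. \<sigma> (r n) w) \<longlonglongrightarrow> f w" for w
      using LIMSEQ_subseq_LIMSEQ[OF \<sigma>(2) y(2)] by (simp add: comp_def)
    have "(\<lambda>n. \<sigma> (r n) (Y (r n)) - d x (Y (r n))) \<longlonglongrightarrow> f y - d x y"
      by (intro tendsto_diff lip_tendsto_moving[OF lip Yr sr] tendsto_d(1)[OF Yr])
    then have "f x \<le> f y - d x y" by (rule LIMSEQ_le[OF sr]) (use Y(2) in blast)
    \<comment> \<open>For \<open>f = k - d y x\<close> the inequality reads
      \<open>k \<le> k - d y x - d x y\<close>, which is impossible because \<open>d x y\<close> is
      positive on the shell.\<close>
    then show False using S(2)[OF y(1)] d_nonneg[of y x] unfolding eq by simp
  qed
  then show "f \<in> boundary_functions" using fB unfolding boundary_functions_def by blast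
qed

lemma boundary_M_B_eq: "boundary_M_B A g0 \<omega> = subtopology (M_B A g0 \<omega>) (cls ` boundary_functions)"
proof -
  have iff: "cls b \<in> range (M_embedding A g0 \<omega>) \<longleftrightarrow> (\<exists>x k. b = (\<lambda>y. k - d y x))" if b: "b \<in> BB" for b
  proof -
    have "cls (\<lambda>y. - d y x) = cls b \<longleftrightarrow> (\<exists>k. b = (\<lambda>y. k - d y x))" for x
      unfolding cls_eq_iff[OF b] by (auto simp: fun_eq_iff)
    then show ?thesis unfolding M_embedding_def by (auto simp: image_iff eq_commute)
  qed
  have "topspace (M_B A g0 \<omega>) - range (M_embedding A g0 \<omega>) = cls ` boundary_functions"
    unfolding topspace_M_B boundary_functions_def using iff by auto
  then show ?thesis unfolding boundary_M_B_def by simp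
qed

lemma TIP_iff: "TIP A g0 \<omega> P \<longleftrightarrow> P \<in> insert UNIV (busemann_past ` boundary_functions)"
proof -
  have PIP: "PIP A g0 \<omega> P \<longleftrightarrow> (\<exists>x k. P = busemann_past (\<lambda>y. k - d y x))" for P
    unfolding PIP_def using IP_past by (auto simp: past_eq)
  show ?thesis
  proof
    assume P: "TIP A g0 \<omega> P"
    then have "IP A g0 \<omega> P" unfolding TIP_def by simp
    then show "P \<in> insert UNIV (busemann_past ` boundary_functions)"
    proof (cases rule: IP_cases)
      case (2 b)
      then have "b \<in> boundary_functions" using P unfolding TIP_def PIP boundary_functions_def by blast
      then show ?thesis using 2(2) by blast
    qed simp
  next
    assume "P \<in> insert UNIV (busemann_past ` boundary_functions)"
    then consider "P = UNIV" | b where "b \<in> boundary_functions" "P = busemann_past b" by blast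
    then show "TIP A g0 \<omega> P"
    proof cases
      case 1
      then show ?thesis unfolding TIP_def PIP using IP_UNIV busemann_past_neq_UNIV by metis
    next
      case (2 b)
      have "IP A g0 \<omega> P" using 2 B_plus_iff_IP unfolding boundary_functions_def by simp
      moreover have "\<not> PIP A g0 \<omega> P"
        using 2 unfolding PIP boundary_functions_def by (simp add: busemann_past_inject)
      ultimately show ?thesis unfolding TIP_def by simp
    qed
  qed
qed

lemma busemann_cone_B_plus: "busemann_cone A g0 \<omega> BB"
proof
  show "closedin (top_of_set BB) BB" by (metis closedin_topspace topspace_euclidean_subtopology)
qed (simp_all add: B_plus_shift)

lemma busemann_cone_boundary: "busemann_cone A g0 \<omega> boundary_functions"
proof
  show sub: "boundary_functions \<subseteq> BB" unfolding boundary_functions_def by blast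
  show "closedin (top_of_set BB) boundary_functions"
    using closed_boundary_functions sub by (simp add: closed_subset)
  fix b l assume b: "b \<in> boundary_functions"
  have "(\<lambda>y. b y + l) \<noteq> (\<lambda>y. k - d y x)" for x k
  proof
    assume "(\<lambda>y. b y + l) = (\<lambda>y. k - d y x)"
    then have "b y + l = k - d y x" for y by (rule fun_cong)
    then have "b = (\<lambda>y. (k - l) - d y x)" by (intro ext) (simp add: algebra_simps eq_diff_eq)
    then show False using b unfolding boundary_functions_def by blast
  qed
  then show "(\<lambda>y. b y + l) \<in> boundary_functions"
    using b B_plus_shift unfolding boundary_functions_def by blast
qed

lemma future_completion_cone:
  "\<exists>\<Theta>. homeomorphic_map (cone_space (M_B A g0 \<omega>)) (future_completion A g0 \<omega>) \<Theta> \<and>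
     \<Theta> (cone_apex (M_B A g0 \<omega>)) = i_plus \<and>
     (\<forall>b\<in>BB. \<Theta> (cone_class (M_B A g0 \<omega>) (ereal (b x0), cls b)) = busemann_past b)"
proof -
  interpret busemann_cone A g0 \<omega> BB x0 by (rule busemann_cone_B_plus)
  have base: "base = M_B A g0 \<omega>"
    using topspace_M_B by (metis subtopology_topspace)
  have "insert UNIV (busemann_past ` BB) = topspace (future_completion A g0 \<omega>)"
    unfolding topspace_future_completion using IP_UNIV by (auto simp: B_plus_iff_IP elim: IP_cases)
  then have ps: "past_space = future_completion A g0 \<omega>" by simp
  show ?thesis
    using homeomorphic_cone_map cone_map_apex cone_map_cone_point cone_class_cone_point
    unfolding base ps i_plus_def by (intro exI[of _ cone_map]) (simp add: cone_point_def)
qed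

lemma future_boundary_cone:
  "\<exists>\<Theta>. homeomorphic_map (cone_space (boundary_M_B A g0 \<omega>)) (future_boundary A g0 \<omega>) \<Theta> \<and>
     \<Theta> (cone_apex (boundary_M_B A g0 \<omega>)) = i_plus \<and>
     (\<forall>b\<in>BB. cls b \<in> topspace (boundary_M_B A g0 \<omega>) \<longrightarrow>
       \<Theta> (cone_class (boundary_M_B A g0 \<omega>) (ereal (b x0), cls b)) = busemann_past b)"
proof -
  interpret busemann_cone A g0 \<omega> boundary_functions x0 by (rule busemann_cone_boundary)
  have ps: "past_space = future_boundary A g0 \<omega>"
    unfolding future_boundary_def using TIP_iff by (metis Collect_mem_eq Collect_cong)
  show ?thesis
    using homeomorphic_cone_map cone_map_apex cone_map_cone_point cone_class_cone_point
    unfolding boundary_M_B_eq[symmetric] ps i_plus_def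
    by (intro exI[of _ cone_map]) (simp add: cone_point_def)
qed

end

lemma (in stationary_data) fermat_causality: "fermat_causality A g0 \<omega>"
  by unfold_locales
    (fact fermat_dist_nonneg fermat_dist_self fermat_dist_triangle fermat_dist_local fermat_dist_shell
      fermat_chronological_iff fermat_C_plus_less fermat_C_plus_chain)+

theorem theorem6p26:
  fixes A :: "('m::{t2_space, second_countable_topology}, 'e::euclidean_space) chart set"
    and g0 :: "'m \<Rightarrow> ('m, 'e) tvec \<Rightarrow> ('m, 'e) tvec \<Rightarrow> real"
    and \<omega> :: "'m \<Rightarrow> ('m, 'e) tvec \<Rightarrow> real"
  assumes "connected (UNIV :: 'm set)"
    and "smooth_atlas A"
    and "riemannian_metric A g0"
    and "one_form A \<omega>"
    and "Hausdorff_space (M_B A g0 \<omega>)"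
  shows "(\<forall>x0. homeomorphic_map (B_topology A g0 \<omega>) (prod_topology euclideanreal (M_B A g0 \<omega>))
           (\<lambda>b. (b x0, B_class A g0 \<omega> b))) \<and>
         (\<forall>x0. \<exists>\<Theta>. homeomorphic_map (cone_space (M_B A g0 \<omega>)) (future_completion A g0 \<omega>) \<Theta> \<and>
           \<Theta> (cone_apex (M_B A g0 \<omega>)) = i_plus \<and>
           (\<forall>b\<in>B_plus A g0 \<omega>.
              \<Theta> (cone_class (M_B A g0 \<omega>) (ereal (b x0), B_class A g0 \<omega> b)) = busemann_past b)) \<and>
         (\<forall>x0. \<exists>\<Theta>. homeomorphic_map (cone_space (boundary_M_B A g0 \<omega>)) (future_boundary A g0 \<omega>) \<Theta> \<and>
           \<Theta> (cone_apex (boundary_M_B A g0 \<omega>)) = i_plus \<and>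
           (\<forall>b\<in>B_plus A g0 \<omega>. B_class A g0 \<omega> b \<in> topspace (boundary_M_B A g0 \<omega>) \<longrightarrow>
              \<Theta> (cone_class (boundary_M_B A g0 \<omega>) (ereal (b x0), B_class A g0 \<omega> b)) = busemann_past b))"
proof -
  have "stationary_data A g0 \<omega>" using assms(1-4) by unfold_locales
  then interpret fermat_causality A g0 \<omega> by (rule stationary_data.fermat_causality)
  interpret fermat_causality_Hausdorff A g0 \<omega> using assms(5) by unfold_locales
  show ?thesis
    using homeomorphic_eval_cls future_completion_cone future_boundary_cone by blast
qed

end
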